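(* Let $n\ge 1$ be an integer and let $0<\epsilon<1$ be irrational. Let $L_{A_n}=\{z\in\mathbb{C}^3 : z_0^{n+1}+2z_1z_2=0\}\cap S^5$, where $S^5\subset\mathbb{C}^3$ is the unit sphere. Let $H(z)=|z|^2+\epsilon(|z_1|^2-|z_2|^2)$ and let $$\alpha_\epsilon=\frac{1}{H}\left[\frac{(n+1)i}{8}\left(z_0d\bar z_0-\bar z_0dz_0\right)+\frac{i}{4}\left(z_1d\bar z_1-\bar z_1dz_1+z_2d\bar z_2-\bar z_2dz_2\right)\right]\bigg|_{L_{A_n}},\qquad \alpha_0=\frac{i}{2}\sum_{j=0}^{2}\left(z_jd\bar z_j-\bar z_jdz_j\right)\bigg|_{L_{A_n}}.$$ Then: (1) $\alpha_\epsilon$ is a nondegenerate contact form on $L_{A_n}$, and $(L_{A_n},\ker\alpha_0)$ and $(L_{A_n},\ker\alpha_\epsilon)$ are contactomorphic. (2) The simple Reeb orbits of the Reeb vector field $R_{\alpha_\epsilon}$ (up to reparametrization by translation) are $$\gamma_+(t)=(0,e^{2i(1+\epsilon)t},0),\quad 0\le t\le\frac{\pi}{1+\epsilon},\qquad \gamma_-(t)=(0,0,e^{2i(1-\epsilon)t}),\quad 0\le t\le\frac{\pi}{1-\epsilon}.$$ (3) For every integer $N\ge1$, the Conley-Zehnder index of the $N$-fold iterate $\gamma_\pm^N$ (defined on $0\le t\le\frac{N\pi}{1\pm\epsilon}$), computed with respect to the canonical trivialization of $\mathbb{C}^3$, is $$\mu_{CZ}(\gamma_\pm^N)=2\left(\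left\lfloor\frac{2N}{(n+1)(1\pm\epsilon)}\right\rfloor+\left\lfloor\frac{N(1\mp\epsilon)}{1\pm\epsilon}\right\rfloor-\left\lfloor\frac{2N}{1\pm\epsilon}\right\rfloor\right)+2N+1.$$
   Context: A contact form on a $3$-manifold $M$ is a $1$-form $\alpha$ with $\alpha\wedge d\alpha\neq0$ everywhere; its contact structure is $\xi=\ker\alpha$. Contact manifolds $(M_0,\xi_0),(M_1,\xi_1)$ are contactomorphic if there is a diffeomorphism $\psi:M_0\to M_1$ with $\psi_*\xi_0=\xi_1$. The Reeb vector field $R_\alpha$ is determined by $\alpha(R_\alpha)=1$, $\iota_{R_\alpha}d\alpha=0$, with flow $\varphi_t$. A Reeb orbit of period $T$ is a map $\gamma:\mathbb{R}/T\mathbb{Z}\to M$ with $\dot\gamma=R_\alpha\circ\gamma$, considered up to translation of the domain; it is simple if $\gamma$ is injective. The iterate $\gamma^N$ is the composition of $\gamma$ with $\mathbb{R}/NT\mathbb{Z}\to\mathbb{R}/T\mathbb{Z}$. A Reeb orbit is nondegenerate if $d(\varphi_T)_{\gamma(0)}:\xi_{\gamma(0)}\to\xi_{\gamma(0)}$ has no eigenvalue equal to $1$; $\alpha$ is nondegenerate if all its Reeb orbits (including iterates) are nondegenerate. Conley-Zehnder index: for a continuous path $\Phi:[0,T]\to \mathrm{Sp}(2m)$ with $\Phi(0)=\mathrm{Id}$ and $\det(\mathrm{Id}-\Phi(T))\ne0$, $\mu_{CZ}(\Phi)\in\mathbb{Z}$ is the usual Conley-Zehnder index (constant under homotopies of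 such paths; $\mu_{CZ}(\Phi\Psi)=\mu_{CZ}(\Psi)+2\mu(\Phi)$ for a loop $\Phi$ at the identity with Maslov index $\mu(\Phi)$; $\mu_{CZ}(\exp(J_0St))=\frac12\mathrm{sgn}(S)$, $0\le t\le 1$, for $S$ symmetric nondegenerate with $\|S\|<2\pi$). With this normalization $\{e^{it}\}_{0\le t\le T}$ has index $2\lfloor T/2\pi\rfloor+1$ for $T\notin2\pi\mathbb{Z}$. The index $\mu_{CZ}(\gamma)$ of a nondegenerate Reeb orbit is the index of the path $d\varphi_t|_\xi$, $0\le t\le T$, written in a symplectic trivialization of $\xi$ along $\gamma$. Here the trivialization is the one induced by the canonical trivialization of $\mathbb{C}^3$: with the symplectic form $\omega_1=\frac{i(n+1)}{4}dz_0\wedge d\bar z_0+\frac i2\sum_{j=1}^2dz_j\wedge d\bar z_j$, the trivialization of $\xi$ along $\gamma$ is such that its direct sum with the frame of the symplectic complement of $\xi$ obtained from $X_1=(\bar z_0^n,\bar z_2,\bar z_1)$, $iX_1$, $R_{\alpha_\epsilon}$ and the radial vector $z$ is homotopic to the constant trivialization of $\mathbb{C}^3$. (Along $\gamma_\pm$ one has $\xi=\mathbb{C}\times\{0\}\times\{0\}$ and this is the constant trivialization by the $z_0$-coordinate.) *)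

theory Defs
  imports "HOL-Analysis.Analysis"
begin

section \<open>Smooth maps and submanifolds of Euclidean space\<close>

fun higher_differentiable_on ::
    "'a::euclidean_space set \<Rightarrow> ('a \<Rightarrow> 'b::real_normed_vector) \<Rightarrow> nat \<Rightarrow> bool" where
  "higher_differentiable_on S f 0 \<longleftrightarrow> continuous_on S f"
| "higher_differentiable_on S f (Suc k) \<longleftrightarrow>
     (\<forall>x\<in>S. f differentiable (at x)) \<and>
     (\<forall>v. higher_differentiable_on S (\<lambda>x. frechet_derivative f (at x) v) k)"

text \<open>Used for open \<open>S\<close> only.\<close>

definition smooth_on :: "'a::euclidean_space set \<Rightarrow> ('a \<Rightarrow> 'b::real_normed_vector) \<Rightarrow> bool" where
  "smooth_on S f \<longleftrightarrow> (\<forall>k. higher_differentiable_on S f k)"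

text \<open>Embedded submanifolds of dimension \<open>k\<close>, by local defining functions: near each of its
  points, \<open>M\<close> is the common zero set of \<open>DIM('a) - k\<close> smooth functions whose differentials
  are linearly independent at that point.\<close>

definition smooth_submanifold :: "nat \<Rightarrow> 'a::euclidean_space set \<Rightarrow> bool" where
  "smooth_submanifold k M \<longleftrightarrow> k \<le> DIM('a) \<and>
     (\<forall>x\<in>M. \<exists>U. \<exists>F :: nat \<Rightarrow> 'a \<Rightarrow> real. open U \<and> x \<in> U \<and>
        (\<forall>i < DIM('a) - k. smooth_on U (F i)) \<and>
        M \<inter> U = {y \<in> U. \<forall>i < DIM('a) - k. F i y = 0} \<and>
        (\<forall>a. (\<forall>v. (\<Sum>i < DIM('a) - k. a i * frechet_derivative (F i) (at x) v) = 0)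
              \<longrightarrow> (\<forall>i < DIM('a) - k. a i = 0)))"

text \<open>Velocities at \<open>z\<close> of curves in \<open>M\<close>. On a submanifold it makes no difference whether the
  curves are required to be smooth or, as here, only differentiable at the parameter \<open>0\<close>.\<close>

definition tangent_space :: "'a::euclidean_space set \<Rightarrow> 'a \<Rightarrow> 'a set" where
  "tangent_space M z = {v. \<exists>c :: real \<Rightarrow> 'a. (\<forall>s. c s \<in> M) \<and> c 0 = z \<and>
                              (c has_vector_derivative v) (at 0)}"

definition smooth_map_on :: "'a::euclidean_space set \<Rightarrow> ('a \<Rightarrow> 'b::euclidean_space) \<Rightarrow> bool" where
  "smooth_map_on M f \<longleftrightarrow>
     (\<forall>x\<in>M. \<exists>U F. open U \<and> x \<in> U \<and> smooth_on U F \<and> (\<forall>y \<in> M \<inter> U. F y = f y))"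

definition diffeomorphism ::
    "'a::euclidean_space set \<Rightarrow> 'b::euclidean_space set \<Rightarrow> ('a \<Rightarrow> 'b) \<Rightarrow> bool" where
  "diffeomorphism M N f \<longleftrightarrow>
     bij_betw f M N \<and> smooth_map_on M f \<and> smooth_map_on N (inv_into M f)"

text \<open>The value of \<open>frechet_derivative f (at z within M)\<close> is unspecified transversally to \<open>M\<close>,
  but on vectors of \<open>tangent_space M z\<close> any two derivatives within \<open>M\<close> agree. It is only
  ever applied to tangent vectors.\<close>

abbreviation tangent_map ::
    "'a::euclidean_space set \<Rightarrow> ('a \<Rightarrow> 'b::euclidean_space) \<Rightarrow> 'a \<Rightarrow> 'a \<Rightarrow> 'b" where
  "tangent_map M f z \<equiv> frechet_derivative f (at z within M)"

section \<open>Contact forms\<close>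

text \<open>A form on \<open>M\<close> is given as the restriction to \<open>TM\<close> of a smooth form \<open>\<alpha>\<close> defined on a
  neighbourhood of \<open>M\<close>; the first argument of \<open>\<alpha>\<close> is the base point. Since \<open>d\<close> commutes with
  restriction, \<open>d\<alpha>\<close> may be computed in the ambient space.\<close>

type_synonym 'a one_form = "'a \<Rightarrow> 'a \<Rightarrow> real"

definition smooth_one_form_on :: "'a::euclidean_space set \<Rightarrow> 'a one_form \<Rightarrow> bool" where
  "smooth_one_form_on U \<alpha> \<longleftrightarrow> (\<forall>z\<in>U. linear (\<alpha> z)) \<and> (\<forall>v. smooth_on U (\<lambda>z. \<alpha> z v))"

definition ext_deriv :: "'a::euclidean_space one_form \<Rightarrow> 'a \<Rightarrow> 'a \<Rightarrow> 'a \<Rightarrow> real" where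
  "ext_deriv \<alpha> z u v =
     frechet_derivative (\<lambda>w. \<alpha> w v) (at z) u - frechet_derivative (\<lambda>w. \<alpha> w u) (at z) v"

definition wedge_deriv :: "'a::euclidean_space one_form \<Rightarrow> 'a \<Rightarrow> 'a \<Rightarrow> 'a \<Rightarrow> 'a \<Rightarrow> real" where
  "wedge_deriv \<alpha> z u v w =
     \<alpha> z u * ext_deriv \<alpha> z v w - \<alpha> z v * ext_deriv \<alpha> z u w + \<alpha> z w * ext_deriv \<alpha> z u v"

definition contact_form :: "'a::euclidean_space set \<Rightarrow> 'a one_form \<Rightarrow> bool" where
  "contact_form M \<alpha> \<longleftrightarrow> smooth_submanifold 3 M \<and>
     (\<exists>U. open U \<and> M \<subseteq> U \<and> smooth_one_form_on U \<alpha>) \<and>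
     (\<forall>z\<in>M. \<exists>u \<in> tangent_space M z. \<exists>v \<in> tangent_space M z. \<exists>w \<in> tangent_space M z.
        wedge_deriv \<alpha> z u v w \<noteq> 0)"

definition contact_structure :: "'a::euclidean_space set \<Rightarrow> 'a one_form \<Rightarrow> 'a \<Rightarrow> 'a set" where
  "contact_structure M \<alpha> z = {v \<in> tangent_space M z. \<alpha> z v = 0}"

text \<open>Contactomorphism of \<open>(M, ker \<alpha>)\<close> and \<open>(N, ker \<beta>)\<close>.\<close>

definition contactomorphic ::
    "'a::euclidean_space set \<Rightarrow> 'a one_form \<Rightarrow> 'b::euclidean_space set \<Rightarrow> 'b one_form \<Rightarrow> bool" where
  "contactomorphic M \<alpha> N \<beta> \<longleftrightarrow> contact_form M \<alpha> \<and> contact_form N \<beta> \<and>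
     (\<exists>\<psi>. diffeomorphism M N \<psi> \<and>
        (\<forall>z\<in>M. tangent_map M \<psi> z ` contact_structure M \<alpha> z = contact_structure N \<beta> (\<psi> z)))"

section \<open>Reeb dynamics\<close>

definition reeb :: "'a::euclidean_space set \<Rightarrow> 'a one_form \<Rightarrow> 'a \<Rightarrow> 'a" where
  "reeb M \<alpha> z = (THE R. R \<in> tangent_space M z \<and> \<alpha> z R = 1 \<and>
                          (\<forall>v \<in> tangent_space M z. ext_deriv \<alpha> z R v = 0))"

definition reeb_trajectory ::
    "'a::euclidean_space set \<Rightarrow> 'a one_form \<Rightarrow> (real \<Rightarrow> 'a) \<Rightarrow> bool" where
  "reeb_trajectory M \<alpha> c \<longleftrightarrow>
     (\<forall>t. c t \<in> M \<and> (c has_vector_derivative reeb M \<alpha> (c t)) (at t))"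

definition reeb_flow :: "'a::euclidean_space set \<Rightarrow> 'a one_form \<Rightarrow> real \<Rightarrow> 'a \<Rightarrow> 'a" where
  "reeb_flow M \<alpha> t z = (THE c. reeb_trajectory M \<alpha> c \<and> c 0 = z) t"

text \<open>Maps from the circle of length \<open>T\<close> are encoded as \<open>T\<close>-periodic functions on the reals. The
  \<open>N\<close>-fold iterate of an orbit is then the same function, with period \<open>N * T\<close>.\<close>

definition reeb_orbit ::
    "'a::euclidean_space set \<Rightarrow> 'a one_form \<Rightarrow> real \<Rightarrow> (real \<Rightarrow> 'a) \<Rightarrow> bool" where
  "reeb_orbit M \<alpha> T \<gamma> \<longleftrightarrow> 0 < T \<and> reeb_trajectory M \<alpha> \<gamma> \<and> (\<forall>t. \<gamma> (t + T) = \<gamma> t)"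

definition simple_reeb_orbit ::
    "'a::euclidean_space set \<Rightarrow> 'a one_form \<Rightarrow> real \<Rightarrow> (real \<Rightarrow> 'a) \<Rightarrow> bool" where
  "simple_reeb_orbit M \<alpha> T \<gamma> \<longleftrightarrow> reeb_orbit M \<alpha> T \<gamma> \<and> inj_on \<gamma> {0..<T}"

definition nondegenerate_orbit ::
    "'a::euclidean_space set \<Rightarrow> 'a one_form \<Rightarrow> real \<Rightarrow> (real \<Rightarrow> 'a) \<Rightarrow> bool" where
  "nondegenerate_orbit M \<alpha> T \<gamma> \<longleftrightarrow>
     \<not> (\<exists>v \<in> contact_structure M \<alpha> (\<gamma> 0). v \<noteq> 0 \<and> tangent_map M (reeb_flow M \<alpha> T) (\<gamma> 0) v = v)"

definition nondegenerate_contact_form :: "'a::euclidean_space set \<Rightarrow> 'a one_form \<Rightarrow> bool" where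
  "nondegenerate_contact_form M \<alpha> \<longleftrightarrow> contact_form M \<alpha> \<and>
     (\<forall>T \<gamma>. reeb_orbit M \<alpha> T \<gamma> \<longrightarrow> nondegenerate_orbit M \<alpha> T \<gamma>)"

section \<open>The Conley-Zehnder index\<close>

text \<open>Matrices of size \<open>2m\<close> are indexed by \<open>'m + 'm\<close>: \<open>Inl p\<close> is the coordinate \<open>x\<^sub>p\<close> and
  \<open>Inr p\<close> the coordinate \<open>y\<^sub>p\<close>. The matrix \<open>J0\<close> is multiplication by \<open>\<i>\<close> on \<open>x + \<i> y\<close>.\<close>

type_synonym 'm sq_matrix = "real ^ ('m + 'm) ^ ('m + 'm)"

definition J0 :: "'m::finite sq_matrix" where
  "J0 = (\<chi> i j. case (i, j) of
            (Inl p, Inr q) \<Rightarrow> (if p = q then - 1 else 0)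
          | (Inr p, Inl q) \<Rightarrow> (if p = q then 1 else 0)
          | _ \<Rightarrow> 0)"

definition Sp :: "'m::finite sq_matrix set" where
  "Sp = {A. transpose A ** J0 ** A = J0}"

text \<open>The orthogonal factor of the polar decomposition \<open>A = P U\<close>. For symplectic \<open>A\<close> it is
  \<open>U = [[X, -Y], [Y, X]]\<close> with \<open>X + \<i> Y\<close> unitary, and \<open>rho A\<close> is \<open>det (X + \<i> Y)\<close>.\<close>

definition polar_unitary :: "'m::finite sq_matrix \<Rightarrow> 'm sq_matrix" where
  "polar_unitary A = (THE U. orthogonal_matrix U \<and>
     (\<exists>P. transpose P = P \<and> (\<forall>v. v \<noteq> 0 \<longrightarrow> 0 < v \<bullet> (P *v v)) \<and> A = P ** U))"

definition rho :: "'m::finite sq_matrix \<Rightarrow> complex" where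
  "rho A = det ((\<chi> p q. Complex (polar_unitary A $ Inl p $ Inl q)
                                (polar_unitary A $ Inr p $ Inl q)) :: complex ^ 'm ^ 'm)"

text \<open>The end points \<open>W\<^sup>+ = -1\<close> and \<open>W\<^sup>- = diag(2, -1, \<dots>, -1; 1/2, -1, \<dots>, -1)\<close> in the
  two components of \<open>{A \<in> Sp. det (1 - A) \<noteq> 0}\<close>; the hyperbolic block of \<open>W\<^sup>-\<close> may sit at any
  index \<open>k\<close>.\<close>

definition W_plus :: "'m::finite sq_matrix" where
  "W_plus = - mat 1"

definition W_minus :: "'m::finite \<Rightarrow> 'm sq_matrix" where
  "W_minus k = (\<chi> i j. if i \<noteq> j then 0
                        else if i = Inl k then 2
                        else if i = Inr k then 1 / 2
                        else - 1)"

text \<open>Definition of Salamon and Zehnder, for paths \<open>\<Phi>\<close> on \<open>{0..T}\<close> in \<open>Sp\<close> with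
  \<open>\<Phi> 0 = 1\<close> and \<open>det (1 - \<Phi> T) \<noteq> 0\<close>: extend \<open>\<Phi>\<close>, without crossing \<open>{A. det (1 - A) = 0}\<close>, to
  a path \<open>\<Psi>\<close> that ends at \<open>W\<^sup>+\<close> or \<open>W\<^sup>-\<close>; the index is the degree of the loop \<open>rho\<^sup>2 \<circ> \<Psi>\<close>.
  Here \<open>\<theta>\<close> is a continuous choice of angle of this loop, in units of full turns.\<close>

definition cz_index :: "real \<Rightarrow> (real \<Rightarrow> 'm::finite sq_matrix) \<Rightarrow> int" where
  "cz_index T \<Phi> = (THE k. \<exists>\<Psi> \<theta>.
      continuous_on {0..T + 1} \<Psi> \<and> (\<forall>t \<in> {0..T}. \<Psi> t = \<Phi> t) \<and>
      (\<forall>t \<in> {0..T + 1}. \<Psi> t \<in> Sp) \<and>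
      (\<forall>t \<in> {T..T + 1}. det (mat 1 - \<Psi> t) \<noteq> 0) \<and>
      \<Psi> (T + 1) \<in> insert W_plus (range W_minus) \<and>
      continuous_on {0..T + 1} \<theta> \<and>
      (\<forall>t \<in> {0..T + 1}. (rho (\<Psi> t))\<^sup>2 = cis (2 * pi * \<theta> t)) \<and>
      \<theta> (T + 1) - \<theta> 0 = of_int k)"

text \<open>\<open>b $ Inl p, b $ Inr p\<close> are the vectors \<open>e\<^sub>p, f\<^sub>p\<close> of a symplectic basis, with
  \<open>\<omega>(e\<^sub>p, f\<^sub>p) = 1\<close>. The signs come from \<open>dx \<and> dy (u, v) = u \<bullet> (- J0 *v v)\<close>.\<close>

definition symplectic_frame ::
    "('a \<Rightarrow> 'a \<Rightarrow> real) \<Rightarrow> 'a ^ ('m::finite + 'm) \<Rightarrow> bool" where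
  "symplectic_frame \<omega> b \<longleftrightarrow> (\<forall>i j. \<omega> (b $ i) (b $ j) = - (J0 $ i $ j))"

definition symplectic_trivialization ::
    "'a::euclidean_space set \<Rightarrow> 'a one_form \<Rightarrow> real \<Rightarrow> (real \<Rightarrow> 'a)
     \<Rightarrow> (real \<Rightarrow> 'a ^ ('m::finite + 'm)) \<Rightarrow> bool" where
  "symplectic_trivialization M \<alpha> T \<gamma> b \<longleftrightarrow> continuous_on UNIV b \<and>
     (\<forall>t. b (t + T) = b t \<and> symplectic_frame (ext_deriv \<alpha> (\<gamma> t)) (b t) \<and>
          span (range (\<lambda>i. b t $ i)) = contact_structure M \<alpha> (\<gamma> t))"

definition linearized_flow ::
    "'a::euclidean_space set \<Rightarrow> 'a one_form \<Rightarrow> (real \<Rightarrow> 'a)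
     \<Rightarrow> (real \<Rightarrow> 'a ^ ('m::finite + 'm)) \<Rightarrow> real \<Rightarrow> 'm sq_matrix" where
  "linearized_flow M \<alpha> \<gamma> b t = (THE A. \<forall>j.
     tangent_map M (reeb_flow M \<alpha> t) (\<gamma> 0) (b 0 $ j) = (\<Sum>i\<in>UNIV. A $ i $ j *\<^sub>R b t $ i))"

section \<open>The link of the \<open>A\<^sub>n\<close> singularity\<close>

text \<open>The index type \<open>3\<close> has the elements \<open>0, 1, 2\<close>, so \<open>z $ j\<close> is \<open>z\<^sub>j\<close> for \<open>j = 0, 1, 2\<close>.\<close>

definition link_A :: "nat \<Rightarrow> (complex ^ 3) set" where
  "link_A n = {z. (z $ 0) ^ (n + 1) + 2 * z $ 1 * z $ 2 = 0} \<inter> sphere 0 1"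

definition H_eps :: "real \<Rightarrow> complex ^ 3 \<Rightarrow> real" where
  "H_eps \<epsilon> z = (norm z)\<^sup>2 + \<epsilon> * ((cmod (z $ 1))\<^sup>2 - (cmod (z $ 2))\<^sup>2)"

text \<open>In the following formulas \<open>dz\<^sub>j\<close> and its conjugate are evaluated on \<open>v\<close> as \<open>v $ j\<close> and
  \<open>cnj (v $ j)\<close>. The complex numbers whose \<open>Re\<close> is taken are real.\<close>

definition alpha_eps :: "nat \<Rightarrow> real \<Rightarrow> (complex ^ 3) one_form" where
  "alpha_eps n \<epsilon> z v = 1 / H_eps \<epsilon> z *
     Re ((of_nat n + 1) * \<i> / 8 * (z $ 0 * cnj (v $ 0) - cnj (z $ 0) * v $ 0)
       + \<i> / 4 * (z $ 1 * cnj (v $ 1) - cnj (z $ 1) * v $ 1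
                + z $ 2 * cnj (v $ 2) - cnj (z $ 2) * v $ 2))"

definition alpha_0 :: "(complex ^ 3) one_form" where
  "alpha_0 z v = Re (\<i> / 2 * (\<Sum>j\<in>UNIV. z $ j * cnj (v $ j) - cnj (z $ j) * v $ j))"

definition omega_1 :: "nat \<Rightarrow> complex ^ 3 \<Rightarrow> complex ^ 3 \<Rightarrow> real" where
  "omega_1 n u v =
     Re (\<i> * (of_nat n + 1) / 4 * (u $ 0 * cnj (v $ 0) - cnj (u $ 0) * v $ 0)
       + \<i> / 2 * (\<Sum>j\<in>{1, 2}. u $ j * cnj (v $ j) - cnj (u $ j) * v $ j))"

definition gamma_plus :: "real \<Rightarrow> real \<Rightarrow> complex ^ 3" where
  "gamma_plus \<epsilon> t = axis 1 (cis (2 * (1 + \<epsilon>) * t))"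

definition gamma_minus :: "real \<Rightarrow> real \<Rightarrow> complex ^ 3" where
  "gamma_minus \<epsilon> t = axis 2 (cis (2 * (1 - \<epsilon>) * t))"

section \<open>The canonical trivialization\<close>

definition X1 :: "nat \<Rightarrow> complex ^ 3 \<Rightarrow> complex ^ 3" where
  "X1 n z = (\<chi> j. if j = 0 then cnj (z $ 0) ^ n else if j = 1 then cnj (z $ 2) else cnj (z $ 1))"

text \<open>Symplectic Gram-Schmidt process: \<open>symp_reduce\<close> is the \<open>\<omega>\<close>-orthogonal projection onto the
  symplectic complement of a pair \<open>(e, f)\<close> with \<open>\<omega> e f = 1\<close>.\<close>

definition symp_reduce ::
    "('a::real_vector \<Rightarrow> 'a \<Rightarrow> real) \<Rightarrow> 'a \<times> 'a \<Rightarrow> 'a \<Rightarrow> 'a" where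
  "symp_reduce \<omega> p v = v - \<omega> v (snd p) *\<^sub>R fst p + \<omega> v (fst p) *\<^sub>R snd p"

definition symp_normalize ::
    "('a::real_vector \<Rightarrow> 'a \<Rightarrow> real) \<Rightarrow> 'a \<Rightarrow> 'a \<Rightarrow> 'a \<times> 'a" where
  "symp_normalize \<omega> u v = (u /\<^sub>R sqrt (\<omega> u v), v /\<^sub>R sqrt (\<omega> u v))"

definition pairs_frame :: "'a \<times> 'a \<Rightarrow> 'a \<times> 'a \<Rightarrow> 'a \<times> 'a \<Rightarrow> 'a ^ (3 + 3)" where
  "pairs_frame p q r =
     (let P = (\<lambda>j::3. if j = 0 then p else if j = 1 then q else r)
      in (\<chi> i. case i of Inl j \<Rightarrow> fst (P j) | Inr j \<Rightarrow> snd (P j)))"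

text \<open>The direct sum at \<open>z\<close> of a frame \<open>b\<close> of the contact structure with the frame of its
  symplectic complement obtained from \<open>X1, \<i> X1\<close> and \<open>z, R\<close>, where \<open>R\<close> is the Reeb vector field.
  The last two vectors are paired in this order since \<open>omega_1 n z R = 2 * H_eps \<epsilon> z > 0\<close>. The
  vectors of \<open>b\<close> are rescaled because \<open>omega_1\<close> is \<open>H_eps\<close> times the differential of
  \<open>alpha_eps\<close> on the contact structure.\<close>

definition sum_frame ::
    "nat \<Rightarrow> real \<Rightarrow> complex ^ 3 \<Rightarrow> (complex ^ 3) ^ (1 + 1) \<Rightarrow> (complex ^ 3) ^ (3 + 3)" where
  "sum_frame n \<epsilon> z b =
     (let \<omega> = omega_1 n;
          R = reeb (link_A n) (alpha_eps n \<epsilon>) z;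
          p = symp_normalize \<omega> (b $ Inl 1) (b $ Inr 1);
          q = symp_normalize \<omega> (symp_reduce \<omega> p (X1 n z)) (symp_reduce \<omega> p (\<i> *s X1 n z));
          r = symp_normalize \<omega> (symp_reduce \<omega> q (symp_reduce \<omega> p z))
                               (symp_reduce \<omega> q (symp_reduce \<omega> p R))
      in pairs_frame p q r)"

definition constant_frame :: "nat \<Rightarrow> (complex ^ 3) ^ (3 + 3)" where
  "constant_frame n =
     (let \<omega> = omega_1 n; E = (\<lambda>j. symp_normalize \<omega> (axis j 1) (axis j \<i>))
      in pairs_frame (E 0) (E 1) (E 2))"

text \<open>Homotopic means homotopic through loops of \<open>omega_1\<close>-symplectic frames (through arbitrary
  real frames the homotopy class would only be determined modulo 2).\<close>

definition canonical_trivialization ::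
    "nat \<Rightarrow> real \<Rightarrow> real \<Rightarrow> (real \<Rightarrow> complex ^ 3) \<Rightarrow> (real \<Rightarrow> (complex ^ 3) ^ (1 + 1)) \<Rightarrow> bool" where
  "canonical_trivialization n \<epsilon> T \<gamma> b \<longleftrightarrow>
     symplectic_trivialization (link_A n) (alpha_eps n \<epsilon>) T \<gamma> b \<and>
     homotopic_loops {F. symplectic_frame (omega_1 n) F}
       (\<lambda>s. sum_frame n \<epsilon> (\<gamma> (T * s)) (b (T * s))) (\<lambda>s. constant_frame n)"

text \<open>The index of the \<open>T\<close>-periodic orbit \<open>\<gamma>\<close> with respect to the canonical trivialization of
  \<open>\<complex>\<^sup>3\<close> is \<open>k\<close>: such trivializations along \<open>\<gamma>\<close> exist, and all of them give the index \<open>k\<close>.\<close>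

definition has_canonical_cz_index ::
    "nat \<Rightarrow> real \<Rightarrow> real \<Rightarrow> (real \<Rightarrow> complex ^ 3) \<Rightarrow> int \<Rightarrow> bool" where
  "has_canonical_cz_index n \<epsilon> T \<gamma> k \<longleftrightarrow>
     (\<exists>b. canonical_trivialization n \<epsilon> T \<gamma> b) \<and>
     (\<forall>b. canonical_trivialization n \<epsilon> T \<gamma> b \<longrightarrow>
        cz_index T (linearized_flow (link_A n) (alpha_eps n \<epsilon>) \<gamma> b) = k)"

end

theory Submission
  imports Defs
begin

text \<open>On the link, \<open>alpha_eps\<close> is the quotient by \<open>H\<close> of a primitive of \<open>omega_1\<close>, so its Reeb field is the Hamiltonian
  field of \<open>H\<close>: a diagonal rotation with frequencies \<open>4 / (n + 1)\<close>, \<open>2 (1 + \<epsilon>)\<close>, \<open>2 (1 - \<epsilon>)\<close>. For irrational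
  \<open>\<epsilon>\<close> a trajectory closes up only if one of \<open>z\<^sub>1\<close>, \<open>z\<^sub>2\<close> vanishes, and then \<open>z\<^sub>0 = 0\<close>.

  The two contact structures are invariant under the two-torus that acts on the link, and both contain the
  directions of constant phases. Such a structure is determined by its slope on the torus orbits, and a
  reparametrization of the interval of orbits, which keeps all phases, carries one slope function into the
  other. No isotopy (Gray stability) is needed.

  Along the closed orbits the contact plane is the \<open>z\<^sub>0\<close>-axis, on which the linearized flow is a rotation. A frame
  of this plane differs from the constant one by a loop in Sp(2). The determinant of the complex-linear part
  of a symplectic frame is a nonvanishing continuous function; it shows that this loop has winding
  number 0 if the frame is canonical, and then the angle of the complex-linear part of the conjugated rotation stays
  within a quarter turn of the angle of the rotation, up to the angles contributed by the loop.\<close>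

section \<open>Smoothness of composite functions\<close>

text \<open>The reparametrization has to be smooth at the two circles where the torus does not act
  freely. There the slope reaches 1 or -1, and as a function of p, the squared modulus of
  \<open>z $ 0\<close>, it is two-valued. The orbits are therefore matched through 1 -
  \<open>slope\<close>^2, a smooth function of p that vanishes at p = 0 with positive derivative and
  so has a smooth inverse; the sign is restored by the slope itself, which is smooth on the link.
  Both contact structures belong to one family, with weight (n + 1) (1 - c) / 2 at the coordinate 0:
  c = 0 gives \<open>alpha_eps\<close>, and c = (n - 1) / (n + 1) gives \<open>alpha_0\<close>.
  Exchanging the two parameters inverts the map. For the index, a two-by-two symplectic matrix of
  trace less than 2 never has \<open>rho\<close> equal to 1. While a path is extended past time T,
  the integer part of its angle in full turns is thus frozen, and this determines the index whatever
  extension is chosen. The second and third floors of the stated formula differ by exactly N, so the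
  number to be found is twice the floor of 2 N / ((n + 1) a), plus 1, with a = 1 + \<epsilon> or 1 -
  \<epsilon>.\<close>

lemma higher_differentiable_on_cong:
  assumes "open S" "\<And>x. x \<in> S \<Longrightarrow> f x = g x"
  shows "higher_differentiable_on S f k = higher_differentiable_on S g k"
  using assms(2)
proof (induction k arbitrary: f g)
  case 0
  then show ?case by (simp cong: continuous_on_cong)
next
  case (Suc k)
  have diff: "f differentiable (at x) \<longleftrightarrow> g differentiable (at x)" if "x \<in> S" for x
    using has_derivative_transform_within_open[OF _ assms(1) that, of f _ UNIV g]
      has_derivative_transform_within_open[OF _ assms(1) that, of g _ UNIV f] Suc.prems
    unfolding differentiable_def by (metis UNIV_I)
  have "frechet_derivative f (at x) = frechet_derivative g (at x)"
    if "x \<in> S" "f differentiable (at x)" for x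
    using frechet_derivative_transform_within_open[OF that(2) assms(1) that(1)] Suc.prems by blast
  then have "higher_differentiable_on S (\<lambda>x. frechet_derivative f (at x) v) k
      = higher_differentiable_on S (\<lambda>x. frechet_derivative g (at x) v) k"
    if "\<forall>x\<in>S. f differentiable (at x)" for v
    using that by (intro Suc.IH) auto
  then show ?case
    using diff by auto
qed

lemma higher_differentiable_on_SucI:
  assumes "open S" "\<And>x. x \<in> S \<Longrightarrow> (f has_derivative f' x) (at x)"
    and "\<And>v. higher_differentiable_on S (\<lambda>x. f' x v) k"
  shows "higher_differentiable_on S f (Suc k)"
proof -
  have "frechet_derivative f (at x) = f' x" if "x \<in> S" for x
    using assms(2)[OF that] frechet_derivative_at by metis
  then have "higher_differentiable_on S (\<lambda>x. frechet_derivative f (at x) v) k" for v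
    using assms(3)[of v] higher_differentiable_on_cong[OF assms(1),
      of "\<lambda>x. frechet_derivative f (at x) v" "\<lambda>x. f' x v" k] by simp
  then show ?thesis using assms(2) by (auto simp: differentiable_def)
qed

lemma higher_differentiable_on_SucD:
  assumes "higher_differentiable_on S f (Suc k)"
  shows "higher_differentiable_on S f k"
  using assms
proof (induction k arbitrary: f)
  case 0
  then show ?case
    by (auto intro!: differentiable_imp_continuous_on simp: differentiable_on_def differentiable_at_withinI)
next
  case (Suc k)
  then show ?case by (auto simp del: higher_differentiable_on.simps(1))
qed

lemma higher_differentiable_on_subset:
  assumes "higher_differentiable_on S f k" "T \<subseteq> S"
  shows "higher_differentiable_on T f k"
  using assms by (induction k arbitrary: f) (auto intro: continuous_on_subset)

lemma higher_differentiable_on_const: "higher_differentiable_on S (\<lambda>x. c) k"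
  by (induction k arbitrary: c) auto

lemma higher_differentiable_on_bounded_linear:
  assumes "open S" "bounded_linear f" shows "higher_differentiable_on S f k"
proof (cases k)
  case 0
  then show ?thesis using assms by (simp add: linear_continuous_on)
next
  case (Suc l)
  show ?thesis unfolding Suc
    by (rule higher_differentiable_on_SucI[OF assms(1), where f' = "\<lambda>x. f"])
       (use assms(2) in \<open>auto intro: bounded_linear_imp_has_derivative higher_differentiable_on_const\<close>)
qed

lemma higher_differentiable_on_Suc_derivative:
  assumes "higher_differentiable_on S f (Suc k)" "x \<in> S"
  shows "(f has_derivative frechet_derivative f (at x)) (at x)"
  using assms by (simp add: frechet_derivative_works)

lemma higher_differentiable_on_add:
  assumes "open S" "higher_differentiable_on S f k" "higher_differentiable_on S g k"
  shows "higher_differentiable_on S (\<lambda>x. f x + g x) k"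
  using assms(2,3)
proof (induction k arbitrary: f g)
  case 0
  then show ?case by (auto intro: continuous_intros)
next
  case (Suc k)
  show ?case
  proof (rule higher_differentiable_on_SucI[OF assms(1)])
    show "((\<lambda>x. f x + g x) has_derivative
       (\<lambda>v. frechet_derivative f (at x) v + frechet_derivative g (at x) v)) (at x)" if "x \<in> S" for x
      using Suc.prems that by (auto intro!: has_derivative_add higher_differentiable_on_Suc_derivative)
    show "higher_differentiable_on S (\<lambda>x. frechet_derivative f (at x) v + frechet_derivative g (at x) v) k" for v
      using Suc by auto
  qed
qed

lemma (in bounded_bilinear) higher_differentiable_on_prod:
  assumes "open S" "higher_differentiable_on S f k" "higher_differentiable_on S g k"
  shows "higher_differentiable_on S (\<lambda>x. prod (f x) (g x)) k"
  using assms(2,3)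
proof (induction k arbitrary: f g)
  case 0
  then show ?case by (auto intro: continuous_on)
next
  case (Suc k)
  show ?case
  proof (rule higher_differentiable_on_SucI[OF assms(1)])
    show "((\<lambda>x. prod (f x) (g x)) has_derivative
       (\<lambda>v. prod (f x) (frechet_derivative g (at x) v) + prod (frechet_derivative f (at x) v) (g x))) (at x)"
      if "x \<in> S" for x
      by (intro FDERIV higher_differentiable_on_Suc_derivative[OF Suc.prems(1) that]
          higher_differentiable_on_Suc_derivative[OF Suc.prems(2) that])
    show "higher_differentiable_on S (\<lambda>x. prod (f x) (frechet_derivative g (at x) v)
             + prod (frechet_derivative f (at x) v) (g x)) k" for v
      using Suc.prems higher_differentiable_on_SucD[OF Suc.prems(1)]
        higher_differentiable_on_SucD[OF Suc.prems(2)]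
      by (intro higher_differentiable_on_add[OF assms(1)] Suc.IH) auto
  qed
qed

text \<open>The derivative of a function of one real variable is multiplication by the number
  \<open>frechet_derivative g (at y) 1\<close>. The chain rule then yields a product of two
  functions, and the induction hypothesis applies to this number as a function of
  \<open>y\<close>.\<close>

lemma higher_differentiable_on_compose_real:
  fixes g :: "real \<Rightarrow> real"
  assumes "open S" "higher_differentiable_on S f k" "higher_differentiable_on T g k" "f ` S \<subseteq> T"
  shows "higher_differentiable_on S (\<lambda>x. g (f x)) k"
  using assms(2,3,4)
proof (induction k arbitrary: f g)
  case 0
  then show ?case by (auto intro: continuous_on_compose2)
next
  case (Suc k)
  have lin: "frechet_derivative g (at y) r = r * frechet_derivative g (at y) 1" if "y \<in> T" for y r
  proof -
    have "linear (frechet_derivative g (at y))"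
      using Suc.prems(2) that by (simp add: linear_frechet_derivative)
    then show ?thesis by (metis linear_scale mult.right_neutral real_scaleR_def)
  qed
  show ?case
  proof (rule higher_differentiable_on_SucI[OF assms(1)])
    show "((\<lambda>x. g (f x)) has_derivative
       (\<lambda>v. frechet_derivative f (at x) v * frechet_derivative g (at (f x)) 1)) (at x)"
      if x: "x \<in> S" for x
    proof -
      have "f x \<in> T" using x Suc.prems by auto
      then have "((\<lambda>x. g (f x)) has_derivative
         (\<lambda>v. frechet_derivative g (at (f x)) (frechet_derivative f (at x) v))) (at x)"
        using Suc.prems x
        by (intro has_derivative_compose[where f = f and g = g] higher_differentiable_on_Suc_derivative)
      then show ?thesis using lin[OF \<open>f x \<in> T\<close>] by (metis (no_types, lifting) ext)
    qed
    show "higher_differentiable_on S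
       (\<lambda>x. frechet_derivative f (at x) v * frechet_derivative g (at (f x)) 1) k" for v
      using Suc.prems higher_differentiable_on_SucD[OF Suc.prems(1)]
      by (intro bounded_bilinear.higher_differentiable_on_prod[OF bounded_bilinear_mult assms(1)]
          Suc.IH[where g = "\<lambda>y. frechet_derivative g (at y) 1"]) auto
  qed
qed

section \<open>Smoothness in a neighbourhood of a point\<close>

lemma higher_differentiable_on_local:
  assumes "\<And>x. x \<in> S \<Longrightarrow> \<exists>U. open U \<and> x \<in> U \<and> higher_differentiable_on U f k"
  shows "higher_differentiable_on S f k"
  using assms
proof (induction k arbitrary: f)
  case 0
  then show ?case
    by (auto intro!: continuous_at_imp_continuous_on) (metis continuous_on_eq_continuous_at)
next
  case (Suc k)
  have "\<exists>U. open U \<and> x \<in> U \<and> higher_differentiable_on U (\<lambda>x. frechet_derivative f (at x) v) k"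
    if "x \<in> S" for x v
    using Suc.prems[OF that] by auto
  then show ?case using Suc.IH Suc.prems by (metis higher_differentiable_on.simps(2))
qed

text \<open>Smoothness of germs. Closure rules then have side conditions at one point only, such as
  a nonzero denominator or a positive radicand, and no common domain has to be carried
  along.\<close>

definition smooth_near :: "'a::euclidean_space \<Rightarrow> ('a \<Rightarrow> 'b::real_normed_vector) \<Rightarrow> bool" where
  "smooth_near z f \<longleftrightarrow> (\<exists>U. open U \<and> z \<in> U \<and> smooth_on U f)"

lemma smooth_on_iff_smooth_near:
  assumes "open U"
  shows "smooth_on U f \<longleftrightarrow> (\<forall>z\<in>U. smooth_near z f)"
proof
  show "\<forall>z\<in>U. smooth_near z f" if "smooth_on U f" using that assms by (auto simp: smooth_near_def)
  assume *: "\<forall>z\<in>U. smooth_near z f"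
  show "smooth_on U f"
    unfolding smooth_on_def
  proof
    show "higher_differentiable_on U f k" for k
      by (rule higher_differentiable_on_local) (use * in \<open>auto simp: smooth_near_def smooth_on_def\<close>)
  qed
qed

lemma smooth_near_imp_differentiable:
  assumes "smooth_near z f" shows "f differentiable (at z)"
proof -
  obtain U where "open U" "z \<in> U" "higher_differentiable_on U f (Suc 0)"
    using assms unfolding smooth_near_def smooth_on_def by blast
  then show ?thesis by simp
qed

lemma smooth_near_open: "open {z. smooth_near z f}"
  unfolding smooth_near_def
  by (subst open_subopen) blast

lemma smooth_on_smooth_near_set: "smooth_on {z. smooth_near z f} f"
  by (subst smooth_on_iff_smooth_near[OF smooth_near_open]) simp

lemma smooth_near_const: "smooth_near z (\<lambda>x. c)"
  by (auto simp: smooth_near_def smooth_on_def higher_differentiable_on_const intro!: exI[of _ UNIV])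

lemma smooth_near_bounded_linear: "bounded_linear f \<Longrightarrow> smooth_near z f"
  by (auto simp: smooth_near_def smooth_on_def intro!: exI[of _ UNIV] higher_differentiable_on_bounded_linear)

lemma smooth_near_two:
  assumes "smooth_near z f" "smooth_near z g"
  obtains U where "open U" "z \<in> U" "smooth_on U f" "smooth_on U g"
proof -
  obtain V W where "open V" "z \<in> V" "smooth_on V f" "open W" "z \<in> W" "smooth_on W g"
    using assms by (auto simp: smooth_near_def)
  then show ?thesis
    by (intro that[of "V \<inter> W"]) (auto simp: smooth_on_def intro: higher_differentiable_on_subset)
qed

lemma smooth_near_add:
  assumes "smooth_near z f" "smooth_near z g" shows "smooth_near z (\<lambda>x. f x + g x)"
  by (rule smooth_near_two[OF assms])
     (auto simp: smooth_near_def smooth_on_def intro: higher_differentiable_on_add)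

lemma smooth_near_bilinear:
  assumes "bounded_bilinear p" "smooth_near z f" "smooth_near z g"
  shows "smooth_near z (\<lambda>x. p (f x) (g x))"
  by (rule smooth_near_two[OF assms(2,3)])
     (auto simp: smooth_near_def smooth_on_def
       intro: bounded_bilinear.higher_differentiable_on_prod[OF assms(1)])

lemmas smooth_near_mult = smooth_near_bilinear[OF bounded_bilinear_mult]
  and smooth_near_scaleR = smooth_near_bilinear[OF bounded_bilinear_scaleR]

lemma smooth_near_minus:
  assumes "smooth_near z f" shows "smooth_near z (\<lambda>x. - f x)"
  using smooth_near_scaleR[OF smooth_near_const[of z "-1"] assms] by simp

lemma smooth_near_diff:
  assumes "smooth_near z f" "smooth_near z g" shows "smooth_near z (\<lambda>x. f x - g x)"
  using smooth_near_add[OF assms(1) smooth_near_minus[OF assms(2)]] by simp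

lemma smooth_near_sum:
  assumes "\<And>i. i \<in> I \<Longrightarrow> smooth_near z (f i)" shows "smooth_near z (\<lambda>x. \<Sum>i\<in>I. f i x)"
proof (cases "finite I")
  case True
  then show ?thesis using assms
    by (induction I rule: finite_induct) (auto simp: smooth_near_const intro: smooth_near_add)
qed (simp add: smooth_near_const)

lemma smooth_near_power:
  fixes f :: "'a::euclidean_space \<Rightarrow> 'b::real_normed_field"
  assumes "smooth_near z f" shows "smooth_near z (\<lambda>x. f x ^ k)"
  by (induction k) (auto simp: smooth_near_const intro: smooth_near_mult assms)

lemma smooth_near_compose_real:
  fixes g :: "real \<Rightarrow> real"
  assumes "smooth_near z f" "smooth_near (f z) g"
  shows "smooth_near z (\<lambda>x. g (f x))"
proof -
  obtain U where U: "open U" "z \<in> U" "smooth_on U f" using assms(1) by (auto simp: smooth_near_def)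
  obtain T where T: "open T" "f z \<in> T" "smooth_on T g" using assms(2) by (auto simp: smooth_near_def)
  have "continuous_on U f" using U(3) unfolding smooth_on_def
    by (metis higher_differentiable_on.simps(1))
  then have op: "open (f -` T \<inter> U)"
    using T U continuous_on_open_vimage by blast
  have "smooth_on (f -` T \<inter> U) (\<lambda>x. g (f x))"
    unfolding smooth_on_def
  proof
    show "higher_differentiable_on (f -` T \<inter> U) (\<lambda>x. g (f x)) k" for k
      using U(3) T(3) higher_differentiable_on_subset[of U f k "f -` T \<inter> U"]
      by (intro higher_differentiable_on_compose_real[OF op _ _, where T = T and f = f and g = g and k = k])
         (auto simp: smooth_on_def)
  qed
  then show ?thesis using op U T by (auto simp: smooth_near_def)
qed

text \<open>The source of all smoothness statements about non-polynomial functions: reciprocals, square roots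
  and inverse functions all solve autonomous equations.\<close>

lemma smooth_on_autonomous:
  fixes g \<phi> :: "real \<Rightarrow> real"
  assumes "open T" "\<And>t. t \<in> T \<Longrightarrow> (g has_real_derivative \<phi> (g t)) (at t)"
    and "\<And>t. t \<in> T \<Longrightarrow> smooth_near (g t) \<phi>"
  shows "smooth_on T g"
  unfolding smooth_on_def
proof
  fix k show "higher_differentiable_on T g k"
  proof (induction k)
    case 0
    then show ?case using assms(2)
      by (auto intro!: continuous_at_imp_continuous_on DERIV_isCont)
  next
    case (Suc k)
    \<comment> \<open>Bootstrapping: the derivative of \<open>g\<close> is \<open>\<phi>\<close>
      composed with \<open>g\<close>, so \<open>k\<close> derivatives of \<open>g\<close> yield one
      more.\<close>
    show ?case
    proof (rule higher_differentiable_on_SucI[OF assms(1)])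
      show "(g has_derivative (\<lambda>v. v * \<phi> (g t))) (at t)" if "t \<in> T" for t
        using assms(2)[OF that] by (simp add: has_field_derivative_def mult_commute_abs)
      show "higher_differentiable_on T (\<lambda>t. v * \<phi> (g t)) k" for v
      proof (intro bounded_bilinear.higher_differentiable_on_prod[OF bounded_bilinear_mult assms(1)]
          higher_differentiable_on_const)
        show "higher_differentiable_on T (\<lambda>t. \<phi> (g t)) k"
          using assms(3) smooth_on_smooth_near_set[of \<phi>] unfolding smooth_on_def
          by (intro higher_differentiable_on_compose_real[OF assms(1) Suc]) auto
      qed
    qed
  qed
qed

lemma smooth_near_inverse_real:
  assumes "y \<noteq> (0::real)" shows "smooth_near y inverse"
proof -
  have "smooth_on (- {0}) (inverse :: real \<Rightarrow> real)"
    by (rule smooth_on_autonomous[where \<phi> = "\<lambda>y. - (y * y)"])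
       (auto intro!: derivative_eq_intros smooth_near_minus
          smooth_near_mult[OF smooth_near_bounded_linear smooth_near_bounded_linear]
          simp: bounded_linear_ident power2_eq_square divide_inverse)
  then show ?thesis unfolding smooth_near_def
    by (intro exI[of _ "- {0}"]) (use assms in \<open>auto simp: open_Compl\<close>)
qed

lemma smooth_near_divide:
  fixes f g :: "'a::euclidean_space \<Rightarrow> real"
  assumes "smooth_near z f" "smooth_near z g" "g z \<noteq> 0"
  shows "smooth_near z (\<lambda>x. f x / g x)"
  unfolding divide_inverse
  by (rule smooth_near_mult[OF assms(1)
        smooth_near_compose_real[OF assms(2) smooth_near_inverse_real[OF assms(3)]]])

lemma smooth_near_sqrt:
  fixes f :: "'a::euclidean_space \<Rightarrow> real"
  assumes "smooth_near z f" "0 < f z"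
  shows "smooth_near z (\<lambda>x. sqrt (f x))"
proof -
  have "smooth_on {0<..} sqrt"
  proof (rule smooth_on_autonomous[where \<phi> = "\<lambda>y. 1 / (2 * y)"])
    show "(sqrt has_real_derivative 1 / (2 * sqrt t)) (at t)" if "t \<in> {0<..}" for t
      using DERIV_real_sqrt[of t] that by (simp add: field_simps)
    show "smooth_near (sqrt t) (\<lambda>y. 1 / (2 * y))" if "t \<in> {0<..}" for t
      by (rule smooth_near_divide[OF smooth_near_const smooth_near_bounded_linear])
         (use that in \<open>auto intro: bounded_linear_mult_right\<close>)
  qed auto
  then have "smooth_near (f z) sqrt" unfolding smooth_near_def
    by (intro exI[of _ "{0<..}"]) (use assms(2) in simp)
  then show ?thesis using assms(1) by (rule smooth_near_compose_real[rotated])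
qed

section \<open>Coordinates of complex three-space\<close>

lemma UNIV_3': "(UNIV :: 3 set) = {0, 1, 2}"
  using UNIV_3 by auto

lemma sum_UNIV_3: "(\<Sum>j\<in>UNIV. f j) = f 0 + f 1 + f (2 :: 3)" for f :: "3 \<Rightarrow> 'a::comm_monoid_add"
  unfolding UNIV_3' by (simp add: add.assoc)

lemma forall_UNIV_3: "(\<forall>j :: 3. P j) \<longleftrightarrow> P 0 \<and> P 1 \<and> P 2"
  by (metis UNIV_3' UNIV_I insertE singletonD)

lemma vec_eq_3: "u = v \<longleftrightarrow> u $ 0 = v $ 0 \<and> u $ 1 = v $ 1 \<and> u $ 2 = v $ 2" for u v :: "'a ^ 3"
  by (simp add: vec_eq_iff forall_UNIV_3)

definition vec3 :: "'a \<Rightarrow> 'a \<Rightarrow> 'a \<Rightarrow> 'a ^ 3" where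
  "vec3 a b c = (\<chi> j. if j = 0 then a else if j = 1 then b else c)"

lemma vec3_nth [simp]: "vec3 a b c $ 0 = a" "vec3 a b c $ 1 = b" "vec3 a b c $ 2 = c"
  by (simp_all add: vec3_def)

section \<open>Weighted Hermitian forms on three-space\<close>

text \<open>Real and imaginary part of a weighted Hermitian form, conjugate-linear in the first
  argument. \<open>omega_1\<close>, \<open>H_eps\<close>, \<open>alpha_0\<close>, the numerator of
  \<open>alpha_eps\<close> and the Euclidean inner product are all instances, so one set of bilinear
  rules serves them all.\<close>

definition wRe :: "real \<Rightarrow> real \<Rightarrow> real \<Rightarrow> complex ^ 3 \<Rightarrow> complex ^ 3 \<Rightarrow> real" where
  "wRe a b c u v = a * Re (cnj (u $ 0) * v $ 0) + b * Re (cnj (u $ 1) * v $ 1) + c * Re (cnj (u $ 2) * v $ 2)"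

definition wIm :: "real \<Rightarrow> real \<Rightarrow> real \<Rightarrow> complex ^ 3 \<Rightarrow> complex ^ 3 \<Rightarrow> real" where
  "wIm a b c u v = a * Im (cnj (u $ 0) * v $ 0) + b * Im (cnj (u $ 1) * v $ 1) + c * Im (cnj (u $ 2) * v $ 2)"

lemma bilinear_wRe: "bilinear (wRe a b c)" and bilinear_wIm: "bilinear (wIm a b c)"
  unfolding bilinear_def wRe_def wIm_def by (auto intro!: linearI simp: algebra_simps)

lemmas bounded_bilinear_wRe = bilinear_wRe[unfolded bilinear_conv_bounded_bilinear]
  and bounded_bilinear_wIm = bilinear_wIm[unfolded bilinear_conv_bounded_bilinear]

lemma wRe_sym: "wRe a b c u v = wRe a b c v u" and wIm_antisym: "wIm a b c u v = - wIm a b c v u"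
  by (simp_all add: wRe_def wIm_def algebra_simps)

lemma wIm_self [simp]: "wIm a b c u u = 0"
  by (simp add: wIm_def)

lemma wIm_imult [simp]:
  "wIm a b c u (\<i> *s v) = wRe a b c u v" "wIm a b c (\<i> *s u) v = - wRe a b c u v"
  "wRe a b c u (\<i> *s v) = - wIm a b c u v" "wRe a b c (\<i> *s u) v = wIm a b c u v"
  by (simp_all add: wRe_def wIm_def algebra_simps)

lemma wRe_self: "wRe a b c u u = a * (cmod (u $ 0))\<^sup>2 + b * (cmod (u $ 1))\<^sup>2 + c * (cmod (u $ 2))\<^sup>2"
  by (simp add: wRe_def cmod_power2) (simp add: power2_eq_square)

lemma wRe_pos: assumes "0 < a" "0 < b" "0 < c" "u \<noteq> 0" shows "0 < wRe a b c u u"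
proof -
  have "u $ 0 \<noteq> 0 \<or> u $ 1 \<noteq> 0 \<or> u $ 2 \<noteq> 0" using assms(4) by (auto simp: vec_eq_3)
  then show ?thesis using assms(1-3) unfolding wRe_self
    by (smt (verit) mult_nonneg_nonneg mult_pos_pos zero_le_power2 zero_less_power norm_ge_zero zero_less_norm_iff)
qed

lemma inner_eq_wRe: "u \<bullet> v = wRe 1 1 1 u v"
  by (simp add: wRe_def inner_vec_def sum_UNIV_3 inner_complex_def)

lemma omega_1_eq_wIm: "omega_1 n = wIm ((real n + 1) / 2) 1 1"
proof (intro ext)
  fix u v
  have "(\<Sum>j\<in>{1, 2}. u $ j * cnj (v $ j) - cnj (u $ j) * v $ j)
      = (u $ 1 * cnj (v $ 1) - cnj (u $ 1) * v $ 1) + (u $ 2 * cnj (v $ 2) - cnj (u $ 2) * v $ 2)"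
    for u v :: "complex ^ 3" by simp
  then show "omega_1 n u v = wIm ((real n + 1) / 2) 1 1 u v"
    by (simp add: omega_1_def wIm_def Re_divide_of_real field_simps)
qed

lemma H_eps_eq_wRe: "H_eps \<epsilon> z = wRe 1 (1 + \<epsilon>) (1 - \<epsilon>) z z"
  unfolding H_eps_def power2_norm_eq_inner inner_eq_wRe wRe_self by (simp add: algebra_simps)

lemma alpha_eps_eq:
  "alpha_eps n \<epsilon> z v = wIm ((real n + 1) / 4) (1 / 2) (1 / 2) z v / wRe 1 (1 + \<epsilon>) (1 - \<epsilon>) z z"
proof -
  have "Re ((of_nat n + 1) * \<i> / 8 * (z $ 0 * cnj (v $ 0) - cnj (z $ 0) * v $ 0)
       + \<i> / 4 * (z $ 1 * cnj (v $ 1) - cnj (z $ 1) * v $ 1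
                + z $ 2 * cnj (v $ 2) - cnj (z $ 2) * v $ 2))
      = wIm ((real n + 1) / 4) (1 / 2) (1 / 2) z v"
    by (simp add: wIm_def field_simps)
  then show ?thesis unfolding alpha_eps_def H_eps_eq_wRe by simp
qed

lemma alpha_0_eq: "alpha_0 = wIm 1 1 1"
  by (intro ext) (simp add: alpha_0_def wIm_def sum_UNIV_3 field_simps)

lemma frechet_derivative_apply:
  "(f has_derivative f') (at z) \<Longrightarrow> frechet_derivative f (at z) u = f' u"
  by (drule frechet_derivative_at) simp

lemma ext_deriv_wIm: "ext_deriv (wIm a b c) z u v = 2 * wIm a b c u v"
proof -
  have "((\<lambda>w. wIm a b c w v) has_derivative (\<lambda>u. wIm a b c u v)) (at z)" for v
    using bounded_bilinear.bounded_linear_left[OF bounded_bilinear_wIm]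
    by (rule bounded_linear_imp_has_derivative)
  then have "frechet_derivative (\<lambda>w. wIm a b c w v) (at z) u = wIm a b c u v" for u v
    by (rule frechet_derivative_apply)
  then show ?thesis using wIm_antisym[of a b c v u] by (simp add: ext_deriv_def)
qed

text \<open>The rule d(\<lambda>/h) = d\<lambda>/h - (dh \<and> \<lambda>)/h^2 for \<lambda> =
  \<open>wIm a b c z\<close> and h = \<open>wRe a' b' c' z z\<close>, where d\<lambda> is 2
  \<open>wIm a b c\<close> and dh is 2 \<open>wRe a' b' c' z\<close>.\<close>

lemma ext_deriv_wIm_div:
  assumes "wRe a' b' c' z z \<noteq> 0"
  shows "ext_deriv (\<lambda>z v. wIm a b c z v / wRe a' b' c' z z) z u v =
    2 * wIm a b c u v / wRe a' b' c' z z
    - 2 * (wRe a' b' c' z u * wIm a b c z v - wRe a' b' c' z v * wIm a b c z u) / (wRe a' b' c' z z)\<^sup>2"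
proof -
  have "((\<lambda>w. wIm a b c w v / wRe a' b' c' w w) has_derivative
      (\<lambda>u. (wIm a b c u v * wRe a' b' c' z z - wIm a b c z v * (wRe a' b' c' z u + wRe a' b' c' u z))
        / (wRe a' b' c' z z * wRe a' b' c' z z))) (at z)" for v
    by (rule has_derivative_divide'[OF bounded_linear_imp_has_derivative
          bounded_bilinear.FDERIV[OF bounded_bilinear_wRe has_derivative_ident has_derivative_ident] assms])
       (rule bounded_bilinear.bounded_linear_left[OF bounded_bilinear_wIm])
  then have *: "frechet_derivative (\<lambda>w. wIm a b c w v / wRe a' b' c' w w) (at z) u =
     (wIm a b c u v * wRe a' b' c' z z - wIm a b c z v * (wRe a' b' c' z u + wRe a' b' c' u z))
        / (wRe a' b' c' z z * wRe a' b' c' z z)" for u v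
    by (rule frechet_derivative_apply)
  show ?thesis
    unfolding ext_deriv_def * wRe_sym[of a' b' c' u z] wRe_sym[of a' b' c' v z]
    using assms wIm_antisym[of a b c v u] by (simp add: field_simps power2_eq_square)
qed

lemmas ext_deriv_alpha_eps = ext_deriv_wIm_div[where a' = 1 and b' = "1 + \<epsilon>" and c' = "1 - \<epsilon>"
    and a = "(real n + 1) / 4" and b = "1 / 2" and c = "1 / 2" for n \<epsilon>, folded alpha_eps_eq]

section \<open>The tangent space of a regular level set\<close>

text \<open>Let \<open>A\<close> be the differential at \<open>z\<close> and \<open>B\<close> a
  right inverse of it. The map \<open>\<Phi>\<close> = id - \<open>B A\<close> + \<open>B F\<close>
  has derivative id at \<open>z\<close> and satisfies \<open>A \<circ> \<Phi> = F\<close>. Its local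
  inverse therefore carries lines in directions of the kernel of \<open>A\<close> into level sets of
  \<open>F\<close>.\<close>

lemma regular_level_set_curve:
  fixes F :: "'a::euclidean_space \<Rightarrow> 'b::euclidean_space"
  assumes der: "\<And>x. (F has_derivative F' x) (at x)" and cont: "\<And>v. isCont (\<lambda>x. F' x v) z"
    and surj: "surj (F' z)" and v: "F' z v = 0"
  obtains c :: "real \<Rightarrow> 'a" where "\<And>s. F (c s) = F z" "c 0 = z" "(c has_vector_derivative v) (at 0)"
proof -
  define A where "A = F' z"
  have lin: "bounded_linear (F' x)" for x using der has_derivative_bounded_linear by blast
  then have linA: "linear A" by (simp add: A_def bounded_linear.linear)
  have Av: "A v = 0" using v by (simp add: A_def)
  obtain B where B: "linear B" "A \<circ> B = id"
    using linear_surjective_right_inverse[OF linA] surj A_def by auto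
  have bB: "bounded_linear B" using B(1) by (simp add: linear_conv_bounded_linear)
  have bA: "bounded_linear A" using lin A_def by simp
  have AB: "A (B y) = y" for y using B(2) by (metis comp_apply id_apply)
  define \<Phi> where "\<Phi> w = w - B (A w) + B (F w)" for w
  define \<Phi>' where "\<Phi>' x h = h - B (A h) + B (F' x h)" for x h
  have der\<Phi>: "(\<Phi> has_derivative \<Phi>' x) (at x)" for x
    unfolding \<Phi>_def[abs_def] \<Phi>'_def[abs_def]
    by (intro has_derivative_add has_derivative_diff has_derivative_ident
        bounded_linear.has_derivative[OF bB] bounded_linear.has_derivative[OF bA] der)
  have \<Phi>'z: "\<Phi>' z = id" by (auto simp: \<Phi>'_def A_def)
  have lin\<Phi>': "bounded_linear (\<Phi>' x)" for x using der\<Phi> has_derivative_bounded_linear by blast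
  \<comment> \<open>Local injectivity asks for continuity of the derivative in operator norm; in
    finite dimension this can be tested on basis vectors.\<close>
  have "isCont (\<lambda>x. Blinfun (\<Phi>' x)) z"
  proof (rule continuous_blinfun_componentwiseI1)
    fix i :: 'a assume "i \<in> Basis"
    show "isCont (\<lambda>x. blinfun_apply (Blinfun (\<Phi>' x)) i) z"
      unfolding bounded_linear_Blinfun_apply[OF lin\<Phi>'] \<Phi>'_def
      by (intro continuous_intros bounded_linear.isCont[OF bB] cont)
  qed
  then have ons: "\<exists>d>0. \<forall>x. dist z x < d \<longrightarrow> onorm (\<lambda>v. \<Phi>' x v - \<Phi>' z v) < e" if e: "e > 0" for e
  proof -
    obtain d where d: "d > 0" "\<And>x. dist x z < d \<Longrightarrow> dist (Blinfun (\<Phi>' x)) (Blinfun (\<Phi>' z)) < e"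
      using \<open>isCont (\<lambda>x. Blinfun (\<Phi>' x)) z\<close> e unfolding continuous_at_eps_delta by metis
    have "dist (Blinfun (\<Phi>' x)) (Blinfun (\<Phi>' z)) = onorm (\<lambda>v. \<Phi>' x v - \<Phi>' z v)" for x
      unfolding dist_norm norm_blinfun.rep_eq blinfun.diff_left
      by (simp add: bounded_linear_Blinfun_apply[OF lin\<Phi>'] norm_blinfun.rep_eq blinfun.diff_left)
    then show ?thesis using d by (intro exI[of _ d]) (auto simp: dist_commute[of z])
  qed
  obtain r where r: "r > 0" "inj_on \<Phi> (ball z r)"
  proof (rule has_derivative_locally_injective[OF UNIV_I open_UNIV _ _ der\<Phi> ons])
    show "bounded_linear (id :: 'a \<Rightarrow> 'a)" by (simp add: id_def)
    show "id \<circ> \<Phi>' z = id" by (simp add: \<Phi>'z)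
  qed
  have cont\<Phi>: "continuous_on (ball z r) \<Phi>"
    by (intro continuous_at_imp_continuous_on ballI has_derivative_continuous[OF der\<Phi>])
  have op: "open (\<Phi> ` ball z r)"
    using invariance_of_domain[OF cont\<Phi> _ r(2)] by simp
  define g where "g = the_inv_into (ball z r) \<Phi>"
  have g\<Phi>: "g (\<Phi> x) = x" if "x \<in> ball z r" for x
    unfolding g_def using the_inv_into_f_f[OF r(2) that] .
  have derg: "(g has_derivative id) (at (\<Phi> z))"
    by (rule has_derivative_inverse_strong[of "ball z r" z \<Phi> g "\<Phi>' z" id])
       (use r cont\<Phi> g\<Phi> der\<Phi>[of z] \<Phi>'z in auto)
  obtain e where e: "e > 0" "ball (\<Phi> z) e \<subseteq> \<Phi> ` ball z r"
    using op r(1) by (meson centre_in_ball imageI open_contains_ball)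
  \<comment> \<open>Curves in \<open>tangent_space\<close> are defined on all reals, so beyond the
    reach of the local inverse the curve rests at \<open>z\<close>.\<close>
  define c where "c s = (if norm (s *\<^sub>R v) < e then g (\<Phi> z + s *\<^sub>R v) else z)" for s :: real
  have A\<Phi>: "A (\<Phi> w) = F w" for w
    unfolding \<Phi>_def by (simp add: linear_add[OF linA] linear_diff[OF linA] AB)
  show thesis
  proof
    show "F (c s) = F z" for s
    proof (cases "norm (s *\<^sub>R v) < e")
      case True
      then have "\<Phi> z + s *\<^sub>R v \<in> \<Phi> ` ball z r"
        using e(2) by (auto simp: dist_norm)
      then obtain w where w: "w \<in> ball z r" "\<Phi> z + s *\<^sub>R v = \<Phi> w" by auto
      then have "c s = w" using True g\<Phi> by (simp add: c_def)
      moreover have "A (\<Phi> z + s *\<^sub>R v) = A (\<Phi> z)"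
        using Av by (simp add: linear_add[OF linA] linear_scale[OF linA])
      ultimately show ?thesis using w(2) A\<Phi> by metis
    qed (simp add: c_def)
    show "c 0 = z" using e(1) g\<Phi>[of z] r(1) by (simp add: c_def)
    have "((\<lambda>s. g (\<Phi> z + s *\<^sub>R v)) has_vector_derivative v) (at 0)"
    proof -
      have "((\<lambda>s. \<Phi> z + s *\<^sub>R v) has_derivative (\<lambda>s. s *\<^sub>R v)) (at 0)"
        by (auto intro!: derivative_eq_intros)
      moreover have "(g has_derivative id) (at (\<Phi> z + 0 *\<^sub>R v))" using derg by simp
      ultimately have "((\<lambda>s. g (\<Phi> z + s *\<^sub>R v)) has_derivative (\<lambda>s. id (s *\<^sub>R v))) (at 0)"
        by (rule has_derivative_compose)
      then show ?thesis by (simp add: has_vector_derivative_def)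
    qed
    moreover have "open {s :: real. norm (s *\<^sub>R v) < e}"
      by (intro open_Collect_less continuous_intros)
    ultimately show "(c has_vector_derivative v) (at 0)"
      by (rule has_vector_derivative_transform_within_open) (use e(1) in \<open>auto simp: c_def\<close>)
  qed
qed

section \<open>The link\<close>

definition sing_poly :: "nat \<Rightarrow> complex ^ 3 \<Rightarrow> complex" where
  "sing_poly n z = (z $ 0) ^ (n + 1) + 2 * z $ 1 * z $ 2"

definition dsing :: "nat \<Rightarrow> complex ^ 3 \<Rightarrow> complex ^ 3 \<Rightarrow> complex" where
  "dsing n z v = (of_nat n + 1) * (z $ 0) ^ n * v $ 0 + 2 * (z $ 2 * v $ 1 + z $ 1 * v $ 2)"

lemma sing_poly_has_derivative: "(sing_poly n has_derivative dsing n z) (at z)"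
proof -
  have nth: "((\<lambda>z. z $ j) has_derivative (\<lambda>v. v $ j)) (at z)" for j and z :: "complex ^ 3"
    by (rule bounded_linear_imp_has_derivative) (rule bounded_linear_vec_nth)
  show ?thesis
    unfolding sing_poly_def[abs_def] dsing_def[abs_def]
    by (rule derivative_eq_intros nth | simp)+ (simp add: algebra_simps fun_eq_iff)
qed

lemma linear_dsing: "linear (dsing n z)"
  by (auto intro!: linearI simp: dsing_def algebra_simps)

lemma dsing_smult: "dsing n z (c *s v) = c * dsing n z v"
  by (simp add: dsing_def algebra_simps)

lemma link_A_iff: "z \<in> link_A n \<longleftrightarrow> sing_poly n z = 0 \<and> wRe 1 1 1 z z = 1"
  by (auto simp: link_A_def sing_poly_def inner_eq_wRe[symmetric] norm_eq_1)

lemma link_A_nonzero: assumes "z \<in> link_A n" shows "z $ 1 \<noteq> 0 \<or> z $ 2 \<noteq> 0"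
proof (rule ccontr)
  assume *: "\<not> ?thesis"
  then have "z $ 0 = 0" using assms by (auto simp: link_A_iff sing_poly_def)
  then show False using * assms by (simp add: link_A_iff wRe_def)
qed

text \<open>The Euler field of the weights for which \<open>sing_poly n\<close> is homogeneous of
  degree 2. In the metric belonging to \<open>omega_1\<close> it is the gradient of half the squared
  norm, hence transverse to the sphere, while its product with \<i> is tangent to the link.\<close>

definition wradial :: "nat \<Rightarrow> complex ^ 3 \<Rightarrow> complex ^ 3" where
  "wradial n z = vec3 (2 / (of_nat n + 1) * z $ 0) (z $ 1) (z $ 2)"

lemma dsing_wradial: "dsing n z (wradial n z) = 2 * sing_poly n z"
proof -
  have "(of_nat n + 1 :: complex) \<noteq> 0" by (metis of_nat_1 of_nat_add of_nat_eq_0_iff add_is_0 one_neq_zero)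
  then have "(of_nat n + 1) * (z $ 0) ^ n * (2 / (of_nat n + 1) * z $ 0) = 2 * z $ 0 ^ (n + 1)"
    by (simp add: divide_simps)
  then show ?thesis unfolding dsing_def wradial_def sing_poly_def vec3_nth
    by (simp only: ring_distribs mult.assoc mult.commute[of "z $ 2"] mult_2)
qed

lemma wRe_wradial: "wRe ((real n + 1) / 2 * k) k k (wradial n z) v = k * wRe 1 1 1 z v"
proof -
  have "cnj (2 / (of_nat n + 1) :: complex) = of_real (2 / (real n + 1))" by simp
  then show ?thesis
    unfolding wRe_def wradial_def vec3_nth complex_cnj_mult
    by (simp add: field_simps)
qed

lemma wradial_nonzero: assumes "z \<in> link_A n" shows "wradial n z \<noteq> 0"
  using link_A_nonzero[OF assms] by (auto simp: wradial_def vec_eq_3)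

text \<open>On the conjugate gradient of the polynomial \<open>dsing n z\<close> is real and
  positive, as the link avoids the origin; a complex multiple of it attains \<open>c\<close>. A real
  multiple of \<open>wradial n z\<close>, which lies in the kernel of \<open>dsing n z\<close> and
  is transverse to the sphere, then adjusts the radial component.\<close>

lemma link_submersion:
  assumes "z \<in> link_A n" shows "\<exists>v. dsing n z v = c \<and> wRe 1 1 1 z v = r"
proof -
  let ?g = "vec3 ((of_nat n + 1) * cnj (z $ 0) ^ n) (2 * cnj (z $ 2)) (2 * cnj (z $ 1))"
  have g: "dsing n z ?g = of_real (((real n + 1) * cmod (z $ 0) ^ n)\<^sup>2 + 4 * (cmod (z $ 2))\<^sup>2 + 4 * (cmod (z $ 1))\<^sup>2)"
  proof -
    have sq: "complex_of_real ((cmod (z $ 0) ^ n)\<^sup>2) = z $ 0 ^ n * cnj (z $ 0) ^ n"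
      using complex_norm_square[of "z $ 0 ^ n"] by (simp add: norm_power)
    show ?thesis
      unfolding dsing_def vec3_nth power_mult_distrib of_real_add of_real_mult sq complex_norm_square
      by (simp add: algebra_simps power2_eq_square)
  qed
  have "((real n + 1) * cmod (z $ 0) ^ n)\<^sup>2 + 4 * (cmod (z $ 2))\<^sup>2 + 4 * (cmod (z $ 1))\<^sup>2 > 0"
    using link_A_nonzero[OF assms]
    by (smt (verit) zero_le_power2 zero_less_power norm_ge_zero zero_less_norm_iff)
  then have d: "dsing n z ?g \<noteq> 0" unfolding g by (metis of_real_eq_0_iff less_irrefl)
  let ?u = "(c / dsing n z ?g) *s ?g"
  have W: "dsing n z (wradial n z) = 0" using assms by (simp add: dsing_wradial link_A_iff)
  have "wRe 1 1 1 z (wradial n z) = wRe ((real n + 1) / 2 * 1) 1 1 (wradial n z) (wradial n z)"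
    unfolding wRe_wradial by simp
  then have pos: "wRe 1 1 1 z (wradial n z) > 0"
    using wRe_pos[OF _ _ _ wradial_nonzero[OF assms], of "(real n + 1) / 2" 1 1] by simp
  let ?v = "?u + ((r - wRe 1 1 1 z ?u) / wRe 1 1 1 z (wradial n z)) *\<^sub>R wradial n z"
  have "dsing n z ?v = c"
    using d W by (simp add: linear_add[OF linear_dsing] linear_scale[OF linear_dsing] dsing_smult)
  moreover have "wRe 1 1 1 z ?v = r"
    using pos by (simp add: bounded_bilinear.add_right[OF bounded_bilinear_wRe]
        bounded_bilinear.scaleR_right[OF bounded_bilinear_wRe])
  ultimately show ?thesis by blast
qed

lemma tangent_space_link:
  assumes z: "z \<in> link_A n"
  shows "tangent_space (link_A n) z = {v. dsing n z v = 0 \<and> wRe 1 1 1 z v = 0}"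
proof (intro equalityI subsetI CollectI)
  define F where "F w = (sing_poly n w, wRe 1 1 1 w w)" for w
  define F' where "F' w v = (dsing n w v, wRe 1 1 1 w v + wRe 1 1 1 v w)" for w v
  have der: "(F has_derivative F' w) (at w)" for w
    unfolding F_def[abs_def] F'_def[abs_def]
    by (intro has_derivative_Pair sing_poly_has_derivative
        bounded_bilinear.FDERIV[OF bounded_bilinear_wRe] has_derivative_ident)
  have F_link: "w \<in> link_A n \<longleftrightarrow> F w = (0, 1)" for w by (simp add: link_A_iff F_def)
  fix v
  {
    assume "v \<in> tangent_space (link_A n) z"
    then obtain c where c: "\<And>s. c s \<in> link_A n" "c 0 = z" "(c has_vector_derivative v) (at 0)"
      by (auto simp: tangent_space_def)
    have "((\<lambda>s. F (c s)) has_derivative (\<lambda>s. F' z (s *\<^sub>R v))) (at 0)"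
      using has_derivative_compose[OF c(3)[unfolded has_vector_derivative_def]] der c(2) by blast
    moreover have "(\<lambda>s. F (c s)) = (\<lambda>s. (0, 1))" using c(1) F_link by auto
    ultimately have "(\<lambda>s. F' z (s *\<^sub>R v)) = (\<lambda>s. 0)"
      by (metis has_derivative_const has_derivative_unique)
    then have "F' z (1 *\<^sub>R v) = 0" by meson
    then show "dsing n z v = 0 \<and> wRe 1 1 1 z v = 0"
      by (simp add: F'_def wRe_sym[of _ _ _ v] zero_prod_def)
  next
    assume v: "v \<in> {v. dsing n z v = 0 \<and> wRe 1 1 1 z v = 0}"
    have cont: "isCont (\<lambda>x. F' x v) z" for v
      unfolding F'_def dsing_def
      by (intro continuous_intros bounded_bilinear.isCont[OF bounded_bilinear_wRe])
    have "surj (F' z)"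
      unfolding surj_def
    proof
      fix y :: "complex \<times> real"
      obtain v where "dsing n z v = fst y" "wRe 1 1 1 z v = snd y / 2"
        using link_submersion[OF z] by blast
      then show "\<exists>v. y = F' z v"
        by (intro exI[of _ v]) (simp add: F'_def wRe_sym[of _ _ _ v] prod_eq_iff)
    qed
    moreover have "F' z v = 0" using v by (simp add: F'_def wRe_sym[of _ _ _ v] zero_prod_def)
    ultimately obtain c where "\<And>s. F (c s) = F z" "c 0 = z" "(c has_vector_derivative v) (at 0)"
      using regular_level_set_curve[OF der cont] by blast
    then show "v \<in> tangent_space (link_A n) z"
      using z F_link by (auto simp: tangent_space_def intro!: exI[of _ c])
  }
qed

lemma smooth_near_vec_nth: "smooth_near z (\<lambda>w :: complex ^ 3. w $ j)"
  by (rule smooth_near_bounded_linear) (rule bounded_linear_vec_nth)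

lemma smooth_near_sing_poly: "smooth_near z (sing_poly n)"
  unfolding sing_poly_def[abs_def]
  by (intro smooth_near_add smooth_near_power smooth_near_mult smooth_near_const smooth_near_vec_nth)

lemma smooth_near_linear_compose:
  assumes "bounded_linear f" "smooth_near z g" shows "smooth_near z (\<lambda>w. f (g w))"
proof -
  have "bounded_bilinear (\<lambda>(r::real) y. r *\<^sub>R f y)"
    using bounded_bilinear.comp[OF bounded_bilinear_scaleR bounded_linear_ident assms(1)] by simp
  from smooth_near_bilinear[OF this smooth_near_const[of z 1] assms(2)] show ?thesis by simp
qed

lemma smooth_submanifold_link: "smooth_submanifold 3 (link_A n)"
proof -
  define F :: "nat \<Rightarrow> complex ^ 3 \<Rightarrow> real" where
    "F i = (if i = 0 then (\<lambda>z. Re (sing_poly n z)) else if i = 1 then (\<lambda>z. Im (sing_poly n z))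
      else (\<lambda>z. wRe 1 1 1 z z - 1))" for i
  have dim: "DIM(complex ^ 3) = 6" by simp
  have der: "frechet_derivative (F i) (at z) v =
      (if i = 0 then Re (dsing n z v) else if i = 1 then Im (dsing n z v) else 2 * wRe 1 1 1 z v)"
    for i z v
  proof -
    have 1: "((\<lambda>z. Re (sing_poly n z)) has_derivative (\<lambda>v. Re (dsing n z v))) (at z)"
      "((\<lambda>z. Im (sing_poly n z)) has_derivative (\<lambda>v. Im (dsing n z v))) (at z)"
      by (intro has_derivative_Re has_derivative_Im sing_poly_has_derivative)+
    have 2: "((\<lambda>z. wRe 1 1 1 z z - 1) has_derivative (\<lambda>v. wRe 1 1 1 z v + wRe 1 1 1 v z - 0)) (at z)"
      by (intro has_derivative_diff has_derivative_const
          bounded_bilinear.FDERIV[OF bounded_bilinear_wRe] has_derivative_ident)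
    show ?thesis
      using frechet_derivative_apply[OF 1(1), of v] frechet_derivative_apply[OF 1(2), of v]
        frechet_derivative_apply[OF 2, of v] wRe_sym[of 1 1 1 v z]
      by (simp add: F_def)
  qed
  have sm: "smooth_on UNIV (F i)" for i
    unfolding smooth_on_iff_smooth_near[OF open_UNIV] F_def
    by (auto intro!: smooth_near_diff[OF _ smooth_near_const] smooth_near_sing_poly
        smooth_near_linear_compose[OF bounded_linear_Re] smooth_near_linear_compose[OF bounded_linear_Im]
        smooth_near_bilinear[OF bounded_bilinear_wRe smooth_near_bounded_linear smooth_near_bounded_linear])
  have three: "{..<3} = {0, 1, 2 :: nat}" by auto
  have "link_A n \<inter> UNIV = {y \<in> UNIV. \<forall>i<3. F i y = 0}"
    by (auto simp: link_A_iff F_def complex_eq_iff less_Suc_eq numeral_3_eq_3)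
  moreover have "\<forall>i<3. a i = 0"
    if z: "z \<in> link_A n" and a: "\<And>v. (\<Sum>i<3. a i * frechet_derivative (F i) (at z) v) = 0" for z a
  proof -
    have eq: "a 0 * Re (dsing n z v) + a 1 * Im (dsing n z v) + a 2 * (2 * wRe 1 1 1 z v) = 0" for v
      using a[of v] unfolding three der by (simp add: add.assoc)
    obtain v1 v2 v3 where "dsing n z v1 = 1" "wRe 1 1 1 z v1 = 0" "dsing n z v2 = \<i>" "wRe 1 1 1 z v2 = 0"
      "dsing n z v3 = 0" "wRe 1 1 1 z v3 = 1" using link_submersion[OF z] by metis
    then have "a 0 = 0" "a 1 = 0" "a 2 = 0" using eq[of v1] eq[of v2] eq[of v3] by auto
    then show ?thesis by (auto simp: less_Suc_eq numeral_3_eq_3 numeral_2_eq_2)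
  qed
  ultimately show ?thesis
    unfolding smooth_submanifold_def dim
    by (intro conjI ballI exI[of _ UNIV] exI[of _ F]) (use sm in auto)
qed

section \<open>Contact forms and Reeb vector fields on the link\<close>

lemma iwradial_tangent:
  assumes "z \<in> link_A n" shows "\<i> *s wradial n z \<in> tangent_space (link_A n) z"
proof -
  have "wRe 1 1 1 z (\<i> *s wradial n z) = 0"
    by (simp add: wIm_def wradial_def field_simps)
  then show ?thesis
    using assms by (simp add: tangent_space_link dsing_smult dsing_wradial link_A_iff)
qed

text \<open>The cross product of the coefficient vector of \<open>dsing n z\<close> with the
  conjugate of \<open>z\<close> is annihilated by both. It spans the complex line inside the tangent
  space.\<close>

lemma complex_tangent_vector:
  assumes z: "z \<in> link_A n"
  obtains q where "q \<noteq> 0" "dsing n z q = 0" "wRe 1 1 1 z q = 0" "wIm 1 1 1 z q = 0"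
proof
  let ?a = "(of_nat n + 1) * (z $ 0) ^ n" and ?b = "2 * z $ 2" and ?c = "2 * z $ 1"
  let ?q = "vec3 (?b * cnj (z $ 2) - ?c * cnj (z $ 1)) (?c * cnj (z $ 0) - ?a * cnj (z $ 2))
                 (?a * cnj (z $ 1) - ?b * cnj (z $ 0))"
  have "cnj (z $ 0) * ?q $ 0 + cnj (z $ 1) * ?q $ 1 + cnj (z $ 2) * ?q $ 2 = 0"
    by (simp add: algebra_simps)
  then have "Re (cnj (z $ 0) * ?q $ 0 + cnj (z $ 1) * ?q $ 1 + cnj (z $ 2) * ?q $ 2) = 0"
    "Im (cnj (z $ 0) * ?q $ 0 + cnj (z $ 1) * ?q $ 1 + cnj (z $ 2) * ?q $ 2) = 0"
    by simp_all
  then show "wRe 1 1 1 z ?q = 0" "wIm 1 1 1 z ?q = 0"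
    unfolding wRe_def wIm_def plus_complex.simps by linarith+
  show "dsing n z ?q = 0" by (simp add: dsing_def algebra_simps)
  show "?q \<noteq> 0"
  proof
    \<comment> \<open>If the two factors of the cross product were parallel, the equation of the
      link would make a squared modulus equal to a negative number.\<close>
    assume "?q = 0"
    then have q: "?b * cnj (z $ 2) = ?c * cnj (z $ 1)" "?c * cnj (z $ 0) = ?a * cnj (z $ 2)"
      by (auto simp: vec_eq_3)
    have "complex_of_real ((cmod (z $ 2))\<^sup>2) = complex_of_real ((cmod (z $ 1))\<^sup>2)"
      unfolding complex_norm_square using q(1) by simp
    then have "(cmod (z $ 2))\<^sup>2 = (cmod (z $ 1))\<^sup>2" by (simp only: of_real_eq_iff)
    then have nz: "z $ 1 \<noteq> 0" "z $ 2 \<noteq> 0" using link_A_nonzero[OF z] by auto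
    have s: "z $ 0 ^ (n + 1) = - (2 * z $ 1 * z $ 2)"
      using z by (simp add: link_A_iff sing_poly_def add_eq_0_iff2)
    have "2 * z $ 1 * z $ 2 * (z $ 0 * cnj (z $ 0)) = (z $ 0 * z $ 2) * (?c * cnj (z $ 0))"
      by (simp add: algebra_simps)
    also have "\<dots> = (of_nat n + 1) * z $ 0 ^ (n + 1) * (z $ 2 * cnj (z $ 2))"
      unfolding q(2) by (simp add: algebra_simps)
    also have "\<dots> = 2 * z $ 1 * z $ 2 * (- ((of_nat n + 1) * (z $ 2 * cnj (z $ 2))))"
      unfolding s by (simp add: algebra_simps)
    finally have "z $ 0 * cnj (z $ 0) = - ((of_nat n + 1) * (z $ 2 * cnj (z $ 2)))"
      using nz by (subst (asm) mult_left_cancel) auto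
    then have "complex_of_real ((cmod (z $ 0))\<^sup>2) = complex_of_real (- ((real n + 1) * (cmod (z $ 2))\<^sup>2))"
      by (simp only: complex_norm_square of_real_minus of_real_mult of_real_add of_real_of_nat_eq of_real_1)
    then have "(cmod (z $ 0))\<^sup>2 = - ((real n + 1) * (cmod (z $ 2))\<^sup>2)" by (simp only: of_real_eq_iff)
    moreover have "(real n + 1) * (cmod (z $ 2))\<^sup>2 > 0" using nz by simp
    ultimately show False by (smt (verit) zero_le_power2)
  qed
qed

lemma smooth_near_wIm: "smooth_near z (\<lambda>z. wIm a b c z v)"
  and smooth_near_wRe: "smooth_near z (\<lambda>z. wRe a b c z z)"
  by (auto intro: smooth_near_bilinear[OF bounded_bilinear_wIm smooth_near_bounded_linear smooth_near_const]
      smooth_near_bilinear[OF bounded_bilinear_wRe smooth_near_bounded_linear smooth_near_bounded_linear])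

lemma link_A_not_0: "z \<in> link_A n \<Longrightarrow> z \<noteq> 0"
  by (auto simp: link_A_iff wRe_def)

text \<open>Of the three products in the wedge on \<i> \<open>wradial n z\<close>, \<open>q\<close>,
  \<i> \<open>q\<close> only the first survives, as \<open>alpha_0\<close> vanishes on
  \<open>q\<close> and \<i> \<open>q\<close>; both of its factors are positive.\<close>

lemma contact_form_alpha_0: "contact_form (link_A n) alpha_0"
  unfolding contact_form_def
proof (intro conjI ballI smooth_submanifold_link exI[of _ UNIV])
  show "smooth_one_form_on UNIV alpha_0"
    unfolding smooth_one_form_on_def alpha_0_eq smooth_on_iff_smooth_near[OF open_UNIV]
    using smooth_near_wIm bilinear_wIm by (auto simp: bilinear_def)
  fix z assume z: "z \<in> link_A n"
  obtain q where q: "q \<noteq> 0" "dsing n z q = 0" "wRe 1 1 1 z q = 0" "wIm 1 1 1 z q = 0"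
    using complex_tangent_vector[OF z] .
  have "q \<in> tangent_space (link_A n) z" "\<i> *s q \<in> tangent_space (link_A n) z"
    using q z by (auto simp: tangent_space_link dsing_smult)
  moreover have "wIm 1 1 1 z (\<i> *s wradial n z) > 0"
    using wRe_wradial[of n 1 z "wradial n z"] wRe_pos[OF _ _ _ wradial_nonzero[OF z], of "(real n + 1) / 2" 1 1]
    by simp
  moreover have "wRe 1 1 1 q q > 0" using q(1) by (intro wRe_pos) auto
  ultimately show "\<exists>u\<in>tangent_space (link_A n) z. \<exists>v\<in>tangent_space (link_A n) z.
      \<exists>w\<in>tangent_space (link_A n) z. wedge_deriv alpha_0 z u v w \<noteq> 0"
    using q
    by (intro bexI[of _ "\<i> *s wradial n z"] bexI[of _ q] bexI[of _ "\<i> *s q"] iwradial_tangent z)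
       (auto simp: wedge_deriv_def alpha_0_eq ext_deriv_wIm)
qed auto

locale reeb_link =
  fixes n :: nat and \<epsilon> :: real
  assumes n: "1 \<le> n" and eps: "0 < \<epsilon>" "\<epsilon> < 1"
begin

abbreviation "M \<equiv> link_A n"
abbreviation "\<alpha> \<equiv> alpha_eps n \<epsilon>"
abbreviation "H z \<equiv> wRe 1 (1 + \<epsilon>) (1 - \<epsilon>) z z"
abbreviation "lam \<equiv> wIm ((real n + 1) / 4) (1 / 2) (1 / 2)"
abbreviation "om \<equiv> wIm ((real n + 1) / 2) 1 1"

lemma H_pos: "z \<noteq> 0 \<Longrightarrow> 0 < H z"
  using eps by (intro wRe_pos) auto

lemma lam_om: "2 * lam u v = om u v"
  by (simp add: wIm_def field_simps)

lemma dalpha: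
  assumes "z \<noteq> 0"
  shows "ext_deriv \<alpha> z u v = om u v / H z
    - 2 * (wRe 1 (1 + \<epsilon>) (1 - \<epsilon>) z u * lam z v - wRe 1 (1 + \<epsilon>) (1 - \<epsilon>) z v * lam z u) / (H z)\<^sup>2"
  using ext_deriv_alpha_eps[of \<epsilon> z n u v] H_pos[OF assms] lam_om[of u v] by simp

text \<open>By the second identity the \<open>om\<close>-complement of \<i>
  \<open>wradial n z\<close> is the tangent space of the sphere. This makes it the test vector both
  for the contact condition and for the uniqueness of the Reeb field.\<close>

lemma iwradial:
  assumes "z \<in> M"
  shows "lam z (\<i> *s wradial n z) = 1 / 2" "om (\<i> *s wradial n z) v = - wRe 1 1 1 z v"
proof -
  have "om z (\<i> *s wradial n z) = - om (\<i> *s wradial n z) z" by (rule wIm_antisym)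
  also have "\<dots> = 1" using assms wRe_wradial[of n 1 z z] by (simp add: link_A_iff)
  finally show "lam z (\<i> *s wradial n z) = 1 / 2" using lam_om[of z "\<i> *s wradial n z"] by simp
  show "om (\<i> *s wradial n z) v = - wRe 1 1 1 z v" using wRe_wradial[of n 1 z v] by simp
qed

text \<open>The dH term drops out of \<alpha> \<and> d\<alpha>, which leaves (\<lambda> \<and>
  d\<lambda>)/H^2 for \<lambda> = \<open>lam z\<close>. One product remains, because \<i>
  \<open>wradial n z\<close> is \<open>om\<close>-orthogonal to \<open>q\<close> and \<i>
  \<open>q\<close>.\<close>

lemma contact_form_alpha_eps: "contact_form M \<alpha>"
  unfolding contact_form_def
proof (intro conjI ballI smooth_submanifold_link exI[of _ "- {0}"])
  show "smooth_one_form_on (- {0}) \<alpha>"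
    unfolding smooth_one_form_on_def
  proof (intro conjI ballI allI)
    show "linear (\<alpha> z)" for z
      unfolding alpha_eps_eq[abs_def] divide_inverse
      using bilinear_wIm by (auto intro!: linearI simp: bilinear_def linear_add linear_scale algebra_simps)
    show "smooth_on (- {0}) (\<lambda>z. \<alpha> z v)" for v
      by (subst smooth_on_iff_smooth_near)
         (auto simp: alpha_eps_eq open_Compl dest: H_pos
           intro!: smooth_near_divide smooth_near_wIm smooth_near_wRe)
  qed
  fix z assume z: "z \<in> M"
  then have z0: "z \<noteq> 0" by (rule link_A_not_0)
  obtain q where q: "q \<noteq> 0" "dsing n z q = 0" "wRe 1 1 1 z q = 0" "wIm 1 1 1 z q = 0"
    using complex_tangent_vector[OF z] .
  let ?K = "\<i> *s wradial n z"
  have T: "q \<in> tangent_space M z" "\<i> *s q \<in> tangent_space M z"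
    using q z by (auto simp: tangent_space_link dsing_smult)
  have K: "om ?K q = 0" "om ?K (\<i> *s q) = 0" "lam z ?K = 1 / 2"
    unfolding iwradial[OF z] using q by simp_all
  have pos: "om q (\<i> *s q) > 0" using q(1) by (simp add: wRe_pos)
  have "wedge_deriv \<alpha> z ?K q (\<i> *s q) = lam z ?K * om q (\<i> *s q) / (H z)\<^sup>2"
    unfolding wedge_deriv_def dalpha[OF z0] alpha_eps_eq K
    using H_pos[OF z0] by (simp add: field_simps power2_eq_square)
  then have "wedge_deriv \<alpha> z ?K q (\<i> *s q) \<noteq> 0" using pos K H_pos[OF z0] by simp
  then show "\<exists>u\<in>tangent_space M z. \<exists>v\<in>tangent_space M z. \<exists>w\<in>tangent_space M z. wedge_deriv \<alpha> z u v w \<noteq> 0"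
    using T iwradial_tangent[OF z] by blast
qed (auto dest: link_A_not_0)

definition R :: "complex ^ 3 \<Rightarrow> complex ^ 3" where
  "R z = vec3 (\<i> * of_real (4 / (real n + 1)) * z $ 0) (\<i> * of_real (2 * (1 + \<epsilon>)) * z $ 1)
     (\<i> * of_real (2 * (1 - \<epsilon>)) * z $ 2)"

lemma om_R: "om (R z) v = - 2 * wRe 1 (1 + \<epsilon>) (1 - \<epsilon>) z v"
  and lam_R: "lam z (R z) = H z" and dH_R: "wRe 1 (1 + \<epsilon>) (1 - \<epsilon>) z (R z) = 0"
  and wRe_R: "wRe 1 1 1 z (R z) = 0"
proof -
  have "m / 2 * (4 / m) = 2" "m / 4 * (4 / m) = 1" if "m \<noteq> 0" for m :: real using that by simp_all
  moreover have "real n + 1 \<noteq> 0" by simp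
  ultimately have 4: "(real n + 1) / 2 * (4 / (real n + 1)) = 2" "(real n + 1) / 4 * (4 / (real n + 1)) = 1"
    by blast+
  have im: "Im (cnj (\<i> * of_real k * x) * y) = - k * Re (cnj x * y)"
    "Im (cnj y * (\<i> * of_real k * x)) = k * Re (cnj y * x)" for k x y
    by (simp_all add: algebra_simps)
  have gen: "a * (- k * x) + 1 * (- (2 * k') * y) + 1 * (- (2 * k'') * w) = - (a * k * x + 2 * k' * y + 2 * k'' * w)"
    "a * (k * x) + 1 / 2 * (2 * k' * y) + 1 / 2 * (2 * k'' * w) = a * k * x + k' * y + k'' * w"
    for a k k' k'' x y w :: real by (simp_all add: algebra_simps)
  have "om (R z) v = - ((real n + 1) / 2 * (4 / (real n + 1)) * Re (cnj (z $ 0) * v $ 0)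
     + 2 * (1 + \<epsilon>) * Re (cnj (z $ 1) * v $ 1) + 2 * (1 - \<epsilon>) * Re (cnj (z $ 2) * v $ 2))"
    unfolding wIm_def R_def vec3_nth im by (rule gen(1))
  then show "om (R z) v = - 2 * wRe 1 (1 + \<epsilon>) (1 - \<epsilon>) z v"
    unfolding 4 wRe_def by (simp add: algebra_simps)
  have "lam z (R z) = (real n + 1) / 4 * (4 / (real n + 1)) * Re (cnj (z $ 0) * z $ 0)
     + (1 + \<epsilon>) * Re (cnj (z $ 1) * z $ 1) + (1 - \<epsilon>) * Re (cnj (z $ 2) * z $ 2)"
    unfolding wIm_def R_def vec3_nth im by (rule gen(2))
  then show "lam z (R z) = H z" unfolding 4 wRe_def by simp
  show "wRe 1 (1 + \<epsilon>) (1 - \<epsilon>) z (R z) = 0" "wRe 1 1 1 z (R z) = 0"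
    by (simp_all add: wRe_def R_def)
qed

text \<open>Both monomials have the same total frequency: (n + 1) times 4 / (n + 1) equals 2 (1 +
  \<epsilon>) + 2 (1 - \<epsilon>) = 4.\<close>

lemma dsing_R: "dsing n z (R z) = 4 * \<i> * sing_poly n z"
proof -
  have "(of_nat n + 1) * complex_of_real (4 / (real n + 1)) = of_real ((real n + 1) * (4 / (real n + 1)))"
    by (simp only: of_real_mult of_real_add of_real_of_nat_eq of_real_1)
  moreover have "m * (4 / m) = 4" if "m \<noteq> 0" for m :: real using that by simp
  from this[of "real n + 1"] have "(real n + 1) * (4 / (real n + 1)) = 4" by auto
  ultimately have 4: "(of_nat n + 1) * complex_of_real (4 / (real n + 1)) = 4" by (simp only: of_real_numeral)
  have "dsing n z (R z) = \<i> * ((of_nat n + 1) * complex_of_real (4 / (real n + 1))) * z $ 0 ^ (n + 1)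
    + 8 * \<i> * z $ 1 * z $ 2"
    unfolding dsing_def R_def vec3_nth by (simp add: algebra_simps)
  then show ?thesis unfolding 4 sing_poly_def by (simp add: algebra_simps)
qed

lemma alpha_R: "z \<noteq> 0 \<Longrightarrow> \<alpha> z (R z) = 1"
  using H_pos[of z] by (simp add: alpha_eps_eq lam_R)

text \<open>Since d\<lambda>(R, v) = - dH(v), \<lambda>(R) = H and dH(R) = 0, the two terms of
  d(\<lambda>/H) cancel after contraction with R.\<close>

lemma dalpha_R: "z \<noteq> 0 \<Longrightarrow> ext_deriv \<alpha> z (R z) v = 0"
  using H_pos[of z] unfolding dalpha om_R lam_R dH_R by (simp add: power2_eq_square)

lemma R_tangent: "z \<in> M \<Longrightarrow> R z \<in> tangent_space M z"
  by (simp add: tangent_space_link dsing_R wRe_R link_A_iff)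

lemma tangent_diff: "z \<in> M \<Longrightarrow> u \<in> tangent_space M z \<Longrightarrow> v \<in> tangent_space M z \<Longrightarrow> u - v \<in> tangent_space M z"
  by (simp add: tangent_space_link linear_diff[OF linear_dsing] bounded_bilinear.diff_right[OF bounded_bilinear_wRe])

text \<open>Gives the uniqueness of the Reeb field. It cannot be read off from nondegeneracy of
  \<open>om\<close> on the whole space, as only tangent test vectors are allowed; the two that
  decide are \<i> \<open>wradial n z\<close> and \<i> \<open>w'\<close>.\<close>

lemma dalpha_nondegenerate:
  assumes z: "z \<in> M" and w: "w \<in> tangent_space M z" "\<alpha> z w = 0"
    and d: "\<And>v. v \<in> tangent_space M z \<Longrightarrow> ext_deriv \<alpha> z w v = 0"
  shows "w = 0"
proof -
  have z0: "z \<noteq> 0" using z by (rule link_A_not_0)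
  have lw: "lam z w = 0" using w(2) H_pos[OF z0] by (simp add: alpha_eps_eq)
  have zw: "wRe 1 1 1 z w = 0" "dsing n z w = 0" using w z by (auto simp: tangent_space_link)
  let ?K = "\<i> *s wradial n z"
  have K: "lam z ?K = 1 / 2" "om w ?K = 0"
    using iwradial[OF z] zw wIm_antisym[of _ _ _ w ?K] by auto
  have dH: "wRe 1 (1 + \<epsilon>) (1 - \<epsilon>) z w = 0"
    using d[OF iwradial_tangent[OF z]] K lw H_pos[OF z0] unfolding dalpha[OF z0] by simp
  have om0: "om w v = 0" if "v \<in> tangent_space M z" for v
    using d[OF that] lw dH H_pos[OF z0] unfolding dalpha[OF z0] by simp
  \<comment> \<open>This multiple makes \<open>w'\<close> lie in the complex line of the tangent
    space, so that \<i> \<open>w'\<close> is tangent as well and positivity applies to the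
    pair.\<close>
  define a where "a = wIm 1 1 1 z w / wRe 1 1 1 z (wradial n z)"
  define w' where "w' = w - a *\<^sub>R ?K"
  have pos: "wRe 1 1 1 z (wradial n z) > 0"
    using wRe_wradial[of n 1 z "wradial n z"] wRe_pos[OF _ _ _ wradial_nonzero[OF z], of "(real n + 1) / 2" 1 1]
    by simp
  have "wIm 1 1 1 z w' = 0"
    using pos unfolding w'_def
    by (simp add: bounded_bilinear.diff_right[OF bounded_bilinear_wIm]
        bounded_bilinear.scaleR_right[OF bounded_bilinear_wIm] a_def)
  moreover have Kt: "dsing n z ?K = 0" "wRe 1 1 1 z ?K = 0" using iwradial_tangent[OF z] z by (auto simp: tangent_space_link)
  moreover have w't: "dsing n z w' = 0" "wRe 1 1 1 z w' = 0"
    using zw Kt unfolding w'_def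
    by (auto simp: linear_diff[OF linear_dsing] linear_scale[OF linear_dsing] 
        bounded_bilinear.diff_right[OF bounded_bilinear_wRe]
        bounded_bilinear.scaleR_right[OF bounded_bilinear_wRe] simp del: wIm_imult)
  ultimately have iw': "\<i> *s w' \<in> tangent_space M z" using z by (simp add: tangent_space_link dsing_smult)
  have "om w' (\<i> *s w') = om w (\<i> *s w') - a * om ?K (\<i> *s w')"
    unfolding w'_def[of ] by (simp only: bounded_bilinear.diff_left[OF bounded_bilinear_wIm]
        bounded_bilinear.scaleR_left[OF bounded_bilinear_wIm] real_scaleR_def)
  also have "\<dots> = 0" using om0[OF iw'] iwradial(2)[OF z, of "\<i> *s w'"] \<open>wIm 1 1 1 z w' = 0\<close> by simp
  finally have "wRe ((real n + 1) / 2) 1 1 w' w' = 0" by simp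
  then have "w' = 0" using wRe_pos[of "(real n + 1) / 2" 1 1 w'] by force
  then have "w = a *\<^sub>R ?K" by (simp add: w'_def)
  moreover have "lam z (a *\<^sub>R ?K) = a / 2"
    by (simp only: bounded_bilinear.scaleR_right[OF bounded_bilinear_wIm] K) simp
  ultimately show ?thesis using lw by simp
qed

lemma reeb_eq: assumes z: "z \<in> M" shows "reeb M \<alpha> z = R z"
  unfolding reeb_def
proof (rule the_equality)
  have z0: "z \<noteq> 0" using z by (rule link_A_not_0)
  show "R z \<in> tangent_space M z \<and> \<alpha> z (R z) = 1 \<and> (\<forall>v\<in>tangent_space M z. ext_deriv \<alpha> z (R z) v = 0)"
    using R_tangent[OF z] alpha_R[OF z0] dalpha_R[OF z0] by simp
  fix S assume S: "S \<in> tangent_space M z \<and> \<alpha> z S = 1 \<and> (\<forall>v\<in>tangent_space M z. ext_deriv \<alpha> z S v = 0)"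
  have "S - R z = 0"
  proof (rule dalpha_nondegenerate[OF z])
    show "S - R z \<in> tangent_space M z" using S R_tangent[OF z] tangent_diff[OF z] by blast
    show "\<alpha> z (S - R z) = 0" using S alpha_R[OF z0]
      by (simp add: alpha_eps_eq bounded_bilinear.diff_right[OF bounded_bilinear_wIm] diff_divide_distrib)
    fix v assume v: "v \<in> tangent_space M z"
    have "ext_deriv \<alpha> z (S - R z) v = ext_deriv \<alpha> z S v - ext_deriv \<alpha> z (R z) v"
      by (simp add: dalpha[OF z0] bounded_bilinear.diff_right[OF bounded_bilinear_wIm]
          bounded_bilinear.diff_left[OF bounded_bilinear_wIm]
          bounded_bilinear.diff_right[OF bounded_bilinear_wRe] algebra_simps diff_divide_distrib add_divide_distrib)
    then show "ext_deriv \<alpha> z (S - R z) v = 0" using S v dalpha_R[OF z0] by simp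
  qed
  then show "S = R z" by simp
qed

section \<open>The Reeb flow\<close>

definition freq :: "3 \<Rightarrow> real" where
  "freq j = (if j = 0 then 4 / (real n + 1) else if j = 1 then 2 * (1 + \<epsilon>) else 2 * (1 - \<epsilon>))"

definition rot :: "real \<Rightarrow> complex ^ 3 \<Rightarrow> complex ^ 3" where
  "rot t v = (\<chi> j. cis (freq j * t) * v $ j)"

lemma R_nth: "R z $ j = \<i> * of_real (freq j) * z $ j"
proof -
  have "j = 0 \<or> j = 1 \<or> j = 2" using UNIV_3' by blast
  then show ?thesis by (auto simp: R_def freq_def)
qed

lemma linear_rot: "linear (rot t)"
  by (auto intro!: linearI simp: rot_def vec_eq_iff algebra_simps)

lemma rot_0 [simp]: "rot 0 v = v"
  by (simp add: rot_def)

lemma rot_link: assumes "z \<in> M" shows "rot t z \<in> M"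
proof -
  have "real (n + 1) * (freq 0 * t) = 4 * t" by (simp add: freq_def field_simps)
  then have "cis (freq 0 * t) ^ (n + 1) = cis (4 * t)"
    unfolding Complex.DeMoivre by (rule arg_cong[where f = cis])
  moreover have "cis (freq 1 * t) * cis (freq 2 * t) = cis (4 * t)"
    unfolding cis_mult by (rule arg_cong[where f = cis]) (simp add: freq_def field_simps)
  ultimately have "sing_poly n (rot t z) = cis (4 * t) * sing_poly n z"
    unfolding sing_poly_def rot_def vec_lambda_beta power_mult_distrib
    by (simp add: algebra_simps)
  moreover have "wRe 1 1 1 (rot t z) (rot t z) = wRe 1 1 1 z z"
    unfolding wRe_self rot_def by (simp add: norm_mult)
  ultimately show ?thesis using assms by (simp add: link_A_iff)
qed

lemma rot_derivative: "((\<lambda>t. rot t z) has_vector_derivative R (rot t z)) (at t)"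
proof -
  have *: "((\<lambda>t. rot t z $ j) has_derivative (\<lambda>s. s *\<^sub>R R (rot t z) $ j)) (at t)" for j
    unfolding R_nth rot_def vec_lambda_beta
    by (rule derivative_eq_intros refl)+ (simp add: fun_eq_iff scaleR_conv_of_real)
  show ?thesis
    unfolding has_vector_derivative_def
  proof (subst has_derivative_componentwise_within, rule ballI)
    fix b :: "complex ^ 3" assume "b \<in> Basis"
    then obtain j u where b: "b = axis j u" by (auto simp: Basis_vec_def)
    show "((\<lambda>t. rot t z \<bullet> b) has_derivative (\<lambda>s. s *\<^sub>R R (rot t z) \<bullet> b)) (at t)"
      unfolding b inner_axis using has_derivative_inner_left[OF *, of j u] by simp
  qed
qed

lemma rot_trajectory: "z \<in> M \<Longrightarrow> reeb_trajectory M \<alpha> (\<lambda>t. rot t z)"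
  by (simp add: reeb_trajectory_def rot_link reeb_eq rot_derivative)

lemma reeb_trajectory_unique:
  assumes "reeb_trajectory M \<alpha> c" shows "c t = rot t (c 0)"
proof -
  have c: "c t \<in> M" "(c has_vector_derivative R (c t)) (at t)" for t
    using assms unfolding reeb_trajectory_def by (metis reeb_eq)+
  have "c t $ j = cis (freq j * t) * c 0 $ j" for j
  proof -
    have cj: "((\<lambda>t. c t $ j) has_derivative (\<lambda>s. s *\<^sub>R (\<i> * of_real (freq j) * c t $ j))) (at t)" for t
      using bounded_linear.has_derivative[OF bounded_linear_vec_nth
          c(2)[of t, unfolded has_vector_derivative_def], of j] by (simp add: R_nth)
    have "((\<lambda>t. cis (- (freq j * t)) * c t $ j) has_vector_derivative 0) (at t)" for t
      unfolding has_vector_derivative_def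
      by (rule derivative_eq_intros cj refl)+ (simp add: fun_eq_iff scaleR_conv_of_real algebra_simps)
    then obtain k where "\<And>t. cis (- (freq j * t)) * c t $ j = k"
      using has_vector_derivative_zero_constant[of UNIV "\<lambda>t. cis (- (freq j * t)) * c t $ j"] by auto
    then have "cis (- (freq j * t)) * c t $ j = c 0 $ j" by (metis cis_zero minus_zero mult_1 mult_zero_right)
    then have "cis (freq j * t) * (cis (- (freq j * t)) * c t $ j) = cis (freq j * t) * c 0 $ j" by simp
    then show ?thesis by (simp only: mult.assoc[symmetric] cis_mult) simp
  qed
  then show ?thesis by (simp add: rot_def vec_eq_iff)
qed

lemma reeb_trajectory_iff:
  "reeb_trajectory M \<alpha> c \<longleftrightarrow> c 0 \<in> M \<and> c = (\<lambda>t. rot t (c 0))"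
proof
  assume "reeb_trajectory M \<alpha> c"
  then show "c 0 \<in> M \<and> c = (\<lambda>t. rot t (c 0))"
    using reeb_trajectory_unique by (auto simp: reeb_trajectory_def)
next
  assume *: "c 0 \<in> M \<and> c = (\<lambda>t. rot t (c 0))"
  show "reeb_trajectory M \<alpha> c" by (subst conjunct2[OF *]) (use * in \<open>intro rot_trajectory, simp\<close>)
qed

lemma reeb_flow_eq: assumes "z \<in> M" shows "reeb_flow M \<alpha> t z = rot t z"
proof -
  have "(THE c. reeb_trajectory M \<alpha> c \<and> c 0 = z) = (\<lambda>t. rot t z)"
    by (rule the_equality) (use rot_trajectory[OF assms] reeb_trajectory_unique in auto)
  then show ?thesis by (simp add: reeb_flow_def)
qed

end

section \<open>Tangent maps computed along curves\<close>

lemma within_derivative_curve: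
  assumes "(f has_derivative D) (at z within M)" "\<And>s. c s \<in> M" "c 0 = z" "(c has_vector_derivative v) (at 0)"
  shows "((\<lambda>s. f (c s)) has_vector_derivative D v) (at 0)"
proof -
  have "(f has_derivative D) (at (c 0) within c ` UNIV)"
    using assms(1-3) by (auto intro: has_derivative_subset)
  then have "((\<lambda>s. f (c s)) has_derivative (\<lambda>s. D (s *\<^sub>R v))) (at 0)"
    using has_derivative_in_compose[OF assms(4)[unfolded has_vector_derivative_def], of f] by simp
  moreover have "D (s *\<^sub>R v) = s *\<^sub>R D v" for s
    using assms(1) has_derivative_linear linear_scale by blast
  ultimately show ?thesis by (simp add: has_vector_derivative_def)
qed

text \<open>\<open>tangent_map\<close> is a choice among possibly several derivatives within
  \<open>M\<close>. At a tangent vector each of them returns the velocity of the image of a curve,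
  and that velocity is unique.\<close>

lemma tangent_map_eq:
  assumes "(f has_derivative D) (at z within M)" "v \<in> tangent_space M z"
  shows "tangent_map M f z v = D v"
proof -
  obtain c where c: "\<And>s. c s \<in> M" "c 0 = z" "(c has_vector_derivative v) (at 0)"
    using assms(2) by (auto simp: tangent_space_def)
  have "(f has_derivative tangent_map M f z) (at z within M)"
    using assms(1) by (auto simp: frechet_derivative_works[symmetric] differentiable_def)
  from within_derivative_curve[OF this c] within_derivative_curve[OF assms(1) c]
  show ?thesis by (rule vector_derivative_unique_at)
qed

context reeb_link
begin

lemma tangent_map_flow:
  assumes "z \<in> M" "v \<in> tangent_space M z"
  shows "tangent_map M (reeb_flow M \<alpha> t) z v = rot t v"
proof (rule tangent_map_eq[OF _ assms(2)])
  have "(rot t has_derivative rot t) (at z within M)"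
    using linear_rot by (rule linear_imp_has_derivative)
  then show "(reeb_flow M \<alpha> t has_derivative rot t) (at z within M)"
    using assms(1) reeb_flow_eq by (rule has_derivative_transform[rotated 2])
qed

end

section \<open>The inverse of the profile function\<close>

text \<open>Let p, x, y be the squared moduli of the coordinates 0, 1, 2 of a point of the link.
  Then x + y = 1 - p and 4 x y = p^(n + 1), so (x - y)^2 = (1 - p)^2 - p^(n + 1). Hence 1 -
  \<open>slope c\<close>^2 depends on p alone: it is \<open>profile n c p\<close>. It is divisible
  by p, and \<open>Kfun\<close> is the quotient.\<close>

definition Kfun :: "nat \<Rightarrow> real \<Rightarrow> real \<Rightarrow> real" where
  "Kfun n c p = ((1 - c) * (2 - (1 + c) * p) + p ^ n) / (1 - c * p)\<^sup>2"

definition profile :: "nat \<Rightarrow> real \<Rightarrow> real \<Rightarrow> real" where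
  "profile n c p = p * Kfun n c p"

definition dprofile :: "nat \<Rightarrow> real \<Rightarrow> real \<Rightarrow> real" where
  "dprofile n c p = 2 * (1 - p) * (1 - c) + (real n + 1) * p ^ n * (1 - c * p) + 2 * c * p ^ (n + 1)"

lemma profile_eq:
  assumes "1 - c * p \<noteq> 0"
  shows "(1 - c * p)\<^sup>2 * (1 - profile n c p) = (1 - p)\<^sup>2 - p ^ (n + 1)"
proof -
  have "(1 - c * p)\<^sup>2 * profile n c p = p * ((1 - c) * (2 - (1 + c) * p) + p ^ n)"
    using assms by (simp add: profile_def Kfun_def)
  then show ?thesis by (simp add: right_diff_distrib) (simp add: power2_eq_square algebra_simps)
qed

lemma profile_eq': "1 - c * p \<noteq> 0 \<Longrightarrow> profile n c p = 1 - ((1 - p)\<^sup>2 - p ^ (n + 1)) / (1 - c * p)\<^sup>2"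
  using profile_eq[of c p n] by (simp add: field_simps)

lemma mult_less_one: assumes "0 \<le> c" "c < 1" "p < 1" shows "c * p < (1 :: real)"
proof (cases "p \<le> 0")
  case True
  then have "c * p \<le> 0" using assms by (simp add: mult_nonneg_nonpos)
  then show ?thesis by simp
next
  case False
  then show ?thesis using assms mult_strict_mono[of c 1 p 1] by simp
qed

lemma profile_has_derivative:
  assumes "1 - c * p \<noteq> 0"
  shows "(profile n c has_real_derivative dprofile n c p / (1 - c * p) ^ 3) (at p)"
proof -
  have op: "open {p. 1 - c * p \<noteq> 0}" by (intro open_Collect_neq continuous_intros)
  have "((\<lambda>p. 1 - ((1 - p)\<^sup>2 - p ^ (n + 1)) / (1 - c * p)\<^sup>2) has_real_derivative
      0 - ((2 * (1 - p) * (0 - 1) - (real n + 1) * p ^ n) * (1 - c * p)\<^sup>2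
        - ((1 - p)\<^sup>2 - p ^ (n + 1)) * (2 * (1 - c * p) * (0 - c))) / ((1 - c * p)\<^sup>2 * (1 - c * p)\<^sup>2)) (at p)"
  proof -
    have pw: "((\<lambda>p. p ^ (n + 1)) has_real_derivative (real n + 1) * p ^ n) (at p)"
      using DERIV_pow[of "n + 1" p UNIV] by (simp add: add.commute)
    have "((\<lambda>p. (1 - p)\<^sup>2) has_real_derivative 2 * (1 - p) * (0 - 1)) (at p)"
      "((\<lambda>p. (1 - c * p)\<^sup>2) has_real_derivative 2 * (1 - c * p) * (0 - c)) (at p)"
      by (auto intro!: derivative_eq_intros simp: algebra_simps)
    from DERIV_diff[OF DERIV_const DERIV_divide[OF DERIV_diff[OF this(1) pw] this(2)]]
    show ?thesis using assms by simp
  qed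
  moreover have "0 - ((2 * (1 - p) * (0 - 1) - (real n + 1) * p ^ n) * (1 - c * p)\<^sup>2
        - ((1 - p)\<^sup>2 - p ^ (n + 1)) * (2 * (1 - c * p) * (0 - c))) / ((1 - c * p)\<^sup>2 * (1 - c * p)\<^sup>2)
      = dprofile n c p / (1 - c * p) ^ 3"
  proof -
    define D where "D = 1 - c * p"
    have D: "D \<noteq> 0" using assms D_def by simp
    have "(2 * (1 - p) + (real n + 1) * p ^ n) * D - 2 * c * ((1 - p)\<^sup>2 - p ^ (n + 1)) = dprofile n c p"
      unfolding D_def dprofile_def by (simp add: power2_eq_square algebra_simps)
    then have "dprofile n c p / D ^ 3 = ((2 * (1 - p) + (real n + 1) * p ^ n) * D - 2 * c * ((1 - p)\<^sup>2 - p ^ (n + 1))) / D ^ 3"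
      by simp
    also have "\<dots> = 0 - ((2 * (1 - p) * (0 - 1) - (real n + 1) * p ^ n) * D\<^sup>2
        - ((1 - p)\<^sup>2 - p ^ (n + 1)) * (2 * D * (0 - c))) / (D\<^sup>2 * D\<^sup>2)"
      using D by (simp add: divide_simps power2_eq_square power3_eq_cube) (simp add: algebra_simps)
    finally show ?thesis unfolding D_def by simp
  qed
  ultimately have "((\<lambda>p. 1 - ((1 - p)\<^sup>2 - p ^ (n + 1)) / (1 - c * p)\<^sup>2) has_real_derivative
      dprofile n c p / (1 - c * p) ^ 3) (at p)" by simp
  then show ?thesis
    by (rule has_field_derivative_transform_within_open[OF _ op]) (use assms profile_eq' in auto)
qed

text \<open>The derivative of the profile is positive on the interval, and its inverse solves the
  autonomous equation whose right-hand side is the reciprocal of that derivative, so it is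
  smooth.\<close>

lemma profile_inverse_exists:
  assumes "0 \<le> c" "c < 1" "1 \<le> n"
  shows "\<exists>Q. \<forall>p\<in>{0..<1}. Q (profile n c p) = p \<and> smooth_near (profile n c p) Q"
proof -
  have Dpos: "dprofile n c p > 0" if "0 \<le> p" "p < 1" for p
  proof -
    have "(1 - p) * (1 - c) > 0" "(real n + 1) * p ^ n * (1 - c * p) \<ge> 0" "c * p ^ (n + 1) \<ge> 0"
      using that assms mult_less_one[of c p] by auto
    moreover have "dprofile n c p = 2 * ((1 - p) * (1 - c)) + (real n + 1) * p ^ n * (1 - c * p) + 2 * (c * p ^ (n + 1))"
      by (simp add: dprofile_def)
    ultimately show ?thesis by linarith
  qed
  \<comment> \<open>The point p = 0 corresponds to the exceptional circles and must be interior to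
    the domain of the inverse function, so the interval is continued a little to the left of
    0.\<close>
  have "isCont (dprofile n c) 0"
    unfolding dprofile_def[abs_def] by (intro continuous_intros)
  then obtain \<delta> where \<delta>: "\<delta> > 0" "\<And>p. \<bar>p\<bar> < \<delta> \<Longrightarrow> \<bar>dprofile n c p - dprofile n c 0\<bar> < dprofile n c 0"
    using Dpos[of 0] unfolding continuous_at_eps_delta dist_real_def by force
  define J where "J = {- \<delta><..<1}"
  have D: "dprofile n c p > 0" if "p \<in> J" for p
    using \<delta>(2)[of p] Dpos[of p] that unfolding J_def by (cases "0 \<le> p") force+
  have lt: "1 - c * p > 0" if "p \<in> J" for p using that mult_less_one[of c p] assms by (simp add: J_def)
  have der: "(profile n c has_real_derivative dprofile n c p / (1 - c * p) ^ 3) (at p)" if "p \<in> J" for p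
    using lt[OF that] by (intro profile_has_derivative) auto
  have pos: "dprofile n c p / (1 - c * p) ^ 3 > 0" if "p \<in> J" for p
    using D[OF that] lt[OF that] by simp
  have less: "profile n c p < profile n c q" if "p \<in> J" "q \<in> J" "p < q" for p q
  proof (rule DERIV_pos_imp_increasing[OF that(3)])
    fix x assume "p \<le> x" "x \<le> q"
    then have "x \<in> J" using that by (auto simp: J_def)
    then show "\<exists>y. (profile n c has_real_derivative y) (at x) \<and> y > 0" using der pos by blast
  qed
  have inj: "inj_on (profile n c) J"
    by (intro linorder_inj_onI') (use less in force)
  have cont: "continuous_on J (profile n c)"
    using der by (auto intro!: continuous_at_imp_continuous_on DERIV_isCont)
  have opJ: "open J" by (simp add: J_def)
  have opI: "open (profile n c ` J)" using invariance_of_domain[OF cont opJ inj] .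
  define Q where "Q = the_inv_into J (profile n c)"
  have Q: "Q (profile n c p) = p" if "p \<in> J" for p
    unfolding Q_def using the_inv_into_f_f[OF inj that] .
  have "smooth_on (profile n c ` J) Q"
  proof (rule smooth_on_autonomous[OF opI, where \<phi> = "\<lambda>p. (1 - c * p) ^ 3 / dprofile n c p"])
    fix t assume "t \<in> profile n c ` J"
    then obtain p where p: "p \<in> J" "t = profile n c p" by auto
    have "(Q has_derivative (*) ((1 - c * p) ^ 3 / dprofile n c p)) (at (profile n c p))"
      by (rule has_derivative_inverse_strong[OF opJ p(1) cont Q
            der[OF p(1), unfolded has_field_derivative_def]])
         (use D[OF p(1)] lt[OF p(1)] in \<open>auto simp: fun_eq_iff\<close>)
    then show "(Q has_real_derivative (1 - c * Q t) ^ 3 / dprofile n c (Q t)) (at t)"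
      using Q p by (simp add: has_field_derivative_def)
    show "smooth_near (Q t) (\<lambda>p. (1 - c * p) ^ 3 / dprofile n c p)"
      using Q p D[OF p(1)] unfolding dprofile_def
      by (intro smooth_near_divide smooth_near_power smooth_near_add smooth_near_diff
          smooth_near_mult[OF smooth_near_mult] smooth_near_mult[OF smooth_near_const]
          smooth_near_const smooth_near_power[OF smooth_near_bounded_linear]
          smooth_near_bounded_linear bounded_linear_ident) (auto)
  qed
  then show ?thesis using Q opI \<delta>(1)
    by (intro exI[of _ Q]) (auto simp: smooth_near_def J_def intro!: exI[of _ "profile n c ` J"])
qed

definition profile_inv :: "nat \<Rightarrow> real \<Rightarrow> real \<Rightarrow> real" where
  "profile_inv n c = (SOME Q. \<forall>p\<in>{0..<1}. Q (profile n c p) = p \<and> smooth_near (profile n c p) Q)"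

lemma profile_inv:
  assumes "0 \<le> c" "c < 1" "1 \<le> n" "0 \<le> p" "p < 1"
  shows "profile_inv n c (profile n c p) = p" "smooth_near (profile n c p) (profile_inv n c)"
  using someI_ex[OF profile_inverse_exists[OF assms(1-3)]] assms(4,5) unfolding profile_inv_def by auto

lemma profile_surj:
  assumes "0 \<le> c" "c < 1" "1 \<le> n" "0 \<le> t" "t \<le> 1"
  obtains p where "0 \<le> p" "p < 1" "profile n c p = t"
proof -
  have lt: "1 - c * x \<noteq> 0" if "0 \<le> x" "x \<le> 1" for x
    using that assms mult_left_mono[of x 1 c] by linarith
  \<comment> \<open>The value at 1 exceeds 1, which keeps the solution strictly below 1.\<close>
  have "profile n c 1 = 1 + 1 / (1 - c)\<^sup>2"
    using assms profile_eq'[of c 1 n] by simp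
  then have 1: "profile n c 1 > 1" using assms by simp
  have "\<exists>x\<ge>0. x \<le> 1 \<and> profile n c x = t"
    by (rule IVT) (use assms 1 lt in \<open>auto simp: profile_def intro!: DERIV_isCont[OF profile_has_derivative, unfolded profile_def]\<close>)
  then obtain x where x: "0 \<le> x" "x \<le> 1" "profile n c x = t" by blast
  moreover have "x \<noteq> 1" using x 1 assms by auto
  ultimately show ?thesis using that[of x] by auto
qed

lemma Kfun_pos: assumes "0 \<le> c" "c < 1" "0 \<le> p" "p < 1" shows "Kfun n c p > 0"
proof -
  have "(1 + c) * p < 2" using assms mult_strict_mono[of "1 + c" 2 p 1] by simp
  then have "(1 - c) * (2 - (1 + c) * p) > 0" "p ^ n \<ge> 0" using assms by auto
  moreover have "1 - c * p > 0" using mult_less_one[of c p] assms by simp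
  ultimately show ?thesis by (simp add: Kfun_def add_pos_nonneg)
qed

lemma smooth_near_Kfun: assumes "1 - c * p \<noteq> 0" shows "smooth_near p (Kfun n c)"
  using assms unfolding Kfun_def[abs_def]
  by (intro smooth_near_divide smooth_near_power smooth_near_add smooth_near_diff
          smooth_near_mult[OF smooth_near_const] smooth_near_const 
          smooth_near_bounded_linear bounded_linear_ident) auto

section \<open>The equivariant contactomorphism\<close>

text \<open>Both contact structures are invariant under the two-torus acting on the link, and they contain
  the real directions. On torus orbits, where \<open>|z\<^sub>0|\<^sup>2 = p\<close>, the form with weight
  \<open>(n + 1) (1 - c) / 2\<close> at the coordinate 0 has slope
  \<open>(|z\<^sub>1|\<^sup>2 - |z\<^sub>2|\<^sup>2) / (1 - c p)\<close>. The map \<open>transfer n c d\<close> preserves the phases of the coordinates and turns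
  the slope for \<open>c\<close> into the one for \<open>d\<close>.\<close>

definition slope :: "real \<Rightarrow> complex ^ 3 \<Rightarrow> real" where
  "slope c z = ((cmod (z $ 1))\<^sup>2 - (cmod (z $ 2))\<^sup>2) / (1 - c * (cmod (z $ 0))\<^sup>2)"

text \<open>The squared moduli of the image point. The first, u, has the same profile for
  \<open>d\<close> as the given point has for \<open>c\<close>; the other two have sum 1 - u and the
  difference that produces the given slope for \<open>d\<close>.\<close>

definition tsq :: "nat \<Rightarrow> real \<Rightarrow> real \<Rightarrow> complex ^ 3 \<Rightarrow> 3 \<Rightarrow> real" where
  "tsq n c d z j = (let u = profile_inv n d (profile n c ((cmod (z $ 0))\<^sup>2)); s = slope c z * (1 - d * u) in
     if j = 0 then u else if j = 1 then (1 - u + s) / 2 else (1 - u - s) / 2)"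

text \<open>The quotient u/p of new and old squared modulus at coordinate 0 would be 0/0 on the
  exceptional circles. From p \<open>Kfun n c p\<close> = u \<open>Kfun n d u\<close> it equals a
  quotient of positive smooth functions. At the other coordinates division by zero returns the
  factor 0, and it multiplies a coordinate that is 0.\<close>

definition tfac :: "nat \<Rightarrow> real \<Rightarrow> real \<Rightarrow> complex ^ 3 \<Rightarrow> 3 \<Rightarrow> real" where
  "tfac n c d z j = (if j = 0 then sqrt (Kfun n c ((cmod (z $ 0))\<^sup>2) / Kfun n d (tsq n c d z 0))
     else sqrt (tsq n c d z j / (cmod (z $ j))\<^sup>2))"

definition transfer :: "nat \<Rightarrow> real \<Rightarrow> real \<Rightarrow> complex ^ 3 \<Rightarrow> complex ^ 3" where
  "transfer n c d z = (\<chi> j. tfac n c d z j *\<^sub>R z $ j)"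

section \<open>Moduli and phases of the image point\<close>

lemma link_A_squares:
  assumes "z \<in> link_A n"
  shows "(cmod (z $ 0))\<^sup>2 + (cmod (z $ 1))\<^sup>2 + (cmod (z $ 2))\<^sup>2 = 1"
    "((cmod (z $ 0))\<^sup>2) ^ (n + 1) = 4 * (cmod (z $ 1))\<^sup>2 * (cmod (z $ 2))\<^sup>2"
    "(cmod (z $ 0))\<^sup>2 < 1"
proof -
  show 1: "(cmod (z $ 0))\<^sup>2 + (cmod (z $ 1))\<^sup>2 + (cmod (z $ 2))\<^sup>2 = 1"
    using assms by (simp add: link_A_iff wRe_self)
  have "z $ 0 ^ (n + 1) = - (2 * z $ 1 * z $ 2)"
    using assms by (simp add: link_A_iff sing_poly_def add_eq_0_iff2)
  then have "cmod (z $ 0 ^ (n + 1)) = 2 * cmod (z $ 1) * cmod (z $ 2)" by (simp add: norm_mult)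
  then have "(cmod (z $ 0)) ^ (n + 1) = 2 * cmod (z $ 1) * cmod (z $ 2)" by (simp only: norm_power)
  then have "((cmod (z $ 0)) ^ (n + 1))\<^sup>2 = 4 * (cmod (z $ 1))\<^sup>2 * (cmod (z $ 2))\<^sup>2"
    by (simp add: power_mult_distrib)
  then show "((cmod (z $ 0))\<^sup>2) ^ (n + 1) = 4 * (cmod (z $ 1))\<^sup>2 * (cmod (z $ 2))\<^sup>2"
    by (simp only: power_mult[symmetric] mult.commute)
  show "(cmod (z $ 0))\<^sup>2 < 1"
    using 1 link_A_nonzero[OF assms]
    by (smt (verit) zero_le_power2 zero_less_power norm_ge_zero zero_less_norm_iff)
qed

locale transfer_link =
  fixes n :: nat and c d :: real
  assumes n: "1 \<le> n" and c: "0 \<le> c" "c < 1" and d: "0 \<le> d" "d < 1"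
begin

abbreviation "L \<equiv> link_A n"

lemma profile_slope:
  assumes z: "z \<in> L" shows "profile n c ((cmod (z $ 0))\<^sup>2) = 1 - (slope c z)\<^sup>2"
    and "1 - c * (cmod (z $ 0))\<^sup>2 > 0"
proof -
  let ?p = "(cmod (z $ 0))\<^sup>2" and ?x = "(cmod (z $ 1))\<^sup>2" and ?y = "(cmod (z $ 2))\<^sup>2"
  show D: "1 - c * ?p > 0" using mult_less_one[OF c link_A_squares(3)[OF z]] by simp
  have "1 - ?p = ?x + ?y" using link_A_squares(1)[OF z] by simp
  then have "(1 - ?p)\<^sup>2 - ?p ^ (n + 1) = (?x + ?y)\<^sup>2 - 4 * ?x * ?y"
    using link_A_squares(2)[OF z] by simp
  also have "\<dots> = (?x - ?y)\<^sup>2" by (simp add: power2_eq_square algebra_simps)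
  finally show "profile n c ?p = 1 - (slope c z)\<^sup>2"
    using D profile_eq'[of c ?p n] by (simp add: slope_def power_divide)
qed

text \<open>The relation u^(n + 1) = 4 X Y of the image moduli is the profile equation for
  \<open>d\<close> read backwards, with X + Y = 1 - u and X - Y given by the slope. Then X and Y
  have nonnegative product and positive sum, so neither is negative.\<close>

lemma tsq_props:
  assumes z: "z \<in> L"
  shows "0 \<le> tsq n c d z 0" "tsq n c d z 0 < 1"
    "profile n d (tsq n c d z 0) = profile n c ((cmod (z $ 0))\<^sup>2)"
    "tsq n c d z 0 + tsq n c d z 1 + tsq n c d z 2 = 1"
    "tsq n c d z 1 - tsq n c d z 2 = slope c z * (1 - d * tsq n c d z 0)"
    "(tsq n c d z 0) ^ (n + 1) = 4 * tsq n c d z 1 * tsq n c d z 2"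
    "0 \<le> tsq n c d z 1" "0 \<le> tsq n c d z 2"
proof -
  let ?p = "(cmod (z $ 0))\<^sup>2"
  have p: "0 \<le> ?p" "?p < 1" using link_A_squares[OF z] by auto
  have "profile n c ?p \<le> 1" using profile_slope(1)[OF z] by simp
  moreover have "profile n c ?p \<ge> 0"
    using Kfun_pos[OF c p, of n] by (simp add: profile_def)
  ultimately obtain u where u: "0 \<le> u" "u < 1" "profile n d u = profile n c ?p"
    using profile_surj[OF d n] by metis
  have t0: "tsq n c d z 0 = u"
    unfolding tsq_def using profile_inv(1)[OF d n u(1,2)] u(3) by simp
  show tu: "0 \<le> tsq n c d z 0" "tsq n c d z 0 < 1" "profile n d (tsq n c d z 0) = profile n c ?p"
    unfolding t0 by (rule u)+
  show s: "tsq n c d z 0 + tsq n c d z 1 + tsq n c d z 2 = 1"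
    "tsq n c d z 1 - tsq n c d z 2 = slope c z * (1 - d * tsq n c d z 0)"
    by (auto simp: tsq_def Let_def field_simps)
  have D: "1 - d * u > 0" using mult_less_one[OF d u(2)] by simp
  have "u ^ (n + 1) = (1 - u)\<^sup>2 - (1 - d * u)\<^sup>2 * (1 - profile n d u)"
    using profile_eq[of d u n] D by simp
  also have "\<dots> = (1 - u)\<^sup>2 - ((1 - d * u) * slope c z)\<^sup>2"
    using u(3) profile_slope[OF z] by (simp add: power_mult_distrib)
  also have "\<dots> = 4 * tsq n c d z 1 * tsq n c d z 2"
  proof -
    have "1 - u = tsq n c d z 1 + tsq n c d z 2" using s(1) t0 by simp
    moreover have "(1 - d * u) * slope c z = tsq n c d z 1 - tsq n c d z 2"
      using s(2) t0 by (simp add: mult.commute)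
    ultimately show ?thesis by (simp only:) (simp add: power2_eq_square algebra_simps)
  qed
  finally show pr: "(tsq n c d z 0) ^ (n + 1) = 4 * tsq n c d z 1 * tsq n c d z 2" unfolding t0 .
  then have "tsq n c d z 1 * tsq n c d z 2 \<ge> 0" using tu(1) zero_le_power[OF tu(1), of "n + 1"] by linarith
  moreover have "tsq n c d z 1 + tsq n c d z 2 > 0" using s tu by simp
  ultimately show "0 \<le> tsq n c d z 1" "0 \<le> tsq n c d z 2"
    by (smt (verit) mult_neg_neg mult_pos_neg mult_neg_pos)+
qed

lemma profile_zero_iff: "0 \<le> p \<Longrightarrow> p < 1 \<Longrightarrow> 0 \<le> a \<Longrightarrow> a < 1 \<Longrightarrow> profile n a p = 0 \<longleftrightarrow> p = 0"
  using Kfun_pos[of a p n] by (auto simp: profile_def)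

lemma tsq_zero:
  assumes z: "z \<in> L" and "z $ j = 0" shows "tsq n c d z j = 0"
proof -
  let ?p = "(cmod (z $ 0))\<^sup>2"
  have p: "0 \<le> ?p" "?p < 1" using link_A_squares[OF z] by auto
  have "z $ 0 = 0"
  proof -
    have j: "j = 0 \<or> j = 1 \<or> j = 2" using UNIV_3' by blast
    then have "z $ 0 = 0 \<or> ?p ^ (n + 1) = 0" using assms(2) link_A_squares(2)[OF z] by auto
    then show ?thesis by auto
  qed
  then have u: "tsq n c d z 0 = 0"
    using tsq_props(1-3)[OF z] profile_zero_iff[OF p c] profile_zero_iff[OF _ _ d] by force
  show ?thesis
  proof (cases "j = 0")
    case True then show ?thesis using u by simp
  next
    case False
    then have j: "j = 1 \<or> j = 2" using UNIV_3' by blast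
    have "slope c z = (cmod (z $ 1))\<^sup>2 - (cmod (z $ 2))\<^sup>2" using \<open>z $ 0 = 0\<close> by (simp add: slope_def)
    then show ?thesis
      using u j assms(2) tsq_props(4,5)[OF z] link_A_squares(1)[OF z] \<open>z $ 0 = 0\<close> by auto
  qed
qed

lemma tfac_sq:
  assumes z: "z \<in> L"
  shows "(tfac n c d z j)\<^sup>2 * (cmod (z $ j))\<^sup>2 = tsq n c d z j" "0 \<le> tfac n c d z j"
proof -
  let ?p = "(cmod (z $ 0))\<^sup>2"
  have p: "0 \<le> ?p" "?p < 1" using link_A_squares[OF z] by auto
  have j: "j = 0 \<or> j = 1 \<or> j = 2" using UNIV_3' by blast
  have K: "Kfun n c ?p > 0" "Kfun n d (tsq n c d z 0) > 0"
    using Kfun_pos[OF c p] Kfun_pos[OF d] tsq_props[OF z] by auto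
  have pos: "0 \<le> tsq n c d z j" using tsq_props[OF z] j by auto
  show "0 \<le> tfac n c d z j" using K pos by (auto simp: tfac_def)
  show "(tfac n c d z j)\<^sup>2 * (cmod (z $ j))\<^sup>2 = tsq n c d z j"
  proof (cases "j = 0")
    case True
    then show ?thesis using K tsq_props(3)[OF z] by (simp add: tfac_def profile_def field_simps)
  next
    case False
    then show ?thesis using tsq_zero[OF z, of j] pos by (auto simp: tfac_def)
  qed
qed

lemma cmod_transfer:
  assumes z: "z \<in> L" shows "(cmod (transfer n c d z $ j))\<^sup>2 = tsq n c d z j"
  using tfac_sq[OF z, of j] by (simp add: transfer_def power_mult_distrib)

text \<open>Both monomials of the polynomial are scaled by the same positive factor; with the phases
  unchanged, this is what keeps the image on the variety.\<close>

lemma tfac_power: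
  assumes z: "z \<in> L" "z $ 1 \<noteq> 0" "z $ 2 \<noteq> 0"
  shows "tfac n c d z 0 ^ (n + 1) = tfac n c d z 1 * tfac n c d z 2"
proof (rule power2_eq_imp_eq)
  let ?a = "tfac n c d z" and ?p = "(cmod (z $ 0))\<^sup>2" and ?x = "(cmod (z $ 1))\<^sup>2" and ?y = "(cmod (z $ 2))\<^sup>2"
  have xy: "?x * ?y \<noteq> 0" using z by simp
  have "((?a 0 ^ (n + 1))\<^sup>2) * (4 * ?x * ?y) = ((?a 0)\<^sup>2 * ?p) ^ (n + 1)"
    using link_A_squares(2)[OF z(1)] by (simp only: power_mult_distrib power_mult[symmetric] mult.commute)
  also have "\<dots> = 4 * tsq n c d z 1 * tsq n c d z 2"
    unfolding tfac_sq[OF z(1)] by (rule tsq_props(6)[OF z(1)])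
  also have "\<dots> = (?a 1 * ?a 2)\<^sup>2 * (4 * ?x * ?y)"
    unfolding tfac_sq(1)[OF z(1), symmetric] by (simp add: power_mult_distrib)
  finally show "(?a 0 ^ (n + 1))\<^sup>2 = (?a 1 * ?a 2)\<^sup>2" using xy by simp
qed (use tfac_sq[OF z(1)] in auto)

lemma transfer_link:
  assumes z: "z \<in> L" shows "transfer n c d z \<in> L"
proof -
  have "wRe 1 1 1 (transfer n c d z) (transfer n c d z) = 1"
    unfolding wRe_self cmod_transfer[OF z] using tsq_props(4)[OF z] by simp
  moreover have "sing_poly n (transfer n c d z) = 0"
  proof (cases "z $ 1 = 0 \<or> z $ 2 = 0")
    case True
    then have "((cmod (z $ 0))\<^sup>2) ^ (n + 1) = 0" using link_A_squares(2)[OF z] by auto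
    then have "z $ 0 = 0" by auto
    then show ?thesis using True by (auto simp: sing_poly_def transfer_def)
  next
    case False
    have "sing_poly n (transfer n c d z)
        = of_real (tfac n c d z 0 ^ (n + 1)) * z $ 0 ^ (n + 1)
        + 2 * of_real (tfac n c d z 1 * tfac n c d z 2) * z $ 1 * z $ 2"
      unfolding sing_poly_def transfer_def vec_lambda_beta scaleR_conv_of_real power_mult_distrib
        of_real_power of_real_mult by (simp only: mult_ac)
    also have "\<dots> = of_real (tfac n c d z 1 * tfac n c d z 2) * sing_poly n z"
      using tfac_power[OF z] False by (simp only: sing_poly_def distrib_left mult_ac) auto
    finally show ?thesis using z by (simp add: link_A_iff)
  qed
  ultimately show ?thesis by (simp add: link_A_iff)
qed

lemma slope_transfer:
  assumes z: "z \<in> L" shows "slope d (transfer n c d z) = slope c z"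
proof -
  have "1 - d * tsq n c d z 0 > 0" using mult_less_one[OF d tsq_props(2)[OF z]] by simp
  then show ?thesis unfolding slope_def[of d] cmod_transfer[OF z] tsq_props(5)[OF z] by simp
qed

text \<open>Profile and slope are preserved, so the second map restores the moduli. The composite
  multiplies each nonzero coordinate by a nonnegative factor of square 1.\<close>

lemma transfer_transfer:
  assumes z: "z \<in> L" shows "transfer n d c (transfer n c d z) = z"
proof -
  interpret bwd: transfer_link n d c using n c d by unfold_locales
  let ?w = "transfer n c d z"
  have w: "?w \<in> L" using transfer_link[OF z] .
  have p: "0 \<le> (cmod (z $ 0))\<^sup>2" "(cmod (z $ 0))\<^sup>2 < 1" using link_A_squares[OF z] by auto
  have t0: "profile_inv n c (profile n d ((cmod (?w $ 0))\<^sup>2)) = (cmod (z $ 0))\<^sup>2"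
    unfolding cmod_transfer[OF z] tsq_props(3)[OF z] by (rule profile_inv(1)[OF c n p])
  have sl: "slope c z * (1 - c * (cmod (z $ 0))\<^sup>2) = (cmod (z $ 1))\<^sup>2 - (cmod (z $ 2))\<^sup>2"
    using profile_slope(2)[OF z] by (simp add: slope_def)
  have t: "tsq n d c ?w j = (cmod (z $ j))\<^sup>2" for j
  proof -
    have "j = 0 \<or> j = 1 \<or> j = 2" using UNIV_3' by blast
    then show ?thesis
      unfolding tsq_def Let_def t0 slope_transfer[OF z] sl using link_A_squares(1)[OF z] by auto
  qed
  have "transfer n d c ?w $ j = z $ j" for j
  proof (cases "z $ j = 0")
    case True
    then show ?thesis by (simp add: transfer_def)
  next
    case False
    let ?r = "tfac n d c ?w j * tfac n c d z j"
    have eq: "transfer n d c ?w $ j = ?r *\<^sub>R z $ j" by (simp add: transfer_def)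
    have "(cmod (transfer n d c ?w $ j))\<^sup>2 = (cmod (z $ j))\<^sup>2"
      unfolding bwd.cmod_transfer[OF w] by (rule t)
    then have "?r\<^sup>2 * (cmod (z $ j))\<^sup>2 = (cmod (z $ j))\<^sup>2"
      unfolding eq by (simp add: power_mult_distrib)
    then have "?r\<^sup>2 = 1" using False by simp
    moreover have "?r \<ge> 0" using bwd.tfac_sq(2)[OF w] tfac_sq(2)[OF z] by simp
    ultimately have "?r = 1" by (simp add: power2_eq_1_iff)
    then show ?thesis unfolding eq by simp
  qed
  then show ?thesis by (simp add: vec_eq_iff)
qed

section \<open>Smoothness and differential of the transfer map\<close>

lemma smooth_near_cmod_sq: "smooth_near z (\<lambda>w. (cmod (w $ j))\<^sup>2)" for z :: "complex ^ 3"
  unfolding power2_norm_eq_inner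
  by (intro smooth_near_bilinear[OF bounded_bilinear_inner] smooth_near_vec_nth)

lemma smooth_near_tsq:
  assumes z: "z \<in> L" shows "smooth_near z (\<lambda>w. tsq n c d w j)"
proof -
  let ?p = "(cmod (z $ 0))\<^sup>2"
  have p: "0 \<le> ?p" "?p < 1" using link_A_squares[OF z] by auto
  have D: "1 - c * ?p \<noteq> 0" using profile_slope(2)[OF z] by simp
  have "smooth_near ?p (profile n c)"
    unfolding profile_def[abs_def]
    by (intro smooth_near_mult[OF smooth_near_bounded_linear] smooth_near_Kfun D bounded_linear_ident)
  then have "smooth_near z (\<lambda>w. profile n c ((cmod (w $ 0))\<^sup>2))"
    by (rule smooth_near_compose_real[OF smooth_near_cmod_sq])
  moreover have "smooth_near (profile n c ?p) (profile_inv n d)"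
    using profile_inv(2)[OF d n tsq_props(1,2)[OF z]] tsq_props(3)[OF z] by simp
  ultimately have u: "smooth_near z (\<lambda>w. profile_inv n d (profile n c ((cmod (w $ 0))\<^sup>2)))"
    by (rule smooth_near_compose_real)
  have s: "smooth_near z (slope c)"
    unfolding slope_def[abs_def] using D
    by (intro smooth_near_divide smooth_near_diff smooth_near_cmod_sq smooth_near_const
        smooth_near_mult[OF smooth_near_const])
  have su: "smooth_near z (\<lambda>w. slope c w * (1 - d * profile_inv n d (profile n c ((cmod (w $ 0))\<^sup>2))))"
    by (intro smooth_near_mult[OF s] smooth_near_diff[OF smooth_near_const]
        smooth_near_mult[OF smooth_near_const u])
  have "smooth_near z (\<lambda>w. (1 - profile_inv n d (profile n c ((cmod (w $ 0))\<^sup>2))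
       + slope c w * (1 - d * profile_inv n d (profile n c ((cmod (w $ 0))\<^sup>2)))) / 2)"
    "smooth_near z (\<lambda>w. (1 - profile_inv n d (profile n c ((cmod (w $ 0))\<^sup>2))
       - slope c w * (1 - d * profile_inv n d (profile n c ((cmod (w $ 0))\<^sup>2)))) / 2)"
    by (rule smooth_near_divide[OF smooth_near_add[OF smooth_near_diff[OF smooth_near_const u] su] smooth_near_const]
      smooth_near_divide[OF smooth_near_diff[OF smooth_near_diff[OF smooth_near_const u] su] smooth_near_const], simp)+
  then show ?thesis using u by (cases "j = 0"; cases "j = 1") (simp_all add: tsq_def Let_def)
qed

text \<open>The factor at a coordinate that vanishes is determined by the other two.\<close>

lemma transfer_local:
  assumes z: "z \<in> L"
  shows "\<exists>a U. open U \<and> z \<in> U \<and> (\<forall>j :: 3. smooth_near z (a j))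
    \<and> (\<forall>w\<in>L \<inter> U. \<forall>j. transfer n c d w $ j = a j w *\<^sub>R w $ j)"
proof -
  have p: "0 \<le> (cmod (z $ 0))\<^sup>2" "(cmod (z $ 0))\<^sup>2 < 1" using link_A_squares[OF z] by auto
  have K: "Kfun n c ((cmod (z $ 0))\<^sup>2) > 0" "Kfun n d (tsq n c d z 0) > 0"
    using Kfun_pos[OF c p] Kfun_pos[OF d tsq_props(1,2)[OF z]] by auto
  have D: "1 - c * (cmod (z $ 0))\<^sup>2 \<noteq> 0" "1 - d * tsq n c d z 0 \<noteq> 0"
    using mult_less_one[OF c p(2)] mult_less_one[OF d tsq_props(2)[OF z]] by auto
  have a0: "smooth_near z (\<lambda>w. tfac n c d w 0)"
    unfolding tfac_def if_True simp_thms
    using K D by (intro smooth_near_sqrt smooth_near_divide divide_pos_pos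
      smooth_near_compose_real[OF smooth_near_cmod_sq smooth_near_Kfun]
      smooth_near_compose_real[OF smooth_near_tsq[OF z] smooth_near_Kfun]) auto
  have nz: "tsq n c d z j > 0" if "z $ j \<noteq> 0" "j \<noteq> 0" for j
  proof (rule ccontr)
    assume "\<not> tsq n c d z j > 0"
    have j: "j = 1 \<or> j = 2" using that UNIV_3' by blast
    then have "tsq n c d z j = 0" using \<open>\<not> tsq n c d z j > 0\<close> tsq_props(7,8)[OF z] by auto
    then have "tsq n c d z 0 = 0" using tsq_props(6)[OF z] j by auto
    then have "profile n c ((cmod (z $ 0))\<^sup>2) = 0" using tsq_props(3)[OF z] by (simp add: profile_def)
    then have "z $ 0 = 0" using profile_zero_iff[OF p c] by simp
    then have s: "slope c z = (cmod (z $ 1))\<^sup>2 - (cmod (z $ 2))\<^sup>2" by (simp add: slope_def)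
    have "(cmod (z $ 1))\<^sup>2 * (cmod (z $ 2))\<^sup>2 = 0"
      using link_A_squares(2)[OF z] \<open>z $ 0 = 0\<close> by simp
    then show False
      using j that \<open>tsq n c d z j = 0\<close> \<open>tsq n c d z 0 = 0\<close> tsq_props(4,5)[OF z] s
        link_A_squares(1)[OF z] \<open>z $ 0 = 0\<close> by auto
  qed
  have aj: "smooth_near z (\<lambda>w. tfac n c d w j)" if "z $ j \<noteq> 0" "j \<noteq> 0" for j
    using nz[OF that] that unfolding tfac_def
    by (simp, intro smooth_near_sqrt smooth_near_divide smooth_near_tsq z smooth_near_cmod_sq divide_pos_pos) auto
  have tf: "tfac n c d z j \<noteq> 0" if "z $ j \<noteq> 0" "j \<noteq> 0" for j
    using nz[OF that] that by (simp add: tfac_def)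
  have main: ?thesis if jk: "{j, k} = {1, 2 :: 3}" "z $ j \<noteq> 0" for j k
  proof -
    have jk': "j \<noteq> 0" "k \<noteq> 0" "j \<noteq> k" using jk by (auto simp: doubleton_eq_iff)
    have cases: "l = 0 \<or> l = j \<or> l = k" for l using UNIV_3' jk by (metis UNIV_I insertE insert_iff singletonD)
    \<comment> \<open>The factor at \<open>k\<close> is rewritten by \<open>tfac_power\<close> as a
      quotient that is smooth at \<open>z\<close> even if \<open>z $ k = 0\<close>. At points with
      \<open>w $ k = 0\<close> both sides of the claim are 0.\<close>
    define a where "a l w = (if l = k then tfac n c d w 0 ^ (n + 1) / tfac n c d w j else tfac n c d w l)" for l w
    have "smooth_near z (a l)" for l
      using cases[of l] a0 aj[OF jk(2) jk'(1)] tf[OF jk(2) jk'(1)] jk' unfolding a_def[abs_def]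
      by (auto intro: smooth_near_divide[OF smooth_near_power[where k = "n + 1"], simplified])
    moreover have "transfer n c d w $ l = a l w *\<^sub>R w $ l" if w: "w \<in> L" "w $ j \<noteq> 0" for w l
    proof (cases "l = k \<and> w $ k \<noteq> 0")
      case True
      have w12: "w $ 1 \<noteq> 0" "w $ 2 \<noteq> 0" using True w jk by (auto simp: doubleton_eq_iff)
      have "tfac n c d w 0 ^ (n + 1) = tfac n c d w j * tfac n c d w k"
        using tfac_power[OF w(1) w12] jk(1) by (auto simp: doubleton_eq_iff)
      moreover have "tfac n c d w j \<noteq> 0"
      proof
        assume "tfac n c d w j = 0"
        then have "tsq n c d w j = 0" using tfac_sq(1)[OF w(1), of j] by simp
        then have "tsq n c d w 0 = 0"
          using tsq_props(6)[OF w(1)] jk(1) by (auto simp: doubleton_eq_iff)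
        then have "profile n c ((cmod (w $ 0))\<^sup>2) = 0" using tsq_props(3)[OF w(1)] by (simp add: profile_def)
        then have "w $ 0 = 0"
          using profile_zero_iff[OF _ link_A_squares(3)[OF w(1)] c] by simp
        then show False using link_A_squares(2)[OF w(1)] w12 by simp
      qed
      ultimately show ?thesis using True by (simp add: a_def transfer_def)
    qed (auto simp: a_def transfer_def)
    moreover have "open {w :: complex ^ 3. w $ j \<noteq> 0}"
      by (intro open_Collect_neq continuous_intros)
    ultimately show ?thesis
      using jk(2) by (intro exI[of _ a] exI[of _ "{w. w $ j \<noteq> 0}"]) auto
  qed
  show ?thesis
  proof (cases "z $ 1 = 0")
    case True
    then have "z $ 2 \<noteq> 0" using link_A_nonzero[OF z] by simp
    then show ?thesis by (rule main[rotated, of 2 1]) auto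
  next
    case False
    then show ?thesis by (rule main[rotated, of 1 2]) auto
  qed
qed

lemma smooth_near_vec:
  fixes f :: "3 \<Rightarrow> complex ^ 3 \<Rightarrow> complex"
  assumes "\<And>j. smooth_near z (f j)" shows "smooth_near z (\<lambda>w. \<chi> j. f j w)"
proof -
  have eq: "(\<chi> j. f j w) = (\<Sum>j\<in>UNIV. axis j (f j w))" for w
    by (simp add: vec_eq_iff axis_def sum_UNIV_3 forall_UNIV_3)
  have bl: "bounded_linear (axis j :: complex \<Rightarrow> complex ^ 3)" for j
    unfolding linear_conv_bounded_linear[symmetric] by (auto intro!: linearI simp: vec_eq_iff axis_def)
  show ?thesis
    unfolding eq by (rule smooth_near_sum) (rule smooth_near_linear_compose[OF bl assms])
qed

text \<open>The second claim records the shape of the differential: in each coordinate a real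
  scaling plus a real multiple of \<open>z $ j\<close>. The latter is radial and disappears from the
  imaginary parts that make up the contact forms.\<close>

lemma transfer_extension:
  assumes z: "z \<in> L"
  shows "\<exists>F U. smooth_near z F \<and> open U \<and> z \<in> U \<and> (\<forall>w\<in>L \<inter> U. F w = transfer n c d w)"
    and "\<exists>D t a. (transfer n c d has_derivative D) (at z within L)
      \<and> (\<forall>j. transfer n c d z $ j = t j *\<^sub>R z $ j) \<and> (\<forall>v j. D v $ j = t j *\<^sub>R v $ j + a j v *\<^sub>R z $ j)"
proof -
  obtain a U where a: "open U" "z \<in> U" "\<And>j :: 3. smooth_near z (a j)"
    "\<And>w j. w \<in> L \<inter> U \<Longrightarrow> transfer n c d w $ j = a j w *\<^sub>R w $ j"
    using transfer_local[OF z] by blast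
  define F where "F w = (\<chi> j. a j w *\<^sub>R w $ j)" for w :: "complex ^ 3"
  have F: "smooth_near z F"
    unfolding F_def[abs_def] by (intro smooth_near_vec smooth_near_scaleR a(3) smooth_near_vec_nth)
  have FM: "F w = transfer n c d w" if "w \<in> L \<inter> U" for w
    using a(4)[OF that] by (simp add: F_def vec_eq_iff)
  then show "\<exists>F U. smooth_near z F \<and> open U \<and> z \<in> U \<and> (\<forall>w\<in>L \<inter> U. F w = transfer n c d w)"
    using F a by blast
  obtain D where D: "(F has_derivative D) (at z)"
    using smooth_near_imp_differentiable[OF F] by (auto simp: differentiable_def)
  have aj: "(a j has_derivative frechet_derivative (a j) (at z)) (at z)" for j
    using smooth_near_imp_differentiable[OF a(3)] by (simp add: frechet_derivative_works)
  have nth: "((\<lambda>w. w $ j) has_derivative (\<lambda>v. v $ j)) (at z)" for j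
    by (rule bounded_linear_imp_has_derivative) (rule bounded_linear_vec_nth)
  have Dj: "D v $ j = a j z *\<^sub>R v $ j + frechet_derivative (a j) (at z) v *\<^sub>R z $ j" for v j
  proof -
    have "((\<lambda>w. F w $ j) has_derivative (\<lambda>v. D v $ j)) (at z)"
      by (rule bounded_linear.has_derivative[OF bounded_linear_vec_nth D])
    moreover have "((\<lambda>w. F w $ j) has_derivative
        (\<lambda>v. a j z *\<^sub>R v $ j + frechet_derivative (a j) (at z) v *\<^sub>R z $ j)) (at z)"
      unfolding F_def vec_lambda_beta by (rule has_derivative_scaleR[OF aj nth])
    ultimately show ?thesis by (rule fun_cong[OF has_derivative_unique])
  qed
  obtain e where e: "0 < e" "ball z e \<subseteq> U" using a(1,2) open_contains_ball by blast
  have "(transfer n c d has_derivative D) (at z within L)"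
    by (rule has_derivative_transform_within[OF has_derivative_at_withinI[OF D] e(1) z])
       (use e(2) FM in \<open>auto simp: dist_commute subset_iff\<close>)
  then show "\<exists>D t a. (transfer n c d has_derivative D) (at z within L)
      \<and> (\<forall>j. transfer n c d z $ j = t j *\<^sub>R z $ j) \<and> (\<forall>v j. D v $ j = t j *\<^sub>R v $ j + a j v *\<^sub>R z $ j)"
    using Dj a(2) a(4)[of z] z
    by (intro exI[of _ D] exI[of _ "\<lambda>j. a j z"] exI[of _ "\<lambda>j. frechet_derivative (a j) (at z)"]) auto
qed

lemma smooth_map_transfer: "smooth_map_on L (transfer n c d)"
  unfolding smooth_map_on_def
proof
  fix z assume z: "z \<in> L"
  obtain F U where F: "smooth_near z F" "open U" "z \<in> U" "\<forall>w\<in>L \<inter> U. F w = transfer n c d w"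
    using transfer_extension(1)[OF z] by blast
  obtain V where V: "open V" "z \<in> V" "smooth_on V F" using F(1) by (auto simp: smooth_near_def)
  have "smooth_on (V \<inter> U) F"
    using V(3) higher_differentiable_on_subset[of V F _ "V \<inter> U"] by (auto simp: smooth_on_def)
  then show "\<exists>U F. open U \<and> z \<in> U \<and> smooth_on U F \<and> (\<forall>y\<in>L \<inter> U. F y = transfer n c d y)"
    using F V by (intro exI[of _ "V \<inter> U"] exI[of _ F]) auto
qed

text \<open>\<open>Im (cnj (z $ j) * v $ j)\<close> divided by the squared modulus of
  \<open>z $ j\<close> is the angular velocity of that coordinate. Logarithmic differentiation of
  the equation of the link makes n + 1 times the first angular velocity equal to the sum of the
  other two. The remaining cases are the two exceptional circles.\<close>

lemma link_tangent_cases: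
  assumes z: "z \<in> L" and v: "dsing n z v = 0"
  defines "p \<equiv> (cmod (z $ 0))\<^sup>2" and "x \<equiv> (cmod (z $ 1))\<^sup>2" and "y \<equiv> (cmod (z $ 2))\<^sup>2"
  shows "(x \<noteq> 0 \<and> y \<noteq> 0 \<and> p \<noteq> 0 \<and> (real n + 1) * Im (cnj (z $ 0) * v $ 0)
       = p * (Im (cnj (z $ 1) * v $ 1) / x + Im (cnj (z $ 2) * v $ 2) / y))
   \<or> (x = 0 \<and> y = 1 \<and> z $ 0 = 0 \<and> z $ 1 = 0) \<or> (y = 0 \<and> x = 1 \<and> z $ 0 = 0 \<and> z $ 2 = 0)"
proof (cases "z $ 1 = 0 \<or> z $ 2 = 0")
  case True
  then have "p ^ (n + 1) = 0" using link_A_squares(2)[OF z] by (auto simp: p_def)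
  then have "z $ 0 = 0" by (auto simp: p_def)
  then show ?thesis using True link_A_squares(1)[OF z] unfolding x_def y_def by auto
next
  case False
  then have nz: "z $ 0 \<noteq> 0" using link_A_squares(2)[OF z] by auto
  have s: "2 * z $ 1 * z $ 2 = - (z $ 0 ^ (n + 1))"
    using z by (simp add: link_A_iff sing_poly_def add_eq_0_iff)
  have "(of_nat n + 1) * (v $ 0 / z $ 0) * z $ 0 ^ (n + 1) = (of_nat n + 1) * z $ 0 ^ n * v $ 0"
    using nz by simp
  also have "\<dots> = - (2 * (z $ 2 * v $ 1 + z $ 1 * v $ 2))"
    using v by (simp only: dsing_def add_eq_0_iff2)
  also have "\<dots> = - (2 * z $ 1 * z $ 2) * (v $ 1 / z $ 1 + v $ 2 / z $ 2)"
    using False by (simp add: field_simps)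
  also have "\<dots> = (v $ 1 / z $ 1 + v $ 2 / z $ 2) * z $ 0 ^ (n + 1)"
    unfolding s by simp
  finally have eq: "(of_nat n + 1) * (v $ 0 / z $ 0) = v $ 1 / z $ 1 + v $ 2 / z $ 2" using nz by simp
  have im: "Im (v $ j / z $ j) = Im (cnj (z $ j) * v $ j) / (cmod (z $ j))\<^sup>2" for j
    by (simp add: complex_div_cnj[of "v $ j"] mult.commute)
  have "Im ((of_nat n + 1) * q) = (real n + 1) * Im q" for q
    by simp
  from this[of "v $ 0 / z $ 0"] have "(real n + 1) * (Im (cnj (z $ 0) * v $ 0) / p)
      = Im (cnj (z $ 1) * v $ 1) / x + Im (cnj (z $ 2) * v $ 2) / y"
    unfolding eq plus_complex.simps im p_def x_def y_def by simp
  then show ?thesis using False nz by (simp add: p_def x_def y_def field_simps)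
qed

text \<open>In the angular velocities A, B of the coordinates 1 and 2, the form with parameter c is
  ((1 - c) p + 2 x)/2 A + ((1 - c) p + 2 y)/2 B. As x + y = 1 - p, it equals (1 - c p) ((1 +
  \<sigma>)/2 A + (1 - \<sigma>)/2 B) with \<sigma> the slope. The image has the same A, B and
  \<sigma>, so only the positive prefactor changes.\<close>

lemma transfer_form:
  assumes z: "z \<in> L" and v: "dsing n z v = 0"
    and w: "\<And>j. w $ j = t j *\<^sub>R v $ j + a j *\<^sub>R z $ j" and t: "\<And>j. transfer n c d z $ j = t j *\<^sub>R z $ j"
  shows "(1 - c * (cmod (z $ 0))\<^sup>2) * wIm ((real n + 1) / 2 * (1 - d)) 1 1 (transfer n c d z) w
    = (1 - d * tsq n c d z 0) * wIm ((real n + 1) / 2 * (1 - c)) 1 1 z v"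
proof -
  let ?p = "(cmod (z $ 0))\<^sup>2" and ?x = "(cmod (z $ 1))\<^sup>2" and ?y = "(cmod (z $ 2))\<^sup>2"
  define u X Y where "u = tsq n c d z 0" and "X = tsq n c d z 1" and "Y = tsq n c d z 2"
  define I where "I j = Im (cnj (z $ j) * v $ j)" for j
  have Iw: "Im (cnj (transfer n c d z $ j) * w $ j) = (t j)\<^sup>2 * I j" for j
    unfolding t w I_def by (simp add: algebra_simps power2_eq_square)
  have tsq': "(t j)\<^sup>2 * (cmod (z $ j))\<^sup>2 = tsq n c d z j" for j
    using cmod_transfer[OF z, of j] unfolding t by (simp add: power_mult_distrib)
  have D: "1 - c * ?p > 0" by (rule profile_slope(2)[OF z])
  have sl: "slope c z * (1 - c * ?p) = ?x - ?y" using D by (simp add: slope_def)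
  let ?G = "(1 - c * ?p) * ((real n + 1) / 2 * (1 - d) * ((t 0)\<^sup>2 * I 0) + 1 * ((t 1)\<^sup>2 * I 1) + 1 * ((t 2)\<^sup>2 * I 2))
      = (1 - d * u) * ((real n + 1) / 2 * (1 - c) * I 0 + 1 * I 1 + 1 * I 2)"
  \<comment> \<open>On an exceptional circle all terms vanish except that of the coordinate of
    modulus 1, whose modulus is preserved.\<close>
  have deg: "u = 0 \<and> I 0 = 0 \<and> I l = 0 \<and> tsq n c d z l = 0 \<and> tsq n c d z 1 + tsq n c d z 2 = 1"
    if "z $ 0 = 0" "z $ l = 0" for l
    using tsq_zero[OF z that(1)] tsq_zero[OF z that(2)] tsq_props(4)[OF z] that by (simp add: u_def I_def)
  show ?thesis
    unfolding wIm_def Iw I_def[symmetric] u_def[symmetric]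
    using link_tangent_cases[OF z v]
  proof (elim disjE conjE)
    assume nz: "?x \<noteq> 0" "?y \<noteq> 0" "?p \<noteq> 0"
      and I0: "(real n + 1) * Im (cnj (z $ 0) * v $ 0)
       = ?p * (Im (cnj (z $ 1) * v $ 1) / ?x + Im (cnj (z $ 2) * v $ 2) / ?y)"
    define A B where "A = I 1 / ?x" and "B = I 2 / ?y"
    have I: "(real n + 1) * I 0 = ?p * (A + B)" "I 1 = ?x * A" "I 2 = ?y * B"
      using nz I0 by (simp_all add: A_def B_def I_def)
    have tt: "(t 0)\<^sup>2 * ?p = u" "(t 1)\<^sup>2 * ?x = X" "(t 2)\<^sup>2 * ?y = Y"
      unfolding tsq' u_def X_def Y_def by (rule refl)+
    have "(real n + 1) / 2 * (1 - d) * ((t 0)\<^sup>2 * I 0) = (1 - d) / 2 * (t 0)\<^sup>2 * ((real n + 1) * I 0)" by simp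
    also have "\<dots> = (1 - d) / 2 * u * (A + B)" unfolding I tt(1)[symmetric] by simp
    finally have "(real n + 1) / 2 * (1 - d) * ((t 0)\<^sup>2 * I 0) + 1 * ((t 1)\<^sup>2 * I 1) + 1 * ((t 2)\<^sup>2 * I 2)
       = ((1 - d) * u + 2 * X) / 2 * A + ((1 - d) * u + 2 * Y) / 2 * B"
      unfolding I(2,3) mult.assoc[symmetric] tt by (simp add: field_simps)
    also have "\<dots> = (1 - d * u) * ((1 + slope c z) / 2 * A + (1 - slope c z) / 2 * B)"
    proof -
      have "(1 - d) * u + 2 * X = (1 - d * u) * (1 + slope c z)" "(1 - d) * u + 2 * Y = (1 - d * u) * (1 - slope c z)"
        using tsq_props(4,5)[OF z] unfolding u_def[symmetric] X_def[symmetric] Y_def[symmetric]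
        by (simp_all add: algebra_simps)
      then show ?thesis by (simp only:) (simp add: algebra_simps)
    qed
    finally have 1: "(real n + 1) / 2 * (1 - d) * ((t 0)\<^sup>2 * I 0) + 1 * ((t 1)\<^sup>2 * I 1) + 1 * ((t 2)\<^sup>2 * I 2)
       = (1 - d * u) * ((1 + slope c z) / 2 * A + (1 - slope c z) / 2 * B)" .
    have "(real n + 1) / 2 * (1 - c) * I 0 = (1 - c) / 2 * ((real n + 1) * I 0)" by simp
    also have "\<dots> = (1 - c) / 2 * ?p * (A + B)" unfolding I by simp
    finally have "(real n + 1) / 2 * (1 - c) * I 0 + 1 * I 1 + 1 * I 2
       = ((1 - c) * ?p + 2 * ?x) / 2 * A + ((1 - c) * ?p + 2 * ?y) / 2 * B"
      unfolding I(2,3) by (simp add: field_simps)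
    also have "\<dots> = (1 - c * ?p) * ((1 + slope c z) / 2 * A + (1 - slope c z) / 2 * B)"
    proof -
      have "(1 - c) * ?p + 2 * ?x = (1 - c * ?p) * (1 + slope c z)" "(1 - c) * ?p + 2 * ?y = (1 - c * ?p) * (1 - slope c z)"
        using link_A_squares(1)[OF z] sl by (simp_all add: algebra_simps)
      then show ?thesis by (simp only:) (simp add: algebra_simps add_divide_distrib diff_divide_distrib)
    qed
    finally show ?G
      unfolding 1 by simp
  next
    assume z0: "?x = 0" "?y = 1" "z $ 0 = 0" "z $ 1 = 0"
    then have "(t 2)\<^sup>2 = 1" using deg[OF z0(3), of 1] tsq'[of 2] by simp
    then show ?G using deg[OF z0(3), of 1] z0 by simp
  next
    assume z0: "?y = 0" "?x = 1" "z $ 0 = 0" "z $ 2 = 0"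
    then have "(t 1)\<^sup>2 = 1" using deg[OF z0(3), of 2] tsq'[of 1] by simp
    then show ?G using deg[OF z0(3), of 2] z0 by simp
  qed
qed

lemma transfer_tangent:
  assumes z: "z \<in> L" and v: "v \<in> tangent_space L z" "wIm ((real n + 1) / 2 * (1 - c)) 1 1 z v = 0"
  shows "tangent_map L (transfer n c d) z v \<in> tangent_space L (transfer n c d z)"
    "wIm ((real n + 1) / 2 * (1 - d)) 1 1 (transfer n c d z) (tangent_map L (transfer n c d) z v) = 0"
proof -
  obtain D t a where D: "(transfer n c d has_derivative D) (at z within L)"
    "\<And>j. transfer n c d z $ j = t j *\<^sub>R z $ j" "\<And>v j. D v $ j = t j *\<^sub>R v $ j + a j v *\<^sub>R z $ j"
    using transfer_extension(2)[OF z] by blast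
  have eq: "tangent_map L (transfer n c d) z v = D v" by (rule tangent_map_eq[OF D(1) v(1)])
  obtain k where k: "\<And>s. k s \<in> L" "k 0 = z" "(k has_vector_derivative v) (at 0)"
    using v(1) by (auto simp: tangent_space_def)
  show "tangent_map L (transfer n c d) z v \<in> tangent_space L (transfer n c d z)"
    unfolding eq tangent_space_def using within_derivative_curve[OF D(1) k] k transfer_link
    by (intro CollectI exI[of _ "\<lambda>s. transfer n c d (k s)"]) auto
  have "dsing n z v = 0" using v(1) z by (simp add: tangent_space_link)
  from transfer_form[OF z this D(3,2)] v(2) profile_slope(2)[OF z]
  show "wIm ((real n + 1) / 2 * (1 - d)) 1 1 (transfer n c d z) (tangent_map L (transfer n c d) z v) = 0"
    unfolding eq by simp
qed

end

text \<open>For the reverse inclusion the differential of the inverse map supplies a preimage;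
  following a curve through both maps shows that it is sent back to the given vector.\<close>

lemma (in transfer_link) transfer_contact:
  assumes z: "z \<in> L"
  shows "tangent_map L (transfer n c d) z ` {v \<in> tangent_space L z. wIm ((real n + 1) / 2 * (1 - c)) 1 1 z v = 0}
    = {w \<in> tangent_space L (transfer n c d z). wIm ((real n + 1) / 2 * (1 - d)) 1 1 (transfer n c d z) w = 0}"
    (is "?D ` ?A = ?B")
proof
  show "?D ` ?A \<subseteq> ?B" using transfer_tangent[OF z] by auto
  interpret bwd: transfer_link n d c using n c d by unfold_locales
  let ?w = "transfer n c d z"
  have w: "?w \<in> L" by (rule transfer_link[OF z])
  have bk: "transfer n d c ?w = z" by (rule transfer_transfer[OF z])
  show "?B \<subseteq> ?D ` ?A"
  proof
    fix b assume b: "b \<in> ?B"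
    define v where "v = tangent_map L (transfer n d c) ?w b"
    have v: "v \<in> ?A" using bwd.transfer_tangent[OF w, of b] b unfolding v_def bk by auto
    obtain k where k: "\<And>s. k s \<in> L" "k 0 = ?w" "(k has_vector_derivative b) (at 0)"
      using b by (auto simp: tangent_space_def)
    have 1: "(transfer n d c has_derivative tangent_map L (transfer n d c) ?w) (at ?w within L)"
      using bwd.transfer_extension(2)[OF w] by (auto simp: frechet_derivative_works[symmetric] differentiable_def)
    have 2: "(transfer n c d has_derivative ?D) (at z within L)"
      using transfer_extension(2)[OF z] by (auto simp: frechet_derivative_works[symmetric] differentiable_def)
    have "((\<lambda>s. transfer n c d (transfer n d c (k s))) has_vector_derivative ?D v) (at 0)"
      by (rule within_derivative_curve[OF 2])
         (use bwd.transfer_link k bk within_derivative_curve[OF 1 k] in \<open>auto simp: v_def\<close>)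
    then have "(k has_vector_derivative ?D v) (at 0)"
      using bwd.transfer_transfer[OF k(1)] by simp
    then have "?D v = b" using k(3) by (rule vector_derivative_unique_at)
    then show "b \<in> ?D ` ?A" using v by blast
  qed
qed

lemma (in transfer_link) transfer_diffeomorphism: "diffeomorphism L L (transfer n c d)"
proof -
  interpret bwd: transfer_link n d c using n c d by unfold_locales
  have bij: "bij_betw (transfer n c d) L L"
    by (rule bij_betw_byWitness[where f' = "transfer n d c"])
       (use transfer_transfer bwd.transfer_transfer transfer_link bwd.transfer_link in auto)
  have "inv_into L (transfer n c d) w = transfer n d c w" if "w \<in> L" for w
    using inv_into_f_eq[OF bij_betw_imp_inj_on[OF bij] bwd.transfer_link[OF that]] bwd.transfer_transfer[OF that]
    by simp
  then have "smooth_map_on L (inv_into L (transfer n c d))"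
    using bwd.smooth_map_transfer unfolding smooth_map_on_def by (metis IntD1)
  then show ?thesis using bij smooth_map_transfer by (simp add: diffeomorphism_def)
qed

lemma contactomorphic_link:
  assumes "1 \<le> n" "0 < \<epsilon>" "\<epsilon> < 1"
  shows "contactomorphic (link_A n) alpha_0 (link_A n) (alpha_eps n \<epsilon>)"
proof -
  interpret reeb_link n \<epsilon> using assms by unfold_locales
  \<comment> \<open>This parameter makes the weight at coordinate 0 equal to 1, as in
    \<open>alpha_0\<close>. The parameter 0 gives \<open>om z\<close>, which is
    \<open>alpha_eps\<close> multiplied by the positive function 2 H.\<close>
  define m where "m = (real n - 1) / (real n + 1)"
  interpret transfer_link n m 0 using assms by unfold_locales (auto simp: m_def)
  have "1 - m = 2 / (real n + 1)" by (simp add: m_def field_simps)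
  then have w: "(real n + 1) / 2 * (1 - m) = 1" by simp
  have "contact_structure (link_A n) alpha_0 z
      = {v \<in> tangent_space (link_A n) z. wIm ((real n + 1) / 2 * (1 - m)) 1 1 z v = 0}" for z
    unfolding contact_structure_def alpha_0_eq w by simp
  moreover have "contact_structure (link_A n) (alpha_eps n \<epsilon>) z
      = {v \<in> tangent_space (link_A n) z. wIm ((real n + 1) / 2 * (1 - 0)) 1 1 z v = 0}" if "z \<in> link_A n" for z
    using H_pos[OF link_A_not_0[OF that]] lam_om[of z, symmetric] unfolding contact_structure_def alpha_eps_eq by auto
  ultimately show ?thesis
    unfolding contactomorphic_def
    using contact_form_alpha_0 contact_form_alpha_eps transfer_diffeomorphism transfer_contact transfer_link
    by (intro conjI exI[of _ "transfer n m 0"]) auto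
qed

section \<open>Closed Reeb orbits\<close>

lemma cis_eq_1_int: "cis x = 1 \<longleftrightarrow> (\<exists>k :: int. x = 2 * pi * of_int k)"
proof
  assume "cis x = 1"
  then have "cos x = 1" by (simp add: complex_eq_iff)
  then show "\<exists>k :: int. x = 2 * pi * of_int k" by (auto simp: cos_one_2pi_int mult_ac)
qed (auto simp: complex_eq_iff sin_int_2pin cos_int_2pin simp del: mult.assoc mult.commute mult.left_commute)

locale irrational_link = reeb_link +
  assumes irr: "\<epsilon> \<notin> \<rat>"
begin

text \<open>Half the frequency of the coordinate 1 or 2; the simple orbit in that coordinate has
  period \<open>pi / amp j\<close>. At index 0 the value 1 - \<epsilon> keeps positivity and
  irrationality free of side conditions.\<close>

definition amp :: "3 \<Rightarrow> real" where
  "amp j = (if j = 1 then 1 + \<epsilon> else 1 - \<epsilon>)"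

lemma amp: "j \<noteq> 0 \<Longrightarrow> freq j = 2 * amp j" "0 < amp j" "amp j \<notin> \<rat>"
proof -
  show "j \<noteq> 0 \<Longrightarrow> freq j = 2 * amp j" by (simp add: freq_def amp_def)
  show "0 < amp j" using eps by (simp add: amp_def)
  show "amp j \<notin> \<rat>"
  proof
    assume "amp j \<in> \<rat>"
    then have "amp j - 1 \<in> \<rat>" "1 - amp j \<in> \<rat>" by (auto intro: Rats_diff Rats_1)
    then show False using irr by (auto simp: amp_def split: if_splits)
  qed
qed

lemma rot_axis: "rot t (axis j x) = axis j (cis (freq j * t) * x)"
  by (simp add: rot_def vec_eq_iff axis_def)

lemma axis_link: assumes "j \<noteq> 0" "cmod x = 1" shows "axis j x \<in> M"
proof -
  have j: "j = 1 \<or> j = 2" using assms(1) UNIV_3' by blast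
  then show ?thesis using assms n by (auto simp: link_A_iff sing_poly_def wRe_self axis_def)
qed

lemma link_axis:
  assumes z: "z \<in> M" and "z $ 1 = 0 \<or> z $ 2 = 0"
  obtains j x where "j \<noteq> 0" "cmod x = 1" "z = axis j x"
proof -
  have "((cmod (z $ 0))\<^sup>2) ^ (n + 1) = 0" using assms(2) link_A_squares(2)[OF z] by auto
  then have z0: "z $ 0 = 0" by auto
  have "(cmod (z $ 1))\<^sup>2 + (cmod (z $ 2))\<^sup>2 = 1" using link_A_squares(1)[OF z] z0 by simp
  then have "z $ 1 = 0 \<and> cmod (z $ 2) = 1 \<or> z $ 2 = 0 \<and> cmod (z $ 1) = 1"
    using assms(2) by (auto simp: power2_eq_1_iff) (smt (verit) norm_ge_zero)+
  moreover have "z = axis 2 (z $ 2)" if "z $ 1 = 0" using that z0 by (simp add: vec_eq_3 axis_def)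
  moreover have "z = axis 1 (z $ 1)" if "z $ 2 = 0" using that z0 by (simp add: vec_eq_3 axis_def)
  ultimately show ?thesis using that[of 1 "z $ 1"] that[of 2 "z $ 2"] by auto
qed

lemma rot_fixed:
  assumes "rot T z = z" "z $ j \<noteq> 0" obtains k :: int where "freq j * T = 2 * pi * of_int k"
proof -
  have "cis (freq j * T) * z $ j = z $ j" using assms(1) by (metis rot_def vec_lambda_beta)
  then have "cis (freq j * T) = 1" using assms(2) by simp
  then show ?thesis using that cis_eq_1_int by blast
qed

text \<open>If both coordinates are nonzero, (1 + \<epsilon>) T and (1 - \<epsilon>) T are integer
  multiples k and l of \<open>pi\<close>, and \<epsilon> = (k - l)/(k + l) would be
  rational.\<close>

lemma closed_on_axis:
  assumes z: "z \<in> M" and "rot T z = z" "0 < T"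
  shows "z $ 1 = 0 \<or> z $ 2 = 0"
proof (rule ccontr)
  assume "\<not> ?thesis"
  then obtain k l :: int where "freq 1 * T = 2 * pi * of_int k" "freq 2 * T = 2 * pi * of_int l"
    using rot_fixed[OF assms(2)] by metis
  moreover have "freq 1 = 2 * (1 + \<epsilon>)" "freq 2 = 2 * (1 - \<epsilon>)" by (simp_all add: freq_def)
  ultimately have kl: "(1 + \<epsilon>) * T = pi * of_int k" "(1 - \<epsilon>) * T = pi * of_int l"
    by (simp_all only: mult.assoc mult_left_cancel[of "2 :: real"] zero_neq_numeral[symmetric] not_False_eq_True)
  have "(1 + \<epsilon>) * T > 0" "(1 - \<epsilon>) * T > 0" using eps assms(3) by auto
  then have pos: "real_of_int k > 0" "real_of_int l > 0" unfolding kl by (simp_all add: zero_less_mult_iff)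
  have "2 * T = pi * of_int (k + l)" "2 * (\<epsilon> * T) = pi * of_int (k - l)"
    using kl by (auto simp: algebra_simps)
  then have "\<epsilon> * (pi * of_int (k + l)) = pi * of_int (k - l)" by (metis mult.left_commute)
  then have "pi * (\<epsilon> * of_int (k + l)) = pi * of_int (k - l)" by (simp only: mult.left_commute)
  then have "\<epsilon> * of_int (k + l) = of_int (k - l)" by (simp only: mult_left_cancel[OF pi_neq_zero])
  then have "\<epsilon> = of_int (k - l) / of_int (k + l)" using pos by (simp add: eq_divide_eq)
  then show False using irr by (metis Rats_divide Rats_of_int)
qed

lemma reeb_orbit_iff:
  "reeb_orbit M \<alpha> T \<gamma> \<longleftrightarrow> 0 < T \<and> (\<exists>j x k. j \<noteq> 0 \<and> cmod x = 1 \<and> freq j * T = 2 * pi * of_int k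
     \<and> \<gamma> = (\<lambda>t. axis j (cis (freq j * t) * x)))" (is "_ \<longleftrightarrow> 0 < T \<and> ?R")
proof (intro iffI conjI)
  assume o: "reeb_orbit M \<alpha> T \<gamma>"
  then show T: "0 < T" by (simp add: reeb_orbit_def)
  have \<gamma>: "\<gamma> 0 \<in> M" "\<gamma> = (\<lambda>t. rot t (\<gamma> 0))" "\<gamma> (0 + T) = \<gamma> 0"
    using o reeb_trajectory_iff[of \<gamma>] unfolding reeb_orbit_def by blast+
  have fx: "rot T (\<gamma> 0) = \<gamma> 0" using \<gamma>(2,3) by (metis add_0)
  obtain j x where j: "j \<noteq> 0" "cmod x = 1" "\<gamma> 0 = axis j x"
    using link_axis[OF \<gamma>(1) closed_on_axis[OF \<gamma>(1) fx T]] by blast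
  have "\<gamma> 0 $ j \<noteq> 0" using j by (auto simp: axis_def)
  then obtain k where "freq j * T = 2 * pi * of_int k" using rot_fixed[OF fx] by blast
  moreover have "\<gamma> = (\<lambda>t. axis j (cis (freq j * t) * x))" using \<gamma>(2) j(3) by (simp add: rot_axis)
  ultimately show ?R using j by blast
next
  assume *: "0 < T \<and> ?R"
  then obtain j x k where j: "j \<noteq> 0" "cmod x = 1" "freq j * T = 2 * pi * of_int k"
    "\<gamma> = (\<lambda>t. axis j (cis (freq j * t) * x))" by blast
  have "cis (freq j * T) = 1" using j(3) cis_eq_1_int by blast
  then have "cis (freq j * (t + T)) = cis (freq j * t)" for t
    by (simp add: distrib_left flip: cis_mult)
  then have per: "\<gamma> (t + T) = \<gamma> t" for t using j(4) by simp
  have "\<gamma> = (\<lambda>t. rot t (axis j x))" using j(4) by (simp add: rot_axis)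
  then have "reeb_trajectory M \<alpha> \<gamma>" using rot_trajectory axis_link[OF j(1,2)] by simp
  then show "reeb_orbit M \<alpha> T \<gamma>" using * per by (simp add: reeb_orbit_def)
qed

text \<open>The period is a positive integer multiple of \<open>pi / amp j\<close>. If the multiple
  were larger than 1, the orbit would be back at its initial point at time
  \<open>pi / amp j\<close>, against injectivity.\<close>

lemma simple_orbit_iff:
  "simple_reeb_orbit M \<alpha> T \<gamma> \<longleftrightarrow>
     (\<exists>j. j \<noteq> 0 \<and> T = pi / amp j \<and> (\<exists>s. \<forall>t. \<gamma> t = axis j (cis (2 * amp j * (t + s)))))"
proof
  assume s: "simple_reeb_orbit M \<alpha> T \<gamma>"
  then obtain j x k where j: "j \<noteq> 0" "cmod x = 1" "freq j * T = 2 * pi * of_int k"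
    "\<gamma> = (\<lambda>t. axis j (cis (freq j * t) * x))" and T: "0 < T" and inj: "inj_on \<gamma> {0..<T}"
    unfolding simple_reeb_orbit_def reeb_orbit_iff by blast
  note a = amp(1)[OF j(1)] amp(2)[of j]
  have aT: "amp j * T = pi * of_int k" using j(3) a by simp
  then have "real_of_int k > 0" using a T by (metis mult_pos_pos pi_gt_zero zero_less_mult_pos)
  then have k1: "k \<ge> 1" by simp
  have "T = pi / amp j"
  proof (rule ccontr)
    assume ne: "T \<noteq> pi / amp j"
    have Teq: "T = pi / amp j * of_int k" using aT a by (simp add: field_simps)
    then have "k \<noteq> 1" using ne by auto
    then have "real_of_int k > 1" using k1 by simp
    then have "pi / amp j * 1 < pi / amp j * of_int k" using a by (intro mult_strict_left_mono) auto
    then have mem: "pi / amp j \<in> {0..<T}" "0 \<in> {0..<T}" using a T Teq by auto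
    have "\<gamma> (pi / amp j) = \<gamma> 0" using j(4) a by simp
    then show False using inj_onD[OF inj _ mem] a by simp
  qed
  moreover obtain \<theta> where x: "x = cis \<theta>" using j(2) by (metis cis_Arg norm_zero zero_neq_one rcis_cmod_Arg rcis_def mult_1 of_real_1)
  have "\<gamma> t = axis j (cis (2 * amp j * (t + \<theta> / (2 * amp j))))" for t
    using a unfolding j(4) x cis_mult by (simp add: distrib_left)
  ultimately show "\<exists>j. j \<noteq> 0 \<and> T = pi / amp j \<and> (\<exists>s. \<forall>t. \<gamma> t = axis j (cis (2 * amp j * (t + s))))"
    using j(1) by blast
next
  assume "\<exists>j. j \<noteq> 0 \<and> T = pi / amp j \<and> (\<exists>s. \<forall>t. \<gamma> t = axis j (cis (2 * amp j * (t + s))))"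
  then obtain j s where j: "j \<noteq> 0" "T = pi / amp j" "\<And>t. \<gamma> t = axis j (cis (2 * amp j * (t + s)))"
    by blast
  note a = amp(1)[OF j(1)] amp(2)[of j]
  have T: "0 < T" using j(2) a by simp
  have "\<gamma> = (\<lambda>t. axis j (cis (freq j * t) * cis (2 * amp j * s)))"
    using j(3) a by (simp add: cis_mult distrib_left fun_eq_iff)
  moreover have "freq j * T = 2 * pi * of_int 1" using j(2) a by simp
  ultimately have orb: "reeb_orbit M \<alpha> T \<gamma>"
    unfolding reeb_orbit_iff using T j(1) by (metis norm_cis)
  have "inj_on \<gamma> {0..<T}"
  proof (rule inj_onI)
    fix t u assume tu: "t \<in> {0..<T}" "u \<in> {0..<T}" "\<gamma> t = \<gamma> u"
    have "cis (2 * amp j * (t + s)) = cis (2 * amp j * (u + s))"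
      using tu(3) unfolding j(3) by (metis axis_nth)
    then have "cis (2 * amp j * (t + s) - 2 * amp j * (u + s)) = 1"
      by (simp flip: cis_divide)
    then obtain k where k: "2 * amp j * (t + s) - 2 * amp j * (u + s) = 2 * pi * of_int k"
      using cis_eq_1_int by blast
    then have tk: "amp j * (t - u) = pi * of_int k" by (simp add: algebra_simps)
    have "\<bar>t - u\<bar> < T" using tu by auto
    then have "amp j * \<bar>t - u\<bar> < amp j * T" using a by simp
    then have "\<bar>amp j * (t - u)\<bar> < pi" using a j(2) by (simp add: abs_mult)
    then have "pi * \<bar>real_of_int k\<bar> < pi * 1" unfolding tk by (simp add: abs_mult)
    then have "\<bar>real_of_int k\<bar> < 1" by (simp only: mult_less_cancel_left_pos[OF pi_gt_zero])
    then have "k = 0" by linarith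
    then show "t = u" using tk a by simp
  qed
  then show "simple_reeb_orbit M \<alpha> T \<gamma>" using orb by (simp add: simple_reeb_orbit_def)
qed

lemma contact_structure_axis:
  assumes j: "j \<noteq> 0" and x: "cmod x = 1"
  shows "contact_structure M \<alpha> (axis j x) = range (axis 0)"
proof -
  have z: "axis j x \<in> M" by (rule axis_link[OF assms])
  have x0: "x \<noteq> 0" using x by auto
  have H: "H (axis j x) \<noteq> 0" using H_pos[OF link_A_not_0[OF z]] by simp
  have cases: "j = 1 \<or> j = 2" using j UNIV_3' by blast
  \<comment> \<open>Here n \<ge> 1 enters: the coordinate 0 disappears from \<open>dsing\<close> on
    the axis, which leaves it free in the contact plane.\<close>
  have nz: "(0 :: complex) ^ n = 0" using n by simp
  have "v \<in> contact_structure M \<alpha> (axis j x) \<longleftrightarrow> v $ 1 = 0 \<and> v $ 2 = 0" for v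
  proof -
    have c0: "Re (cnj x * y) = 0 \<and> Im (cnj x * y) = 0 \<longleftrightarrow> y = 0" for y
      using x0 complex_eq_iff[of "cnj x * y" 0] by simp
    have "v \<in> contact_structure M \<alpha> (axis j x) \<longleftrightarrow>
       dsing n (axis j x) v = 0 \<and> wRe 1 1 1 (axis j x) v = 0 \<and> lam (axis j x) v = 0"
      using H z by (simp add: contact_structure_def tangent_space_link alpha_eps_eq)
    also have "\<dots> \<longleftrightarrow> v $ 1 = 0 \<and> v $ 2 = 0"
      using cases
    proof
      assume j: "j = 1"
      have "dsing n (axis j x) v = 2 * (x * v $ 2)" "wRe 1 1 1 (axis j x) v = Re (cnj x * v $ 1)"
        "lam (axis j x) v = Im (cnj x * v $ 1) / 2"
        unfolding j using nz by (simp_all add: dsing_def wRe_def wIm_def axis_def)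
      moreover have "2 * (x * v $ 2) = 0 \<longleftrightarrow> v $ 2 = 0" using x0 by simp
      moreover have "Im (cnj x * v $ 1) / 2 = 0 \<longleftrightarrow> Im (cnj x * v $ 1) = 0" by simp
      ultimately show ?thesis using c0[of "v $ 1"] by metis
    next
      assume j: "j = 2"
      have "dsing n (axis j x) v = 2 * (x * v $ 1)" "wRe 1 1 1 (axis j x) v = Re (cnj x * v $ 2)"
        "lam (axis j x) v = Im (cnj x * v $ 2) / 2"
        unfolding j using nz by (simp_all add: dsing_def wRe_def wIm_def axis_def)
      moreover have "2 * (x * v $ 1) = 0 \<longleftrightarrow> v $ 1 = 0" using x0 by simp
      moreover have "Im (cnj x * v $ 2) / 2 = 0 \<longleftrightarrow> Im (cnj x * v $ 2) = 0" by simp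
      ultimately show ?thesis using c0[of "v $ 2"] by metis
    qed
    finally show ?thesis .
  qed
  moreover have "v \<in> range (axis 0) \<longleftrightarrow> v $ 1 = 0 \<and> v $ 2 = 0" for v :: "complex ^ 3"
  proof
    assume "v $ 1 = 0 \<and> v $ 2 = 0"
    then have "v = axis 0 (v $ 0)" by (simp add: vec_eq_3 axis_def)
    then show "v \<in> range (axis 0)" by blast
  qed (auto simp: axis_def)
  ultimately show ?thesis by blast
qed

text \<open>\<open>freq 0\<close> is rational and \<open>amp j\<close> is not, so the two rotations
  have no common period.\<close>

lemma freq_0_nonresonant:
  assumes "j \<noteq> 0" "0 < T" "freq j * T = 2 * pi * of_int k" shows "cis (freq 0 * T) \<noteq> 1"
proof
  assume "cis (freq 0 * T) = 1"
  then obtain l where l: "freq 0 * T = 2 * pi * of_int l" using cis_eq_1_int by blast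
  have k: "amp j * T = pi * of_int k" using assms(3) amp(1)[OF assms(1)] by simp
  have l': "2 / (real n + 1) * T = pi * of_int l" using l by (simp add: freq_def)
  then have "real_of_int l > 0" using assms(2)
    by (metis add_pos_pos divide_pos_pos mult_pos_pos of_nat_0_less_iff n less_le_trans pi_gt_zero zero_less_mult_pos zero_less_numeral zero_less_one)
  moreover have "amp j * (pi * of_int l) = 2 / (real n + 1) * (amp j * T)" unfolding l'[symmetric] by simp
  then have "pi * (amp j * of_int l) = pi * (2 / (real n + 1) * of_int k)" unfolding k by (simp add: mult_ac)
  then have "amp j * of_int l = 2 / (real n + 1) * of_int k" by (simp only: mult_left_cancel[OF pi_neq_zero])
  ultimately have "amp j = 2 / (real n + 1) * of_int k / of_int l" by (simp add: eq_divide_eq mult_ac)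
  also have "\<dots> \<in> \<rat>" by (intro Rats_divide Rats_mult Rats_add) auto
  finally show False using amp(3) by blast
qed

lemma nondegenerate: "nondegenerate_contact_form M \<alpha>"
  unfolding nondegenerate_contact_form_def
proof (intro conjI allI impI contact_form_alpha_eps)
  fix T \<gamma> assume "reeb_orbit M \<alpha> T \<gamma>"
  then obtain j x k where j: "j \<noteq> 0" "cmod x = 1" "freq j * T = 2 * pi * of_int k"
    "\<gamma> = (\<lambda>t. axis j (cis (freq j * t) * x))" and T: "0 < T"
    unfolding reeb_orbit_iff by blast
  have \<gamma>0: "\<gamma> 0 = axis j x" using j(4) by simp
  show "nondegenerate_orbit M \<alpha> T \<gamma>"
    unfolding nondegenerate_orbit_def
  proof
    assume "\<exists>v\<in>contact_structure M \<alpha> (\<gamma> 0). v \<noteq> 0 \<and> tangent_map M (reeb_flow M \<alpha> T) (\<gamma> 0) v = v"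
    then obtain v where v: "v \<in> contact_structure M \<alpha> (axis j x)" "v \<noteq> 0"
      "tangent_map M (reeb_flow M \<alpha> T) (axis j x) v = v" unfolding \<gamma>0 by blast
    obtain y where y: "v = axis 0 y" using v(1) contact_structure_axis[OF j(1,2)] by blast
    have "v \<in> tangent_space M (axis j x)" using v(1) by (simp add: contact_structure_def)
    then have "rot T v = v" using v(3) tangent_map_flow[OF axis_link[OF j(1,2)]] by simp
    then have "cis (freq 0 * T) * y = y" unfolding y rot_axis by (metis axis_nth)
    moreover have "y \<noteq> 0" using v(2) y by (auto simp: axis_def vec_eq_iff)
    ultimately have "cis (freq 0 * T) = 1" by simp
    then show False using freq_0_nonresonant[OF j(1) T j(3)] by blast
  qed
qed

end

section \<open>Two-by-two symplectic matrices\<close>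

definition mat2 :: "real \<Rightarrow> real \<Rightarrow> real \<Rightarrow> real \<Rightarrow> 1 sq_matrix" where
  "mat2 a b c d = (\<chi> i j. case i of Inl _ \<Rightarrow> (case j of Inl _ \<Rightarrow> a | Inr _ \<Rightarrow> b)
     | Inr _ \<Rightarrow> (case j of Inl _ \<Rightarrow> c | Inr _ \<Rightarrow> d))"

lemma mat2_nth [simp]: "mat2 a b c d $ Inl p $ Inl q = a" "mat2 a b c d $ Inl p $ Inr q = b"
  "mat2 a b c d $ Inr p $ Inl q = c" "mat2 a b c d $ Inr p $ Inr q = d"
  by (simp_all add: mat2_def)

lemma UNIV_11: "(UNIV :: (1 + 1) set) = {Inl 1, Inr 1}"
proof -
  have "x = Inl 1 \<or> x = Inr 1" for x :: "1 + 1"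
    by (cases x) (simp_all add: num1_eq1)
  then show ?thesis by blast
qed

lemma forall_11: "(\<forall>i :: 1 + 1. P i) \<longleftrightarrow> P (Inl 1) \<and> P (Inr 1)"
  by (metis UNIV_11 UNIV_I insertE singletonD)

lemma sum_11: "(\<Sum>i\<in>UNIV. f i) = f (Inl 1) + f (Inr (1 :: 1))" for f :: "1 + 1 \<Rightarrow> 'a::comm_monoid_add"
  unfolding UNIV_11 by simp

lemma mat2_eq: "A = mat2 (A $ Inl 1 $ Inl 1) (A $ Inl 1 $ Inr 1) (A $ Inr 1 $ Inl 1) (A $ Inr 1 $ Inr 1)"
  by (simp add: vec_eq_iff forall_11)

lemma mat2_eq_iff: "mat2 a b c d = mat2 a' b' c' d' \<longleftrightarrow> a = a' \<and> b = b' \<and> c = c' \<and> d = d'"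
  by (auto simp: vec_eq_iff forall_11)

lemma mat2_exhaust: obtains a b c d where "A = mat2 a b c d"
  using mat2_eq by blast

lemma mat2_mult: "mat2 a b c d ** mat2 a' b' c' d'
    = mat2 (a * a' + b * c') (a * b' + b * d') (c * a' + d * c') (c * b' + d * d')"
  by (simp add: vec_eq_iff forall_11 matrix_matrix_mult_def sum_11)

lemma mat2_transpose: "transpose (mat2 a b c d) = mat2 a c b d"
  by (simp add: vec_eq_iff forall_11 transpose_def)

lemma mat2_mat_1: "mat 1 = mat2 1 0 0 1"
  by (simp add: vec_eq_iff forall_11 mat_def)

lemma mat2_J0: "J0 = mat2 0 (-1) 1 0"
  by (simp add: vec_eq_iff forall_11 J0_def)

lemma mat2_diff: "mat2 a b c d - mat2 a' b' c' d' = mat2 (a - a') (b - b') (c - c') (d - d')"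
  by (simp add: vec_eq_iff forall_11)

lemma mat2_minus: "- mat2 a b c d = mat2 (- a) (- b) (- c) (- d)"
  by (simp add: vec_eq_iff forall_11)

lemma mat2_Sp: "mat2 a b c d \<in> Sp \<longleftrightarrow> a * d - b * c = 1"
  by (auto simp: Sp_def mat2_J0 mat2_transpose mat2_mult mat2_eq_iff algebra_simps)

lemma mat2_det: "det (mat2 a b c d) = a * d - b * c"
proof -
  have f: "finite {Inr (1 :: 1) :: 1 + 1}" "Inl (1 :: 1) \<notin> {Inr (1 :: 1) :: 1 + 1}" by auto
  show ?thesis
    unfolding det_def UNIV_11
    unfolding sum_over_permutations_insert[OF f]
    unfolding permutes_sing
    by (simp add: sign_swap_id permutation_swap_id sign_compose sign_id swap_id_eq)
qed

lemma mat2_quadratic: "v \<bullet> (mat2 a b c d *v v)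
    = a * (v $ Inl 1)\<^sup>2 + (b + c) * (v $ Inl 1 * v $ Inr 1) + d * (v $ Inr 1)\<^sup>2"
  by (simp add: inner_vec_def matrix_vector_mult_def sum_11 power2_eq_square algebra_simps)

lemma continuous_on_mat2:
  assumes "continuous_on S a" "continuous_on S b" "continuous_on S c" "continuous_on S d"
  shows "continuous_on S (\<lambda>t. mat2 (a t) (b t) (c t) (d t))"
  unfolding mat2_def
proof (intro continuous_on_vec_lambda)
  fix i j :: "1 + 1"
  show "continuous_on S (\<lambda>t. case i of Inl _ \<Rightarrow> (case j of Inl _ \<Rightarrow> a t | Inr _ \<Rightarrow> b t)
     | Inr _ \<Rightarrow> (case j of Inl _ \<Rightarrow> c t | Inr _ \<Rightarrow> d t))"
    using assms by (cases i; cases j) simp_all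
qed

section \<open>Polar decomposition and the phase \<open>rho\<close>\<close>

lemma mat2_posdef_det:
  assumes "transpose P = P" "\<And>v. v \<noteq> 0 \<Longrightarrow> 0 < v \<bullet> (P *v v)" "P = mat2 p q r s"
  shows "q = r" "0 < p + s" "0 < p * s - q * r"
proof -
  show qr: "q = r" using assms(1) unfolding assms(3) mat2_transpose mat2_eq_iff by blast
  define vec2 where "vec2 x y = (\<chi> i :: 1 + 1. case i of Inl _ \<Rightarrow> x | Inr _ \<Rightarrow> y)" for x y :: real
  have v: "vec2 x y $ Inl 1 = x" "vec2 x y $ Inr 1 = y" for x y by (simp_all add: vec2_def)
  have pos: "0 < p * x\<^sup>2 + (q + r) * (x * y) + s * y\<^sup>2" if "x \<noteq> 0 \<or> y \<noteq> 0" for x y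
    using assms(2)[of "vec2 x y"] that unfolding assms(3) mat2_quadratic v by (auto simp: vec_eq_iff forall_11 v)
  have p: "0 < p" using pos[of 1 0] by simp
  moreover have "0 < s" using pos[of 0 1] by simp
  ultimately show "0 < p + s" by simp
  \<comment> \<open>The vector (- q, p) is the critical direction: the quadratic form takes there
    the value p times the determinant.\<close>
  have "0 < p * (p * s - q * r)" using pos[of "- q" p] p qr by (simp add: power2_eq_square algebra_simps)
  then show "0 < p * s - q * r" using p by (simp add: zero_less_mult_iff)
qed

text \<open>The orthogonal factor is the rotation through the argument of (a + d) + \<i> (c - b).
  For uniqueness: a positive definite factor forces the orthogonal one to have determinant 1, so it
  is a rotation, and trace and antisymmetric part of the product recover its angle.\<close>

lemma polar_unitary_mat2:
  assumes det: "a * d - b * c = 1"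
  defines "s \<equiv> a + d" and "t \<equiv> c - b"
  defines "r \<equiv> sqrt (s\<^sup>2 + t\<^sup>2)"
  shows "polar_unitary (mat2 a b c d) = mat2 (s / r) (- t / r) (t / r) (s / r)"
  unfolding polar_unitary_def
proof (rule the_equality)
  have "s\<^sup>2 + t\<^sup>2 = (a - d)\<^sup>2 + (b + c)\<^sup>2 + 4 * (a * d - b * c)"
    by (simp add: s_def t_def power2_eq_square algebra_simps)
  then have "s\<^sup>2 + t\<^sup>2 > 0" unfolding det by (smt (verit) zero_le_power2)
  then have r: "r > 0" "r * r = s\<^sup>2 + t\<^sup>2" by (simp_all add: r_def)
  define U where "U = mat2 (s / r) (- t / r) (t / r) (s / r)"
  \<comment> \<open>The product of the given matrix with the transpose of \<open>U\<close>.\<close>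
  define P where "P = mat2 ((a * s - b * t) / r) ((a * t + b * s) / r) ((c * s - d * t) / r) ((c * t + d * s) / r)"
  have one: "s / r * (s / r) + t / r * (t / r) = 1"
  proof -
    have "s / r * (s / r) + t / r * (t / r) = (s\<^sup>2 + t\<^sup>2) / (r * r)"
      by (simp add: add_divide_distrib power2_eq_square)
    also have "\<dots> = 1" unfolding r(2) using \<open>s\<^sup>2 + t\<^sup>2 > 0\<close> by (intro divide_self) linarith
    finally show ?thesis .
  qed
  have "orthogonal_matrix U"
    unfolding orthogonal_matrix_def U_def mat2_transpose mat2_mult mat2_mat_1 mat2_eq_iff
    using one by (simp add: algebra_simps)
  moreover have sym: "transpose P = P"
    unfolding P_def mat2_transpose mat2_eq_iff by (simp add: s_def t_def algebra_simps)
  moreover have "mat2 a b c d = P ** U"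
  proof -
    have "x = (x * s - y * t) / r * (s / r) + (x * t + y * s) / r * (t / r)"
      "y = (x * s - y * t) / r * (- t / r) + (x * t + y * s) / r * (s / r)" for x y
    proof -
      have "(x * s - y * t) / r * (s / r) + (x * t + y * s) / r * (t / r) = x * (s / r * (s / r) + t / r * (t / r))"
        "(x * s - y * t) / r * (- t / r) + (x * t + y * s) / r * (s / r) = y * (s / r * (s / r) + t / r * (t / r))"
        using r(1) by (simp_all add: field_simps)
      then show "x = (x * s - y * t) / r * (s / r) + (x * t + y * s) / r * (t / r)"
        "y = (x * s - y * t) / r * (- t / r) + (x * t + y * s) / r * (s / r)" unfolding one by simp_all
    qed
    then show ?thesis unfolding P_def U_def mat2_mult mat2_eq_iff by blast
  qed
  moreover have "\<forall>v. v \<noteq> 0 \<longrightarrow> 0 < v \<bullet> (P *v v)"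
  proof (intro allI impI)
    fix v :: "real ^ (1 + 1)" assume v: "v \<noteq> 0"
    define x y where "x = v $ Inl 1" and "y = v $ Inr 1"
    have xy: "x \<noteq> 0 \<or> y \<noteq> 0" using v by (auto simp: x_def y_def vec_eq_iff forall_11)
    define p q where "p = a * s - b * t" and "q = a * t + b * s"
    have p: "p > 0"
    proof -
      have "p = a\<^sup>2 + b\<^sup>2 + (a * d - b * c)"
        by (simp add: p_def s_def t_def power2_eq_square algebra_simps)
      then show ?thesis using det by (smt (verit) zero_le_power2)
    qed
    have dd: "p * (c * t + d * s) - q * q = s\<^sup>2 + t\<^sup>2"
    proof -
      have q': "q = c * s - d * t" by (simp add: q_def s_def t_def algebra_simps)
      have "p * (c * t + d * s) - q * (c * s - d * t) = (a * d - b * c) * (s\<^sup>2 + t\<^sup>2)"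
        unfolding p_def q_def by (simp add: power2_eq_square algebra_simps)
      then show ?thesis using q' det by simp
    qed
    have "p * (p * x\<^sup>2 + 2 * q * (x * y) + (c * t + d * s) * y\<^sup>2)
        = (p * x + q * y)\<^sup>2 + (p * (c * t + d * s) - q * q) * y\<^sup>2"
      by (simp add: power2_eq_square algebra_simps)
    also have "\<dots> > 0"
    proof (cases "y = 0")
      case True then show ?thesis using xy p by simp
    next
      case False
      then show ?thesis unfolding dd using \<open>s\<^sup>2 + t\<^sup>2 > 0\<close> by (simp add: add_nonneg_pos)
    qed
    finally have "p * x\<^sup>2 + 2 * q * (x * y) + (c * t + d * s) * y\<^sup>2 > 0"
      using p by (simp add: zero_less_mult_iff)
    then have "(p * x\<^sup>2 + 2 * q * (x * y) + (c * t + d * s) * y\<^sup>2) / r > 0" using r by simp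
    moreover have "v \<bullet> (P *v v) = (p * x\<^sup>2 + 2 * q * (x * y) + (c * t + d * s) * y\<^sup>2) / r"
    proof -
      have "c * s - d * t = q" by (simp add: q_def s_def t_def algebra_simps)
      then show ?thesis
        unfolding P_def mat2_quadratic x_def[symmetric] y_def[symmetric] p_def[symmetric] q_def[symmetric]
        by (simp add: add_divide_distrib algebra_simps)
    qed
    ultimately show "0 < v \<bullet> (P *v v)" by simp
  qed
  ultimately show "orthogonal_matrix U \<and> (\<exists>P. transpose P = P \<and> (\<forall>v. v \<noteq> 0 \<longrightarrow> 0 < v \<bullet> (P *v v)) \<and> mat2 a b c d = P ** U)"
    by blast
  fix V assume V: "orthogonal_matrix V \<and> (\<exists>P. transpose P = P \<and> (\<forall>v. v \<noteq> 0 \<longrightarrow> 0 < v \<bullet> (P *v v)) \<and> mat2 a b c d = P ** V)"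
  obtain e f g h where Veq: "V = mat2 e f g h" using mat2_exhaust by blast
  from V obtain P' where P': "transpose P' = P'" "\<And>v. v \<noteq> 0 \<Longrightarrow> 0 < v \<bullet> (P' *v v)" "mat2 a b c d = P' ** V"
    by blast
  obtain p q q' p' where Peq: "P' = mat2 p q q' p'" using mat2_exhaust by blast
  note pd = mat2_posdef_det[OF P'(1,2) Peq]
  have orth: "e * e + g * g = 1" "f * f + h * h = 1" "e * f + g * h = 0"
    using V unfolding orthogonal_matrix_def Veq mat2_transpose mat2_mult mat2_mat_1 mat2_eq_iff by auto
  have A: "a = p * e + q * g" "b = p * f + q * h" "c = q * e + p' * g" "d = q * f + p' * h"
    using P'(3) pd(1) unfolding Veq Peq mat2_mult mat2_eq_iff by auto
  have "(p * p' - q * q) * (e * h - f * g) = 1"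
    using det unfolding A by (simp add: algebra_simps)
  then have "e * h - f * g > 0" using pd by (metis zero_less_mult_pos zero_less_one)
  moreover have "(e * h - f * g)\<^sup>2 = (e * e + g * g) * (f * f + h * h) - (e * f + g * h)\<^sup>2"
    by (simp add: power2_eq_square algebra_simps)
  then have "(e * h - f * g)\<^sup>2 = 1" unfolding orth by simp
  ultimately have eh: "e * h - f * g = 1" by (simp add: power2_eq_1_iff)
  \<comment> \<open>This sum of squares measures the distance of an orthogonal matrix from being a
    rotation.\<close>
  have "(e - h)\<^sup>2 + (f + g)\<^sup>2 = (e * e + g * g) + (f * f + h * h) - 2 * (e * h - f * g)"
    by (simp add: power2_eq_square algebra_simps)
  then have "(e - h)\<^sup>2 + (f + g)\<^sup>2 = 0" unfolding orth eh by simp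
  then have hg: "h = e" "f = - g" by (simp_all add: sum_power2_eq_zero_iff)
  have sc: "s = (p + p') * e" "t = (p + p') * g" by (simp_all add: s_def t_def A hg algebra_simps)
  have "s\<^sup>2 + t\<^sup>2 = (p + p')\<^sup>2 * (e * e + g * g)" unfolding sc by (simp add: power2_eq_square algebra_simps)
  then have "r = p + p'" using pd(2) unfolding r_def orth by simp
  then show "V = mat2 (s / r) (- t / r) (t / r) (s / r)"
    unfolding Veq mat2_eq_iff hg using sc pd(2) by simp
qed

text \<open>(a + d) + \<i> (c - b) is twice the complex-linear part of the matrix, viewed as a
  real-linear map of the complex plane.\<close>

lemma rho_mat2:
  assumes "a * d - b * c = 1" shows "rho (mat2 a b c d) = sgn (Complex (a + d) (c - b))"
proof -
  have "det (A :: complex ^ 1 ^ 1) = A $ 1 $ 1" for A by (rule det_1)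
  then show ?thesis
    unfolding rho_def polar_unitary_mat2[OF assms] by (simp add: sgn_eq cmod_def complex_eq_iff)
qed

lemma det_1_minus_mat2:
  assumes "a * d - b * c = 1" shows "det (mat 1 - mat2 a b c d) = 2 - (a + d)"
  unfolding mat2_mat_1 mat2_diff mat2_det using assms by (simp add: algebra_simps)

text \<open>With angle 0 the matrix is symmetric of nonnegative trace, and (a + d)^2 = (a - d)^2 + 4
  b^2 + 4. Hence along a path of trace less than 2 the angle never meets a multiple of 2
  \<open>pi\<close>.\<close>

lemma rho_eq_1_trace:
  assumes "A \<in> Sp" "rho A = 1" shows "A $ Inl 1 $ Inl 1 + A $ Inr 1 $ Inr (1 :: 1) \<ge> 2"
proof -
  obtain a b c d where A: "A = mat2 a b c d" using mat2_exhaust by blast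
  have det: "a * d - b * c = 1" using assms(1) by (simp add: A mat2_Sp)
  have sg: "sgn (Complex (a + d) (c - b)) = 1" using assms(2) rho_mat2[OF det] by (simp add: A)
  have "Complex (a + d) (c - b) = of_real (cmod (Complex (a + d) (c - b)))"
    using sg by (metis mult_1 sgn_mult_abs mult.commute of_real_1 scaleR_conv_of_real mult.right_neutral sgn_zero zero_neq_one divide_eq_1_iff sgn_eq)
  then have "c - b = 0" "a + d \<ge> 0"
    by (metis complex.sel(2) Im_complex_of_real, metis complex.sel(1) Re_complex_of_real norm_ge_zero)
  then have "(a + d)\<^sup>2 = (a - d)\<^sup>2 + 4 * b\<^sup>2 + 4 * (a * d - b * c)" by (simp add: power2_eq_square algebra_simps)
  then have "(a + d)\<^sup>2 \<ge> 2\<^sup>2" unfolding det using zero_le_power2[of "a - d"] zero_le_power2[of b] by simp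
  then have "a + d \<ge> 2" using \<open>a + d \<ge> 0\<close> by (rule power2_le_imp_le)
  then show ?thesis by (simp add: A)
qed

lemma continuous_on_rho:
  assumes "continuous_on S \<Psi>" "\<And>t. t \<in> S \<Longrightarrow> \<Psi> t \<in> (Sp :: 1 sq_matrix set)"
  shows "continuous_on S (\<lambda>t. rho (\<Psi> t))"
proof -
  let ?h = "\<lambda>t. Complex (\<Psi> t $ Inl 1 $ Inl 1 + \<Psi> t $ Inr 1 $ Inr 1) (\<Psi> t $ Inr 1 $ Inl 1 - \<Psi> t $ Inl 1 $ Inr 1)"
  have "rho (\<Psi> t) = ?h t / of_real (cmod (?h t)) \<and> ?h t \<noteq> 0" if "t \<in> S" for t
  proof -
    obtain a b c d where A: "\<Psi> t = mat2 a b c d" using mat2_exhaust by blast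
    have det: "a * d - b * c = 1" using assms(2)[OF that] by (simp add: A mat2_Sp)
    have "(a + d)\<^sup>2 + (c - b)\<^sup>2 = (a - d)\<^sup>2 + (b + c)\<^sup>2 + 4 * (a * d - b * c)"
      by (simp add: power2_eq_square algebra_simps)
    then have "a + d \<noteq> 0 \<or> c - b \<noteq> 0" unfolding det by (smt (verit) zero_le_power2 power_zero_numeral)
    then show ?thesis unfolding A rho_mat2[OF det] by (auto simp: sgn_eq complex_eq_iff)
  qed
  moreover have hc: "continuous_on S ?h"
    unfolding Complex_eq using assms(1) by (intro continuous_intros)
  have "continuous_on S (\<lambda>t. ?h t / of_real (cmod (?h t)))"
    by (rule continuous_on_divide[OF hc continuous_on_of_real[OF continuous_on_norm[OF hc]]])
       (use calculation in auto)
  ultimately show ?thesis by (metis (no_types, lifting) continuous_on_cong)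
qed

lemma rho_1: "rho (mat 1 :: 1 sq_matrix) = 1"
  unfolding mat2_mat_1 by (subst rho_mat2) (auto simp: sgn_eq complex_eq_iff cmod_def)

lemma rho_W_plus: "rho (W_plus :: 1 sq_matrix) = - 1"
  unfolding W_plus_def mat2_mat_1 mat2_minus by (subst rho_mat2) (auto simp: sgn_eq complex_eq_iff cmod_def)

lemma W_minus_1: "W_minus k = mat2 2 0 0 (1 / 2)"
  by (auto simp: vec_eq_iff forall_11 W_minus_def num1_eq1)

section \<open>Computing the index of paths in the component of -1\<close>

lemma cis_lift_zero:
  fixes f :: "real \<Rightarrow> real"
  assumes "continuous_on {a..b} f" "\<And>t. t \<in> {a..b} \<Longrightarrow> cis (f t) = 1" "f a = 0" "t \<in> {a..b}"
  shows "f t = 0"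
proof (rule ccontr)
  assume ne: "f t \<noteq> 0"
  have c: "continuous_on {a..t} f" using assms(4) by (intro continuous_on_subset[OF assms(1)]) auto
  \<comment> \<open>A nonzero value between 0 and \<open>f t\<close> of modulus at most
    \<open>pi\<close>. The function attains it, yet it is no multiple of 2
    \<open>pi\<close>.\<close>
  define y where "y = sgn (f t) * min (\<bar>f t\<bar>) pi"
  have y: "0 < \<bar>y\<bar>" "\<bar>y\<bar> \<le> pi" using ne by (auto simp: y_def abs_mult sgn_if)
  have at: "a \<le> t" using assms(4) by simp
  have "\<exists>u. a \<le> u \<and> u \<le> t \<and> f u = y"
  proof (cases "f t > 0")
    case True
    then have "f a \<le> y" "y \<le> f t" using assms(3) by (auto simp: y_def)
    then show ?thesis using IVT'[OF _ _ at c] by blast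
  next
    case False
    then have "f t < 0" using ne by simp
    then have "y \<le> f a" "f t \<le> y" using assms(3) by (auto simp: y_def)
    then show ?thesis using IVT2'[OF _ _ at c] by blast
  qed
  then obtain u where u: "a \<le> u" "u \<le> t" "f u = y" by blast
  then have "u \<in> {a..b}" using assms(4) by auto
  then have "cis y = 1" using assms(2) u(3) by blast
  then obtain k :: int where k: "y = 2 * pi * of_int k" using cis_eq_1_int by blast
  then have "k \<noteq> 0" using y by auto
  then have "\<bar>real_of_int k\<bar> \<ge> 1" by linarith
  then have "2 * pi * 1 \<le> 2 * pi * \<bar>real_of_int k\<bar>" by (intro mult_left_mono) auto
  then show False using y k by (simp add: abs_mult)
qed

lemma lift_avoids_multiples:
  fixes f :: "real \<Rightarrow> real"
  assumes "continuous_on {a..b} f" "\<And>t. t \<in> {a..b} \<Longrightarrow> cis (f t) \<noteq> 1" "a \<le> b"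
  shows "\<lfloor>f b / (2 * pi)\<rfloor> = \<lfloor>f a / (2 * pi)\<rfloor>"
proof (rule ccontr)
  assume ne: "\<not> ?thesis"
  define g where "g t = f t / (2 * pi)" for t
  have c: "continuous_on {a..b} g" unfolding g_def by (intro continuous_intros assms(1)) auto
  have "\<exists>u\<in>{a..b}. \<exists>k :: int. g u = of_int k"
  proof (cases "\<lfloor>g a\<rfloor> < \<lfloor>g b\<rfloor>")
    case True
    then have "g a \<le> of_int \<lfloor>g b\<rfloor>" "of_int \<lfloor>g b\<rfloor> \<le> g b" by linarith+
    then show ?thesis using IVT'[OF _ _ assms(3) c] by fastforce
  next
    case False
    then have "\<lfloor>g b\<rfloor> < \<lfloor>g a\<rfloor>" using ne by (simp add: g_def)
    then have "g b \<le> of_int \<lfloor>g a\<rfloor>" "of_int \<lfloor>g a\<rfloor> \<le> g a" by linarith+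
    then show ?thesis using IVT2'[OF _ _ assms(3) c] by fastforce
  qed
  then obtain u k where u: "u \<in> {a..b}" "g u = of_int k" by blast
  then have "f u = 2 * pi * of_int k" by (simp add: g_def field_simps)
  then show False using assms(2)[OF u(1)] cis_eq_1_int by blast
qed

lemma lift_end_at_minus_1:
  assumes "cis x = - 1" "\<lfloor>x / (2 * pi)\<rfloor> = k" shows "x = (2 * of_int k + 1) * pi"
proof -
  have "cis (x - pi) = 1" using assms(1) by (simp add: cis_divide[symmetric])
  then obtain l where l: "x - pi = 2 * pi * of_int l" using cis_eq_1_int by blast
  then have "x / (2 * pi) = of_int l + 1 / 2" by (simp add: field_simps)
  then have "l = k" using assms(2) by linarith
  then show ?thesis using l by (simp add: algebra_simps)
qed

text \<open>One extension of trace less than 2 with its angle gives existence. Any other extension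
  has the same angle up to time T. Since det (1 - A) = 2 - trace, its trace stays below 2
  afterwards, so it ends at \<open>W_plus\<close>, and the integer part of its angle in full turns
  is frozen. The final angle is then an odd multiple of \<open>pi\<close> with known integer
  part.\<close>

lemma cz_index_eq:
  fixes \<Phi> \<Psi> :: "real \<Rightarrow> 1 sq_matrix" and \<phi> :: "real \<Rightarrow> real"
  assumes T: "0 < T" and \<Phi>0: "\<Phi> 0 = mat 1"
    and \<Psi>: "continuous_on {0..T + 1} \<Psi>" "\<And>t. t \<in> {0..T} \<Longrightarrow> \<Psi> t = \<Phi> t" "\<And>t. t \<in> {0..T + 1} \<Longrightarrow> \<Psi> t \<in> Sp"
      "\<And>t. t \<in> {T..T + 1} \<Longrightarrow> \<Psi> t $ Inl 1 $ Inl 1 + \<Psi> t $ Inr 1 $ Inr 1 < 2" "\<Psi> (T + 1) = W_plus"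
    and \<phi>: "continuous_on {0..T + 1} \<phi>" "\<And>t. t \<in> {0..T + 1} \<Longrightarrow> rho (\<Psi> t) = cis (\<phi> t)" "\<phi> 0 = 0"
      "\<phi> (T + 1) = (2 * of_int k + 1) * pi"
  shows "cz_index T \<Phi> = 2 * k + 1"
  unfolding cz_index_def
proof (rule the_equality)
  have det: "det (mat 1 - A) = 2 - (A $ Inl 1 $ Inl 1 + A $ Inr 1 $ Inr 1)" if "A \<in> Sp" for A :: "1 sq_matrix"
  proof -
    obtain a b c d where A: "A = mat2 a b c d" using mat2_exhaust by blast
    then show ?thesis using that det_1_minus_mat2[of a d b c] by (simp add: mat2_Sp)
  qed
  have pw: "(cis x)\<^sup>2 = cis (2 * x)" for x by (simp add: Complex.DeMoivre)
  show "\<exists>\<Psi> \<theta>. continuous_on {0..T + 1} \<Psi> \<and> (\<forall>t \<in> {0..T}. \<Psi> t = \<Phi> t) \<and> (\<forall>t \<in> {0..T + 1}. \<Psi> t \<in> Sp) \<and>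
      (\<forall>t \<in> {T..T + 1}. det (mat 1 - \<Psi> t) \<noteq> 0) \<and> \<Psi> (T + 1) \<in> insert W_plus (range W_minus) \<and>
      continuous_on {0..T + 1} \<theta> \<and> (\<forall>t \<in> {0..T + 1}. (rho (\<Psi> t))\<^sup>2 = cis (2 * pi * \<theta> t)) \<and>
      \<theta> (T + 1) - \<theta> 0 = of_int (2 * k + 1)"
  \<comment> \<open>The angle of the square of \<open>rho\<close> is 2 \<open>\<phi> t\<close>; in
    full turns it is \<open>\<phi> t / pi\<close>.\<close>
  proof (intro exI[of _ \<Psi>] exI[of _ "\<lambda>t. \<phi> t / pi"] conjI ballI)
    show "det (mat 1 - \<Psi> t) \<noteq> 0" if t: "t \<in> {T..T + 1}" for t
    proof -
      have "\<Psi> t \<in> Sp" using t T by (intro \<Psi>(3)) auto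
      from det[OF this] \<Psi>(4)[OF t] show ?thesis by simp
    qed
    show "(rho (\<Psi> t))\<^sup>2 = cis (2 * pi * (\<phi> t / pi))" if "t \<in> {0..T + 1}" for t
      unfolding \<phi>(2)[OF that] pw by simp
    show "continuous_on {0..T + 1} (\<lambda>t. \<phi> t / pi)" by (intro continuous_intros \<phi>(1)) auto
  qed (use \<Psi> \<phi> in auto)
  fix l
  assume "\<exists>\<Psi> \<theta>. continuous_on {0..T + 1} \<Psi> \<and> (\<forall>t \<in> {0..T}. \<Psi> t = \<Phi> t) \<and> (\<forall>t \<in> {0..T + 1}. \<Psi> t \<in> Sp) \<and>
      (\<forall>t \<in> {T..T + 1}. det (mat 1 - \<Psi> t) \<noteq> 0) \<and> \<Psi> (T + 1) \<in> insert W_plus (range W_minus) \<and>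
      continuous_on {0..T + 1} \<theta> \<and> (\<forall>t \<in> {0..T + 1}. (rho (\<Psi> t))\<^sup>2 = cis (2 * pi * \<theta> t)) \<and>
      \<theta> (T + 1) - \<theta> 0 = of_int l"
  then obtain X \<theta> where X: "continuous_on {0..T + 1} X" "\<And>t. t \<in> {0..T} \<Longrightarrow> X t = \<Phi> t"
      "\<And>t. t \<in> {0..T + 1} \<Longrightarrow> X t \<in> Sp" "\<And>t. t \<in> {T..T + 1} \<Longrightarrow> det (mat 1 - X t) \<noteq> 0"
      "X (T + 1) \<in> insert W_plus (range W_minus)"
    and \<theta>: "continuous_on {0..T + 1} \<theta>" "\<And>t. t \<in> {0..T + 1} \<Longrightarrow> (rho (X t))\<^sup>2 = cis (2 * pi * \<theta> t)"
      "\<theta> (T + 1) - \<theta> 0 = of_int l"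
    by blast
  define \<eta> where "\<eta> t = pi * (\<theta> t - \<theta> 0)" for t
  have \<eta>0: "\<eta> 0 = 0" by (simp add: \<eta>_def)
  have \<eta>c: "continuous_on {0..T + 1} \<eta>" unfolding \<eta>_def by (intro continuous_intros \<theta>(1))
  have X0: "X 0 = mat 1" using X(2)[of 0] T \<Phi>0 by simp
  then have "cis (2 * pi * \<theta> 0) = 1" using \<theta>(2)[of 0] T rho_1 by simp
  then have sq: "(rho (X t))\<^sup>2 = cis (2 * \<eta> t)" if "t \<in> {0..T + 1}" for t
  proof -
    have "2 * \<eta> t = 2 * pi * \<theta> t - 2 * pi * \<theta> 0" by (simp add: \<eta>_def algebra_simps)
    then have "cis (2 * \<eta> t) = cis (2 * pi * \<theta> t) / cis (2 * pi * \<theta> 0)" by (simp only: cis_divide)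
    then show ?thesis using \<theta>(2)[OF that] \<open>cis (2 * pi * \<theta> 0) = 1\<close> by simp
  qed
  \<comment> \<open>\<open>\<eta>\<close> is half the angle of the square of \<open>rho\<close>, so
    it is an angle of \<open>rho\<close> up to sign; by continuity the sign is that at time
    0.\<close>
  define q where "q t = rho (X t) * cis (- \<eta> t)" for t
  have "q t \<in> {1, - 1}" if "t \<in> {0..T + 1}" for t
  proof -
    have "(q t)\<^sup>2 = cis (2 * \<eta> t) * cis (2 * (- \<eta> t))"
      unfolding q_def power_mult_distrib sq[OF that] pw by simp
    also have "\<dots> = 1" by (simp add: cis_mult)
    finally show ?thesis by (auto simp: power2_eq_1_iff)
  qed
  then have "finite (q ` {0..T + 1})" by (meson finite.emptyI finite.insertI finite_subset image_subsetI)
  moreover have "continuous_on {0..T + 1} q"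
    unfolding q_def using continuous_on_rho[OF X(1,3)] \<eta>c by (intro continuous_intros) auto
  ultimately have "q constant_on {0..T + 1}"
    by (intro continuous_finite_range_constant) auto
  moreover have "q 0 = 1" unfolding q_def X0 \<eta>0 rho_1 by simp
  ultimately have q1: "q t = 1" if "t \<in> {0..T + 1}" for t
    using that T unfolding constant_on_def by (metis add_nonneg_nonneg atLeastAtMost_iff less_eq_real_def zero_less_one)
  have rX: "rho (X t) = cis (\<eta> t)" if "t \<in> {0..T + 1}" for t
  proof -
    have "rho (X t) = q t * cis (\<eta> t)" by (simp add: q_def mult.assoc cis_mult)
    then show ?thesis using q1[OF that] by simp
  qed
  have "\<eta> T - \<phi> T = 0"
  proof (rule cis_lift_zero[of 0 T "\<lambda>t. \<eta> t - \<phi> t"])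
    show "continuous_on {0..T} (\<lambda>t. \<eta> t - \<phi> t)"
      by (intro continuous_intros continuous_on_subset[OF \<eta>c] continuous_on_subset[OF \<phi>(1)]) auto
    show "cis (\<eta> t - \<phi> t) = 1" if t: "t \<in> {0..T}" for t
    proof -
      have "cis (\<eta> t) = cis (\<phi> t)" using rX[of t] \<phi>(2)[of t] X(2)[OF t] \<Psi>(2)[OF t] t by simp
      then show ?thesis by (simp add: cis_divide[symmetric])
    qed
  qed (use \<eta>0 \<phi>(3) T in auto)
  then have eqT: "\<eta> T = \<phi> T" by simp
  have sub: "{T..T + 1} \<subseteq> {0..T + 1}" using T by auto
  have tr: "X t $ Inl 1 $ Inl 1 + X t $ Inr 1 $ Inr 1 < 2" if t: "t \<in> {T..T + 1}" for t
  proof (rule ccontr)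
    assume *: "\<not> ?thesis"
    let ?f = "\<lambda>t. X t $ Inl 1 $ Inl 1 + X t $ Inr 1 $ Inr 1"
    have "continuous_on {T..t} ?f"
      using continuous_on_subset[OF X(1), of "{T..t}"] T t by (intro continuous_intros) auto
    moreover have "?f T \<le> 2" using \<Psi>(4)[of T] X(2)[of T] \<Psi>(2)[of T] T by simp
    moreover have "2 \<le> ?f t" using * by simp
    ultimately obtain u where u: "T \<le> u" "u \<le> t" "?f u = 2" using IVT'[of ?f T 2 t] t by auto
    then have "u \<in> {T..T + 1}" using t by auto
    moreover from this have "u \<in> {0..T + 1}" using sub by blast
    ultimately show False using X(4)[of u] det[OF X(3)[of u]] u(3) by simp
  qed
  have ne1: "cis (\<eta> t) \<noteq> 1" if t: "t \<in> {T..T + 1}" for t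
    using rho_eq_1_trace[OF X(3)[of t]] rX[of t] tr[OF t] sub t by force
  have ne2: "cis (\<phi> t) \<noteq> 1" if t: "t \<in> {T..T + 1}" for t
    using rho_eq_1_trace[OF \<Psi>(3)[of t]] \<phi>(2)[of t] \<Psi>(4)[OF t] sub t by force
  have "X (T + 1) = W_plus"
    \<comment> \<open>\<open>W_minus\<close> has trace 5/2, which exceeds 2.\<close>
    using X(5) tr[of "T + 1"] by (auto simp: W_minus_1)
  then have "cis (\<eta> (T + 1)) = - 1" using rX[of "T + 1"] rho_W_plus T by simp
  moreover have "\<lfloor>\<eta> (T + 1) / (2 * pi)\<rfloor> = \<lfloor>\<phi> (T + 1) / (2 * pi)\<rfloor>"
    using lift_avoids_multiples[OF continuous_on_subset[OF \<eta>c sub] ne1]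
      lift_avoids_multiples[OF continuous_on_subset[OF \<phi>(1) sub] ne2] eqT by simp
  moreover have "\<lfloor>\<phi> (T + 1) / (2 * pi)\<rfloor> = k"
  proof -
    have "\<phi> (T + 1) / (2 * pi) = of_int k + 1 / 2" unfolding \<phi>(4) by (simp add: field_simps)
    then show ?thesis by linarith
  qed
  ultimately have "\<eta> (T + 1) = (2 * of_int k + 1) * pi" by (intro lift_end_at_minus_1) auto
  moreover have "\<eta> (T + 1) = pi * of_int l" unfolding \<eta>_def \<theta>(3) by simp
  ultimately have "pi * of_int l = pi * of_int (2 * k + 1)" by (simp add: mult.commute)
  then have "real_of_int l = of_int (2 * k + 1)" by (simp only: mult_left_cancel[OF pi_neq_zero])
  then show "l = 2 * k + 1" by (simp only: of_int_eq_iff)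
qed

text \<open>\<open>B\<inverse> w B\<^sub>0\<close>, where \<open>w\<close> acts on the plane by complex multiplication and the matrices \<open>B\<close>, \<open>B\<^sub>0\<close> of determinant 1
  have the columns \<open>E, F\<close> and \<open>E\<^sub>0, F\<^sub>0\<close>.\<close>

definition conj_rot :: "complex \<Rightarrow> complex \<Rightarrow> complex \<Rightarrow> complex \<Rightarrow> complex \<Rightarrow> 1 sq_matrix" where
  "conj_rot E F E0 F0 w = mat2 (Im (cnj (w * E0) * F)) (Im (cnj (w * F0) * F)) (Im (cnj E * (w * E0))) (Im (cnj E * (w * F0)))"

lemma conj_rot_det:
  assumes "Im (cnj E * F) = 1" "Im (cnj E0 * F0) = 1" "cmod w = 1"
  shows "Im (cnj (w * E0) * F) * Im (cnj E * (w * F0)) - Im (cnj (w * F0) * F) * Im (cnj E * (w * E0)) = 1"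
proof -
  \<comment> \<open>The Pluecker relation for four vectors of the plane.\<close>
  have pl: "Im (cnj u * F) * Im (cnj E * v) - Im (cnj v * F) * Im (cnj E * u) = Im (cnj u * v) * Im (cnj E * F)"
    for u v by (simp add: algebra_simps)
  have eq: "cnj (w * E0) * (w * F0) = of_real ((cmod w)\<^sup>2) * (cnj E0 * F0)"
    unfolding complex_norm_square by simp
  have "Im (cnj (w * E0) * (w * F0)) = 1" unfolding eq using assms by simp
  then show ?thesis unfolding pl using assms by simp
qed

text \<open>The map with 1, \<i> sent to E, F has complex-linear part (E - \<i> F)/2 and antilinear
  part (E + \<i> F)/2; for determinant 1 the inverse has the conjugate of the former and minus the
  latter. Multiplying out gives four times the complex-linear part of the conjugated
  rotation.\<close>

lemma conj_rot_trace:
  "2 * Complex (Im (cnj (w * E0) * F) + Im (cnj E * (w * F0))) (Im (cnj E * (w * E0)) - Im (cnj (w * F0) * F))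
   = cnj (E - \<i> * F) * w * (E0 - \<i> * F0) - (E + \<i> * F) * cnj w * cnj (E0 + \<i> * F0)"
  by (simp add: complex_eq_iff) (simp add: algebra_simps)

lemma sgn_exp_complex: "sgn (exp z) = cis (Im z)"
  by (simp add: sgn_eq exp_eq_polar norm_mult)

text \<open>By \<open>conj_rot_trace\<close> the phase \<open>rho\<close> is that of
  \<open>cnj (m t) * cis (y t) * m 0\<close> times a factor \<open>\<beta>\<close> in the right
  half-plane. The first factor has the angle of the rotation corrected by \<open>g\<close>, and
  \<beta> adds less than a quarter turn. At the end \<open>g\<close> has returned to its initial
  value and \<beta> is real again, so the final angle is that of the rotation.\<close>

lemma cz_index_rotation:
  fixes E F :: "real \<Rightarrow> complex" and g :: "real \<Rightarrow> complex"
  assumes T: "0 < T" and cont: "continuous_on {0..T} E" "continuous_on {0..T} F"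
    and symp: "\<And>t. t \<in> {0..T} \<Longrightarrow> Im (cnj (E t) * F t) = 1" and per: "E T = E 0" "F T = F 0"
    and g: "continuous_on {0..T} g" "\<And>t. t \<in> {0..T} \<Longrightarrow> E t - \<i> * F t = exp (g t)" "g T = g 0"
    and \<Phi>: "\<And>t. t \<in> {0..T} \<Longrightarrow> \<Phi> t = conj_rot (E t) (F t) (E 0) (F 0) (cis (\<omega> * t))"
    and k: "2 * pi * of_int k < \<omega> * T" "\<omega> * T < 2 * pi * (of_int k + 1)"
  shows "cz_index T \<Phi> = 2 * k + 1"
proof -
  \<comment> \<open>\<open>\<tau>\<close> freezes the frame after time T, while \<open>y\<close>
    moves the rotation angle linearly from \<open>\<omega> * T\<close> to the odd multiple of
    \<open>pi\<close> in the same open interval between multiples of 2 \<open>pi\<close>.\<close>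
  define \<tau> where "\<tau> t = min t T" for t
  define y where "y t = \<omega> * \<tau> t + (t - \<tau> t) * ((2 * of_int k + 1) * pi - \<omega> * T)" for t
  define \<Psi> where "\<Psi> t = conj_rot (E (\<tau> t)) (F (\<tau> t)) (E 0) (F 0) (cis (y t))" for t
  define m N where "m t = E (\<tau> t) - \<i> * F (\<tau> t)" and "N t = E (\<tau> t) + \<i> * F (\<tau> t)" for t
  define \<beta> where "\<beta> t = 1 - N t * cnj (N 0) / (cnj (m t) * m 0) * cis (- 2 * y t)" for t
  define \<phi> where "\<phi> t = Im (g 0) - Im (g (\<tau> t)) + y t + Im (Ln (\<beta> t))" for t
  have \<tau>: "\<tau> t \<in> {0..T}" if "t \<in> {0..T + 1}" for t using that T by (auto simp: \<tau>_def)
  have \<tau>T: "\<tau> t = T" if "t \<in> {T..T + 1}" for t using that by (auto simp: \<tau>_def)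
  have \<tau>id: "\<tau> t = t" if "t \<in> {0..T}" for t using that by (auto simp: \<tau>_def)
  have \<tau>c: "continuous_on {0..T + 1} \<tau>" unfolding \<tau>_def by (intro continuous_intros)
  have yc: "continuous_on {0..T + 1} y" unfolding y_def by (intro continuous_intros \<tau>c)
  have E\<tau>: "continuous_on {0..T + 1} (\<lambda>t. f (\<tau> t))" if "continuous_on {0..T} f" for f :: "real \<Rightarrow> complex"
    by (rule continuous_on_compose2[OF that \<tau>c]) (use \<tau> in auto)
  have symp\<tau>: "Im (cnj (E (\<tau> t)) * F (\<tau> t)) = 1" if "t \<in> {0..T + 1}" for t using symp \<tau>[OF that] by blast
  have E0: "Im (cnj (E 0) * F 0) = 1" using symp[of 0] T by simp
  have mN: "(cmod (m t))\<^sup>2 = (cmod (N t))\<^sup>2 + 4" "m t \<noteq> 0" "cmod (N t) < cmod (m t)" if "t \<in> {0..T + 1}" for t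
  proof -
    \<comment> \<open>The squared moduli of linear and antilinear part differ by a multiple of the
      determinant, which is 1. So the linear part dominates and \<open>\<beta>\<close> keeps
      positive real part.\<close>
    have "(cmod (e - \<i> * f))\<^sup>2 = (cmod (e + \<i> * f))\<^sup>2 + 4 * Im (cnj e * f)" for e f
      by (simp add: cmod_power2) (simp add: power2_eq_square algebra_simps)
    then show 1: "(cmod (m t))\<^sup>2 = (cmod (N t))\<^sup>2 + 4" using symp\<tau>[OF that] by (simp add: m_def N_def)
    show "m t \<noteq> 0"
    proof
      assume "m t = 0"
      then show False using 1 zero_le_power2[of "cmod (N t)"] by simp
    qed
    have "(cmod (N t))\<^sup>2 < (cmod (m t))\<^sup>2" using 1 by linarith
    then show "cmod (N t) < cmod (m t)" by (rule power_less_imp_less_base) simp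
  qed
  have zero: "0 \<in> {0..T + 1}" using T by simp
  have \<beta>: "Re (\<beta> t) > 0" if "t \<in> {0..T + 1}" for t
  proof -
    have "cmod (N t) * cmod (N 0) < cmod (m t) * cmod (m 0)"
      using mN[OF that] mN[OF zero] by (intro mult_strict_mono') auto
    then have "cmod (N t * cnj (N 0) / (cnj (m t) * m 0) * cis (- 2 * y t)) < 1"
      using mN[OF that] mN[OF zero] by (simp add: norm_mult norm_divide)
    then show ?thesis
      using complex_Re_le_cmod[of "N t * cnj (N 0) / (cnj (m t) * m 0) * cis (- 2 * y t)"] by (simp add: \<beta>_def)
  qed
  have \<beta>n: "\<beta> t \<notin> \<real>\<^sub>\<le>\<^sub>0" if "t \<in> {0..T + 1}" for t
    using \<beta>[OF that] by (auto simp: complex_nonpos_Reals_iff)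
  have mc: "continuous_on {0..T + 1} m" "continuous_on {0..T + 1} N"
    unfolding m_def N_def by (intro continuous_intros E\<tau> cont)+
  have \<beta>c: "continuous_on {0..T + 1} \<beta>"
    unfolding \<beta>_def using mN(2) zero by (intro continuous_intros mc yc) auto
  have \<phi>c: "continuous_on {0..T + 1} \<phi>"
    unfolding \<phi>_def by (intro continuous_intros E\<tau>[OF g(1)] yc continuous_on_Ln \<beta>c \<beta>n)
  have \<Psi>c: "continuous_on {0..T + 1} \<Psi>"
    unfolding \<Psi>_def conj_rot_def
    by (intro continuous_on_mat2 continuous_intros E\<tau> cont yc)
  have det: "Im (cnj (cis x * E 0) * F (\<tau> t)) * Im (cnj (E (\<tau> t)) * (cis x * F 0))
      - Im (cnj (cis x * F 0) * F (\<tau> t)) * Im (cnj (E (\<tau> t)) * (cis x * E 0)) = 1" if "t \<in> {0..T + 1}" for t x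
    by (rule conj_rot_det[OF symp\<tau>[OF that] E0]) simp
  have \<tau>0: "\<tau> 0 = 0" using T by (simp add: \<tau>_def)
  have rho: "rho (\<Psi> t) = cis (\<phi> t)" if t: "t \<in> {0..T + 1}" for t
  proof -
    let ?w = "cis (y t)"
    let ?c = "Complex (Im (cnj (?w * E 0) * F (\<tau> t)) + Im (cnj (E (\<tau> t)) * (?w * F 0)))
      (Im (cnj (E (\<tau> t)) * (?w * E 0)) - Im (cnj (?w * F 0) * F (\<tau> t)))"
    have "cis (- 2 * y t) * ?w = cnj ?w" by (simp add: cis_mult cis_cnj)
    then have "cnj (m t) * ?w * m 0 * \<beta> t = cnj (m t) * ?w * m 0 - N t * cnj ?w * cnj (N 0)"
      using mN(2)[OF t] mN(2)[OF zero] unfolding \<beta>_def by (simp add: algebra_simps)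
    also have "\<dots> = 2 * ?c" unfolding conj_rot_trace m_def N_def \<tau>0 ..
    finally have "2 * ?c = cnj (m t) * ?w * m 0 * \<beta> t" ..
    also have "\<dots> = exp (cnj (g (\<tau> t)) + \<i> * y t + g 0 + Ln (\<beta> t))"
    proof -
      have "\<beta> t \<noteq> 0" using \<beta>[OF t] by auto
      moreover have "m t = exp (g (\<tau> t))" "m 0 = exp (g 0)"
        using g(2)[OF \<tau>[OF t]] g(2)[of 0] T by (auto simp: m_def \<tau>0)
      ultimately show ?thesis by (simp add: exp_add exp_cnj cis_conv_exp)
    qed
    finally have "sgn (2 * ?c) = cis (Im (cnj (g (\<tau> t)) + \<i> * y t + g 0 + Ln (\<beta> t)))"
      by (simp only: sgn_exp_complex)
    moreover have "Im (cnj (g (\<tau> t)) + \<i> * y t + g 0 + Ln (\<beta> t)) = \<phi> t" by (simp add: \<phi>_def)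
    ultimately have "sgn (2 * ?c) = cis (\<phi> t)" by (simp only:)
    moreover have "sgn (2 * x) = sgn x" for x :: complex by (simp add: sgn_mult sgn_eq[of 2])
    ultimately have "sgn ?c = cis (\<phi> t)" by (simp only:)
    then show ?thesis unfolding \<Psi>_def conj_rot_def rho_mat2[OF det[OF t]] .
  qed
  have conj1: "conj_rot e f e f 1 = mat 1" "conj_rot e f e f (- 1) = W_plus" if "Im (cnj e * f) = 1" for e f
  proof -
    have "Im (cnj f * e) = - 1" using that by (simp add: algebra_simps)
    then show "conj_rot e f e f 1 = mat 1" "conj_rot e f e f (- 1) = W_plus"
      using that by (simp_all add: conj_rot_def mat2_mat_1 W_plus_def mat2_minus mat2_eq_iff mult.commute[of e])
  qed
  have y0: "y 0 = 0" by (simp add: y_def \<tau>0)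
  have yT: "y (T + 1) = (2 * of_int k + 1) * pi" using T by (simp add: y_def \<tau>_def)
  show ?thesis
  proof (rule cz_index_eq[OF T _ \<Psi>c _ _ _ _ \<phi>c rho])
    show "\<Phi> 0 = mat 1" using \<Phi>[of 0] T conj1(1)[OF E0] by simp
    show "\<Psi> t = \<Phi> t" if "t \<in> {0..T}" for t using that by (simp add: \<Psi>_def \<Phi> \<tau>id y_def)
    show "\<Psi> t \<in> Sp" if "t \<in> {0..T + 1}" for t
      unfolding \<Psi>_def conj_rot_def mat2_Sp by (rule det[OF that])
    have "cis (y (T + 1)) = - 1"
    proof -
      have "cis (y (T + 1)) = cis (2 * pi * of_int k) * cis pi" unfolding yT cis_mult by (simp add: algebra_simps)
      moreover have "cis (2 * pi * of_int k) = 1" using cis_eq_1_int by blast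
      ultimately show ?thesis by simp
    qed
    then show "\<Psi> (T + 1) = W_plus"
      using conj1(2)[OF E0] per \<tau>T[of "T + 1"] T by (simp add: \<Psi>_def)
    show "\<Psi> t $ Inl 1 $ Inl 1 + \<Psi> t $ Inr 1 $ Inr 1 < 2" if t: "t \<in> {T..T + 1}" for t
    proof -
      have "Im (cnj (cis x * e) * f) + Im (cnj e * (cis x * f)) = 2 * cos x * Im (cnj e * f)" for e f x
        by (simp add: algebra_simps)
      then have tr: "\<Psi> t $ Inl 1 $ Inl 1 + \<Psi> t $ Inr 1 $ Inr 1 = 2 * cos (y t)"
        using \<tau>T[OF t] per E0 by (simp add: \<Psi>_def conj_rot_def)
      define z where "z = y t - 2 * pi * of_int k"
      define u where "u = t - T"
      have u: "0 \<le> u" "u \<le> 1" using t by (auto simp: u_def)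
      \<comment> \<open>A convex combination of two angles strictly between 0 and 2
        \<open>pi\<close>, so the cosine stays below 1 and the trace below 2.\<close>
      have z: "z = (1 - u) * (\<omega> * T - 2 * pi * of_int k) + u * pi"
        by (simp add: z_def y_def \<tau>T[OF t] u_def algebra_simps)
      have "z > 0 \<and> z < 2 * pi"
      proof (cases "u = 1")
        case False
        then have "(1 - u) * (\<omega> * T - 2 * pi * of_int k) > 0"
          "(1 - u) * (\<omega> * T - 2 * pi * of_int k) < (1 - u) * (2 * pi)"
        proof -
          have "0 < \<omega> * T - 2 * pi * of_int k" "\<omega> * T - 2 * pi * of_int k < 2 * pi" "0 < 1 - u"
            using k u False by (auto simp: algebra_simps)
          then show "(1 - u) * (\<omega> * T - 2 * pi * of_int k) > 0"
            "(1 - u) * (\<omega> * T - 2 * pi * of_int k) < (1 - u) * (2 * pi)"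
            by (auto intro: mult_pos_pos mult_strict_left_mono)
        qed
        moreover have "0 \<le> u * pi" "u * pi \<le> u * (2 * pi)" using u by auto
        moreover have "(1 - u) * (2 * pi) = 2 * pi - u * (2 * pi)" by (simp add: algebra_simps)
        ultimately show ?thesis unfolding z by linarith
      qed (simp add: z)
      then have "cos z \<noteq> 1"
        using cos_one_2pi_int[of z] by (auto simp: zero_less_mult_iff mult_less_cancel_right)
      then have "cos z < 1" using cos_le_one[of z] by linarith
      moreover have "cos (y t) = cos z"
        unfolding z_def by (simp add: cos_diff cos_int_2pin sin_int_2pin)
      ultimately show ?thesis unfolding tr by simp
    qed
    have \<beta>0: "\<beta> 0 = of_real (1 - (cmod (N 0))\<^sup>2 / (cmod (m 0))\<^sup>2)"
      unfolding \<beta>_def y0 of_real_diff of_real_divide complex_norm_square by (simp add: mult.commute)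
    have pos: "1 - (cmod (N 0))\<^sup>2 / (cmod (m 0))\<^sup>2 > 0"
      using \<beta>[OF zero] unfolding \<beta>0 by simp
    have L: "Im (Ln (\<beta> 0)) = 0" unfolding \<beta>0 using Ln_of_real[OF pos] by simp
    then show "\<phi> 0 = 0" by (simp add: \<phi>_def \<tau>0 y0)
    have "\<beta> (T + 1) = \<beta> 0"
    proof -
      have "cis (- 2 * y (T + 1)) = 1"
        unfolding cis_eq_1_int yT by (intro exI[of _ "- (2 * k + 1)"]) (simp add: algebra_simps)
      then show ?thesis
        using per \<tau>T[of "T + 1"] by (simp add: \<beta>_def m_def N_def \<tau>0 y0)
    qed
    then show "\<phi> (T + 1) = (2 * of_int k + 1) * pi"
      using L g(3) \<tau>T[of "T + 1"] by (simp add: \<phi>_def yT)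
  qed
qed

section \<open>Loops of symplectic frames\<close>

text \<open>On the contractible square of the homotopy \<open>D\<close> has a continuous logarithm
  \<open>G\<close>. Its increment around the loop is an integer multiple of 2 \<open>pi\<close>
  \<i>, constant in the homotopy parameter, and 0 at the constant end.\<close>

lemma nullhomotopic_loop_log:
  fixes D :: "'a::real_normed_vector \<Rightarrow> complex"
  assumes "homotopic_loops S p (\<lambda>x. c)" "continuous_on S D" "\<And>x. x \<in> S \<Longrightarrow> D x \<noteq> 0"
  obtains g where "continuous_on {0..1} g" "\<And>x. x \<in> {0..1} \<Longrightarrow> D (p x) = exp (g x)" "g 1 = g (0 :: real)"
proof -
  let ?Q = "{0..1::real} \<times> {0..1::real}"
  obtain h where h: "continuous_on ?Q h" "h \<in> ?Q \<rightarrow> S" "\<And>x. x \<in> {0..1} \<Longrightarrow> h (0, x) = p x"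
    "\<And>x. x \<in> {0..1} \<Longrightarrow> h (1, x) = c" "\<And>t. t \<in> {0..1} \<Longrightarrow> h (t, 1) = h (t, 0)"
    using assms(1) unfolding homotopic_loops pathfinish_def pathstart_def by auto
  have "continuous_on ?Q (\<lambda>z. D (h z))"
    by (rule continuous_on_compose2[OF assms(2) h(1)]) (use h(2) in auto)
  moreover have "contractible ?Q" by (intro convex_imp_contractible convex_Times convex_real_interval)
  moreover have "D (h z) \<noteq> 0" if "z \<in> ?Q" for z using assms(3) h(2) that by blast
  ultimately obtain G where G: "continuous_on ?Q G" "\<And>z. z \<in> ?Q \<Longrightarrow> D (h z) = exp (G z)"
    using continuous_logarithm_on_contractible[of ?Q "\<lambda>z. D (h z)"] by blast
  have zero: "f x = 0" if f: "continuous_on {0..1} f" "\<And>x. x \<in> {0..1} \<Longrightarrow> exp (f x) = 1" "f 0 = 0" and x: "x \<in> {0..1}"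
    for f :: "real \<Rightarrow> complex" and x
  proof -
    have Re: "Re (f x) = 0" if "x \<in> {0..1}" for x
    proof -
      have "exp (Re (f x)) = 1" using norm_exp_eq_Re[of "f x"] f(2)[OF that] by simp
      then show ?thesis by simp
    qed
    have "continuous_on {0..1} (\<lambda>x. Im (f x))" by (intro continuous_intros f(1))
    moreover have "cis (Im (f x)) = 1" if "x \<in> {0..1}" for x
      using f(2)[OF that] Re[OF that] by (simp add: exp_eq_polar)
    ultimately have "Im (f x) = 0"
      by (rule cis_lift_zero) (use f(3) x in simp_all)
    then show ?thesis using Re[OF x] by (simp add: complex_eq_iff)
  qed
  have c: "continuous_on {0..1} (\<lambda>x. G (u x, v x))"
    if "continuous_on {0..1} u" "continuous_on {0..1} v" "\<And>x. x \<in> {0..1} \<Longrightarrow> u x \<in> {0..1} \<and> v x \<in> {0..1}"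
    for u v :: "real \<Rightarrow> real"
  proof (rule continuous_on_compose2[OF G(1)])
    show "continuous_on {0..1} (\<lambda>x. (u x, v x))" by (intro continuous_on_Pair that(1,2))
    show "(\<lambda>x. (u x, v x)) ` {0..1} \<subseteq> ?Q" using that(3) by blast
  qed
  have const: "G (1, x) - G (1, 0) = 0" if "x \<in> {0..1}" for x
  proof (rule zero[OF _ _ _ that])
    show "continuous_on {0..1} (\<lambda>x. G (1, x) - G (1, 0))"
      by (rule continuous_on_diff[OF c[of "\<lambda>_. 1" "\<lambda>x. x"] continuous_on_const])
        (simp_all add: continuous_on_id)
    show "exp (G (1, x) - G (1, 0)) = 1" if "x \<in> {0..1}" for x
      using G(2)[of "(1, x)"] G(2)[of "(1, 0)"] h(4)[OF that] h(4)[of 0] that by (simp add: exp_diff)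
  qed simp
  from const[of 1] have start: "G (1 - 0, 1) - G (1 - 0, 0) = 0" by simp
  have "G (1 - 1, 1) - G (1 - 1, 0) = 0"
  \<comment> \<open>The homotopy is run backwards so that the comparison starts at the end where the
    increment is known to be 0.\<close>
  proof (rule zero[of "\<lambda>x. G (1 - x, 1) - G (1 - x, 0)"])
    show "continuous_on {0..1} (\<lambda>x. G (1 - x, 1) - G (1 - x, 0))"
      by (rule continuous_on_diff[OF c[of "\<lambda>x. 1 - x" "\<lambda>_. 1"] c[of "\<lambda>x. 1 - x" "\<lambda>_. 0"]])
        (simp_all add: continuous_on_op_minus)
    show "exp (G (1 - x, 1) - G (1 - x, 0)) = 1" if "x \<in> {0..1}" for x
      using G(2)[of "(1 - x, 1)"] G(2)[of "(1 - x, 0)"] h(5)[of "1 - x"] that by (simp add: exp_diff)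
  qed (use start in auto)
  then have "G (0, 1) = G (0, 0)" by simp
  moreover have "D (p x) = exp (G (0, x))" if "x \<in> {0..1}" for x
    using G(2)[of "(0, x)"] h(3)[OF that] that by simp
  moreover have "continuous_on {0..1} (\<lambda>x. G (0, x))"
    by (rule c[of "\<lambda>_. 0" "\<lambda>x. x"]) (simp_all add: continuous_on_id)
  ultimately show ?thesis using that[of "\<lambda>x. G (0, x)"] by blast
qed

lemma forall_33: "(\<forall>i :: 3 + 3. P i) \<longleftrightarrow>
    P (Inl 0) \<and> P (Inl 1) \<and> P (Inl 2) \<and> P (Inr 0) \<and> P (Inr 1) \<and> P (Inr 2)"
  by (auto simp: split_sum_all forall_UNIV_3)

lemma pairs_frame_nth:
  "pairs_frame p q r $ Inl 0 = fst p" "pairs_frame p q r $ Inl 1 = fst q" "pairs_frame p q r $ Inl 2 = fst r"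
  "pairs_frame p q r $ Inr 0 = snd p" "pairs_frame p q r $ Inr 1 = snd q" "pairs_frame p q r $ Inr 2 = snd r"
  by (simp_all add: pairs_frame_def)

lemma symplectic_pairs_frame:
  assumes "\<And>u v. \<omega> u v = - \<omega> v u"
    and "\<omega> (fst p) (snd p) = 1" "\<omega> (fst q) (snd q) = 1" "\<omega> (fst r) (snd r) = 1"
    and "\<omega> (fst p) (fst q) = 0" "\<omega> (fst p) (snd q) = 0" "\<omega> (snd p) (fst q) = 0" "\<omega> (snd p) (snd q) = 0"
    and "\<omega> (fst p) (fst r) = 0" "\<omega> (fst p) (snd r) = 0" "\<omega> (snd p) (fst r) = 0" "\<omega> (snd p) (snd r) = 0"
    and "\<omega> (fst q) (fst r) = 0" "\<omega> (fst q) (snd r) = 0" "\<omega> (snd q) (fst r) = 0" "\<omega> (snd q) (snd r) = 0"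
  shows "symplectic_frame \<omega> (pairs_frame p q r)"
proof -
  have self: "\<omega> u u = 0" for u using assms(1)[of u u] by simp
  have neg: "\<omega> u v = 1 \<Longrightarrow> \<omega> v u = - 1" "\<omega> u v = 0 \<Longrightarrow> \<omega> v u = 0" for u v
    using assms(1)[of v u] by simp_all
  show ?thesis
    unfolding symplectic_frame_def forall_33 pairs_frame_nth
    by (simp add: J0_def self assms(2-) assms(2-4)[THEN neg(1)] assms(5-)[THEN neg(2)])
qed

text \<open>On symplectic matrices the complex-linear part is invertible, so its determinant detects the homotopy
  class of a loop of symplectic frames.\<close>

definition frame_det :: "(complex ^ 3) ^ (3 + 3) \<Rightarrow> complex" where
  "frame_det F = det (\<chi> i p. F $ Inl p $ i - \<i> * F $ Inr p $ i :: complex ^ 3 ^ 3)"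

text \<open>Split a kernel vector \<open>x\<close> into real combinations with \<open>v\<close> +
  \<i> \<open>u\<close> = 0. Then \<omega>(v, u) = \<omega>(- \<i> u, u) is nonnegative by
  compatibility with \<i>, while the symplectic relations of the frame make it minus the squared
  norm of \<open>x\<close>.\<close>

lemma frame_det_nonzero:
  assumes F: "symplectic_frame (wIm a b c) F" and pos: "0 < a" "0 < b" "0 < c"
  shows "frame_det F \<noteq> 0"
proof -
  let ?A = "(\<chi> i p. F $ Inl p $ i - \<i> * F $ Inr p $ i) :: complex ^ 3 ^ 3"
  have "x = 0" if x: "?A *v x = 0" for x
  proof -
    define v where "v = (\<Sum>p\<in>UNIV. Re (x $ p) *\<^sub>R F $ Inl p + Im (x $ p) *\<^sub>R F $ Inr p)"
    define u where "u = (\<Sum>p\<in>UNIV. Im (x $ p) *\<^sub>R F $ Inl p - Re (x $ p) *\<^sub>R F $ Inr p)"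
    have "v + \<i> *s u = ?A *v x"
      by (simp add: vec_eq_iff v_def u_def sum_UNIV_3 matrix_vector_mult_def complex_eq_iff algebra_simps)
    then have "v = (- \<i>) *s u" using x by (simp add: eq_neg_iff_add_eq_0 vector_smult_lneg)
    then have "wIm a b c v u = wRe a b c u u"
      by (simp add: wIm_def wRe_def algebra_simps)
    moreover have "wIm a b c v u = - (\<Sum>p\<in>UNIV. (Re (x $ p))\<^sup>2 + (Im (x $ p))\<^sup>2)"
    proof -
      have om: "wIm a b c (F $ i) (F $ j) = - (J0 $ i $ j)" for i j
        using F by (simp add: symplectic_frame_def)
      show ?thesis
        unfolding v_def u_def sum_UNIV_3
        by (simp add: bounded_bilinear.add_left[OF bounded_bilinear_wIm] bounded_bilinear.add_right[OF bounded_bilinear_wIm]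
          bounded_bilinear.diff_right[OF bounded_bilinear_wIm]
          bounded_bilinear.scaleR_left[OF bounded_bilinear_wIm] bounded_bilinear.scaleR_right[OF bounded_bilinear_wIm]
          om J0_def power2_eq_square)
    qed
    moreover have "wRe a b c u u \<ge> 0" using wRe_pos[OF pos, of u] by (cases "u = 0") (auto simp: wRe_def)
    ultimately have "(\<Sum>p\<in>UNIV. (Re (x $ p))\<^sup>2 + (Im (x $ p))\<^sup>2) \<le> 0" by simp
    then have "(\<Sum>p\<in>UNIV. (Re (x $ p))\<^sup>2 + (Im (x $ p))\<^sup>2) = 0" by (intro antisym sum_nonneg) auto
    then have "\<forall>p\<in>UNIV. (Re (x $ p))\<^sup>2 + (Im (x $ p))\<^sup>2 = 0" by (subst (asm) sum_nonneg_eq_0_iff) auto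
    then show "x = 0" by (simp add: vec_eq_iff complex_eq_iff sum_power2_eq_zero_iff)
  qed
  then have "invertible ?A" unfolding invertible_left_inverse matrix_left_invertible_ker by blast
  then show ?thesis unfolding frame_det_def by (simp add: invertible_det_nz)
qed

lemma det_3': "det (A :: complex ^ 3 ^ 3) =
    A $ 0 $ 0 * A $ 1 $ 1 * A $ 2 $ 2 + A $ 0 $ 1 * A $ 1 $ 2 * A $ 2 $ 0 + A $ 0 $ 2 * A $ 1 $ 0 * A $ 2 $ 1
    - A $ 0 $ 0 * A $ 1 $ 2 * A $ 2 $ 1 - A $ 0 $ 1 * A $ 1 $ 0 * A $ 2 $ 2 - A $ 0 $ 2 * A $ 1 $ 1 * A $ 2 $ 0"
proof -
  \<comment> \<open>The expansion \<open>det_3\<close> is indexed by 1, 2, 3, and in the type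
    \<open>3\<close> the numeral 3 is 0.\<close>
  have "(3 :: 3) = 0" by simp
  then show ?thesis using det_3[of A] by (simp only:) (simp add: algebra_simps)
qed

lemma continuous_on_frame_det: "continuous_on S frame_det"
  unfolding frame_det_def[abs_def] det_3' vec_lambda_beta by (intro continuous_intros)

section \<open>The canonical trivialization along the two orbits\<close>

lemma continuous_on_axis:
  assumes "continuous_on S f" shows "continuous_on S (\<lambda>x. axis j (f x) :: complex ^ 3)"
  unfolding axis_def
proof (rule continuous_on_vec_lambda)
  show "continuous_on S (\<lambda>x. if i = j then f x else 0)" for i
    using assms by (cases "i = j") auto
qed

lemma continuous_on_pairs_frame:
  fixes p1 :: "'a::topological_space \<Rightarrow> complex ^ 3"
  assumes "continuous_on S p1" "continuous_on S p2" "continuous_on S q1" "continuous_on S q2"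
    "continuous_on S r1" "continuous_on S r2"
  shows "continuous_on S (\<lambda>x. pairs_frame (p1 x, p2 x) (q1 x, q2 x) (r1 x, r2 x))"
  unfolding pairs_frame_def Let_def
proof (intro continuous_on_vec_lambda)
  fix i :: "3 + 3"
  show "continuous_on S (\<lambda>x. case i of
      Inl l \<Rightarrow> fst (if l = 0 then (p1 x, p2 x) else if l = 1 then (q1 x, q2 x) else (r1 x, r2 x))
    | Inr l \<Rightarrow> snd (if l = 0 then (p1 x, p2 x) else if l = 1 then (q1 x, q2 x) else (r1 x, r2 x)))"
  proof -
    obtain l where "i = Inl l \<or> i = Inr l" by (cases i) auto
    then show ?thesis using assms by (cases "l = 0"; cases "l = 1") auto
  qed
qed

text \<open>Treats both orbits at once: \<open>j\<close> is the coordinate in which the orbit runs,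
  \<open>k\<close> the other one besides 0, and \<open>N\<close> the iterate.\<close>

locale axis_orbit = irrational_link +
  fixes j k :: 3 and N :: nat
  assumes jk: "j = 1 \<and> k = 2 \<or> j = 2 \<and> k = 1" and N: "1 \<le> N"
begin

definition "a = amp j"
definition "T = real N * pi / a"
definition "orb t = (axis j (cis (2 * a * t)) :: complex ^ 3)"
text \<open>The Euclidean area spanned in the \<open>z $ 0\<close> plane by a symplectic basis for
  d\<alpha>; division by its square root normalizes to determinant 1.\<close>

definition "\<kappa> = 2 * a / (real n + 1)"

lemma a_pos: "a > 0" and T_pos: "T > 0" and kappa_pos: "\<kappa> > 0" and j0: "j \<noteq> 0"
  using amp(2)[of j] N jk by (auto simp: a_def T_def \<kappa>_def)

lemma jk_distinct [simp]: "j \<noteq> 0" "k \<noteq> 0" "j \<noteq> k" "k \<noteq> j" "0 \<noteq> j" "0 \<noteq> k"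
  using jk by auto

lemma om_axis:
  "om (axis 0 x) (axis 0 y) = (real n + 1) / 2 * Im (cnj x * y)"
  "l \<noteq> 0 \<Longrightarrow> om (axis l x) (axis l y) = Im (cnj x * y)"
  "l \<noteq> m \<Longrightarrow> om (axis l x) (axis m y) = 0"
proof -
  have cases: "l = 0 \<or> l = 1 \<or> l = 2" for l :: 3 using UNIV_3' by blast
  show "om (axis 0 x) (axis 0 y) = (real n + 1) / 2 * Im (cnj x * y)"
    unfolding wIm_def axis_def by simp
  show "l \<noteq> 0 \<Longrightarrow> om (axis l x) (axis l y) = Im (cnj x * y)"
    using cases[of l] unfolding wIm_def axis_def by auto
  show "l \<noteq> m \<Longrightarrow> om (axis l x) (axis m y) = 0"
    using cases[of l] cases[of m] unfolding wIm_def axis_def by auto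
qed

lemma orb: "orb t \<in> M" "H (orb t) = a" "R (orb t) = axis j (\<i> * of_real (2 * a) * cis (2 * a * t))"
proof -
  show "orb t \<in> M" unfolding orb_def by (rule axis_link) (use j0 in auto)
  show "H (orb t) = a" using jk by (auto simp: orb_def wRe_self axis_def a_def amp_def)
  show "R (orb t) = axis j (\<i> * of_real (2 * a) * cis (2 * a * t))"
    unfolding vec_eq_iff R_nth using amp(1)[OF j0] by (auto simp: orb_def axis_def a_def)
qed

text \<open>The phase is opposite to that of the orbit. The two rotating columns of the sum frame
  thus have a constant determinant, and this is the reason why the constant trivialization of the
  contact plane is canonical.\<close>

lemma X1_orb: "X1 n (orb t) = axis k (cnj (cis (2 * a * t)))"
  using jk n by (auto simp: X1_def orb_def axis_def vec_eq_3)

lemma dalpha_orb: "ext_deriv \<alpha> (orb t) (axis 0 x) (axis 0 y) = Im (cnj x * y) / \<kappa>"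
proof -
  have "lam (orb t) (axis 0 x) = 0" for x
    using lam_om[of "orb t" "axis 0 x"] om_axis(3)[of j 0] by (simp add: orb_def)
  then show ?thesis
    unfolding dalpha[OF link_A_not_0[OF orb(1)]] orb(2) om_axis(1) \<kappa>_def by simp
qed

text \<open>The three pairs lie in different coordinate axes, which are
  \<open>om\<close>-orthogonal, so the Gram-Schmidt projections do nothing and only the
  normalizations by the square roots of \<open>a\<close>, 1 and \<open>2 * a\<close> remain.\<close>

lemma sum_frame_orb:
  assumes b: "b $ Inl 1 = axis 0 e" "b $ Inr 1 = axis 0 f" and ef: "Im (cnj e * f) = \<kappa>"
    and x_def: "x = cis (2 * a * t)"
  shows "sum_frame n \<epsilon> (orb t) b = pairs_frame (axis 0 (e / of_real (sqrt a)), axis 0 (f / of_real (sqrt a)))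
    (axis k (cnj x), axis k (\<i> * cnj x)) (axis j (x / of_real (sqrt (2 * a))), axis j (\<i> * of_real (sqrt (2 * a)) * x))"
proof -
  have xx: "cnj x * x = 1" "x * cnj x = 1" by (simp_all add: x_def cis_cnj cis_mult)
  have scale: "axis l y /\<^sub>R r = axis l (y / of_real r)" for l :: 3 and y :: complex and r :: real
  proof -
    have "inverse r *\<^sub>R y = y / of_real r" by (simp add: scaleR_conv_of_real divide_inverse mult.commute)
    then show ?thesis by (simp add: vec_eq_iff axis_def)
  qed
  have smul: "\<i> *s axis l y = axis l (\<i> * y)" for l and y :: complex
    by (simp add: vec_eq_iff axis_def)
  have p: "symp_normalize om (b $ Inl 1) (b $ Inr 1) = (axis 0 (e / of_real (sqrt a)), axis 0 (f / of_real (sqrt a)))"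
  proof -
    have "(real n + 1) / 2 * \<kappa> = a" by (simp add: \<kappa>_def)
    then show ?thesis unfolding symp_normalize_def b om_axis(1) ef scale by simp
  qed
  have red: "symp_reduce om (axis l y1, axis l y2) (axis m w) = axis m w" if "l \<noteq> m" for l m y1 y2 w
    using that om_axis(3)[of m l] by (simp add: symp_reduce_def)
  have q: "symp_normalize om (axis k (cnj x)) (axis k (\<i> * cnj x)) = (axis k (cnj x), axis k (\<i> * cnj x))"
  proof -
    have "om (axis k (cnj x)) (axis k (\<i> * cnj x)) = 1"
      using xx by (simp only: om_axis(2)[OF jk_distinct(2)] complex_cnj_cnj mult.left_commute[of x] xx) simp
    then show ?thesis by (simp add: symp_normalize_def)
  qed
  have r: "symp_normalize om (axis j x) (axis j (\<i> * of_real (2 * a) * x))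
     = (axis j (x / of_real (sqrt (2 * a))), axis j (\<i> * of_real (sqrt (2 * a)) * x))"
  proof -
    have "cnj x * (\<i> * of_real (2 * a) * x) = \<i> * of_real (2 * a) * (cnj x * x)" by simp
    then have "om (axis j x) (axis j (\<i> * of_real (2 * a) * x)) = 2 * a"
      unfolding om_axis(2)[OF jk_distinct(1)] xx by (simp only: xx) simp
    moreover have "\<i> * of_real (2 * a) * x / of_real (sqrt (2 * a)) = \<i> * of_real (sqrt (2 * a)) * x"
    proof -
      have "complex_of_real (2 * a) = of_real (sqrt (2 * a)) * of_real (sqrt (2 * a))"
        using a_pos by (simp only: of_real_mult[symmetric]) simp
      then show ?thesis using a_pos by simp
    qed
    ultimately show ?thesis unfolding symp_normalize_def scale by simp
  qed
  show ?thesis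
    unfolding sum_frame_def Let_def omega_1_eq_wIm p reeb_eq[OF orb(1)] orb(3) X1_orb x_def[symmetric] smul
      red[OF jk_distinct(6)] q
    unfolding orb_def x_def[symmetric] red[OF jk_distinct(5)] red[OF jk_distinct(4)] r ..
qed

lemma frame_det_sum_frame:
  obtains C where "C \<noteq> 0" "\<And>t b e f. b $ Inl 1 = axis 0 e \<Longrightarrow> b $ Inr 1 = axis 0 f \<Longrightarrow> Im (cnj e * f) = \<kappa>
    \<Longrightarrow> frame_det (sum_frame n \<epsilon> (orb t) b) = C * (e - \<i> * f)"
proof -
  let ?s = "complex_of_real (sqrt (2 * a))"
  define D where "D = 1 / ?s + ?s"
  \<comment> \<open>For \<open>j = 1\<close> the second and third column occupy the rows 2 and 1, an
    odd permutation.\<close>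
  define C where "C = (if j = 1 then - 1 else 1) * (2 * D / of_real (sqrt a))"
  have "1 / sqrt (2 * a) + sqrt (2 * a) > 0" using a_pos by (simp add: add_pos_pos)
  then have "complex_of_real (1 / sqrt (2 * a) + sqrt (2 * a)) \<noteq> 0" by (metis less_irrefl of_real_eq_0_iff)
  then have "D \<noteq> 0" by (simp add: D_def)
  then have "C \<noteq> 0" using a_pos by (simp add: C_def)
  moreover have "frame_det (sum_frame n \<epsilon> (orb t) b) = C * (e - \<i> * f)"
    if "b $ Inl 1 = axis 0 e" "b $ Inr 1 = axis 0 f" "Im (cnj e * f) = \<kappa>" for t b e f
  proof -
    define x where "x = cis (2 * a * t)"
    have xx: "cnj x * x = 1" by (simp add: x_def cis_cnj cis_mult)
    have "frame_det (sum_frame n \<epsilon> (orb t) b) = (if j = 1 then - 1 else 1) *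
       ((e / of_real (sqrt a) - \<i> * (f / of_real (sqrt a))) * (cnj x - \<i> * (\<i> * cnj x)) * (x / ?s - \<i> * (\<i> * ?s * x)))"
      unfolding sum_frame_orb[OF that x_def] frame_det_def det_3' vec_lambda_beta pairs_frame_nth fst_conv snd_conv
      using jk by (auto simp: axis_def)
    also have "\<dots> = (if j = 1 then - 1 else 1) * ((e - \<i> * f) / of_real (sqrt a) * (2 * D) * (cnj x * x))"
    proof -
      have "e / of_real (sqrt a) - \<i> * (f / of_real (sqrt a)) = (e - \<i> * f) / of_real (sqrt a)"
        by (simp add: diff_divide_distrib)
      moreover have "cnj x - \<i> * (\<i> * cnj x) = 2 * cnj x" by (simp flip: mult.assoc)
      moreover have "x / ?s - \<i> * (\<i> * ?s * x) = x * D"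
        unfolding D_def by (simp add: distrib_left mult.commute flip: mult.assoc)
      ultimately show ?thesis by (simp only: mult_ac)
    qed
    also have "\<dots> = C * (e - \<i> * f)" unfolding xx C_def by simp
    finally show ?thesis .
  qed
  ultimately show ?thesis using that by blast
qed

section \<open>Trivializations of the contact plane and the linearized flow\<close>

lemma trivialization_components:
  assumes b: "symplectic_trivialization M \<alpha> T orb (b :: real \<Rightarrow> (complex ^ 3) ^ (1 + 1))"
  defines "e \<equiv> \<lambda>t. b t $ Inl 1 $ 0" and "f \<equiv> \<lambda>t. b t $ Inr 1 $ 0"
  shows "b t $ Inl 1 = axis 0 (e t)" "b t $ Inr 1 = axis 0 (f t)" "Im (cnj (e t) * f t) = \<kappa>"
    "continuous_on UNIV e" "continuous_on UNIV f" "e (t + T) = e t" "f (t + T) = f t"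
proof -
  have sp: "b t $ i \<in> range (axis 0)" for i
  proof -
    have "b t $ i \<in> span (range (\<lambda>i. b t $ i))" by (intro span_base) simp
    also have "\<dots> = contact_structure M \<alpha> (orb t)" using b by (simp add: symplectic_trivialization_def)
    also have "\<dots> = range (axis 0)" unfolding orb_def by (rule contact_structure_axis) (use j0 in auto)
    finally show ?thesis .
  qed
  then show ax: "b t $ Inl 1 = axis 0 (e t)" "b t $ Inr 1 = axis 0 (f t)"
    unfolding e_def f_def using axis_nth by (metis imageE)+
  have "ext_deriv \<alpha> (orb t) (b t $ Inl 1) (b t $ Inr 1) = - (J0 $ Inl (1::1) $ Inr 1)"
    using b by (simp add: symplectic_trivialization_def symplectic_frame_def)
  also have "\<dots> = 1" by (simp add: J0_def)
  finally show "Im (cnj (e t) * f t) = \<kappa>"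
    unfolding ax dalpha_orb using kappa_pos by (simp add: divide_eq_eq)
  have "continuous_on UNIV b" using b by (simp add: symplectic_trivialization_def)
  then have "continuous_on UNIV (\<lambda>t. b t $ i $ 0)" for i by (intro continuous_intros)
  then show "continuous_on UNIV e" "continuous_on UNIV f" unfolding e_def f_def by blast+
  show "e (t + T) = e t" "f (t + T) = f t"
    using b by (simp_all add: e_def f_def symplectic_trivialization_def)
qed

text \<open>The flow acts on the contact plane by a rotation; its matrix entries in the moving frame
  come from Cramer's rule, with \<open>Im (cnj u * v)\<close> as the area form.\<close>

lemma linearized_flow_orb:
  assumes b: "symplectic_trivialization M \<alpha> T orb (b :: real \<Rightarrow> (complex ^ 3) ^ (1 + 1))"
  defines "E \<equiv> \<lambda>t. b t $ Inl 1 $ 0 / of_real (sqrt \<kappa>)" and "F \<equiv> \<lambda>t. b t $ Inr 1 $ 0 / of_real (sqrt \<kappa>)"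
  shows "linearized_flow M \<alpha> orb b t = conj_rot (E t) (F t) (E 0) (F 0) (cis (freq 0 * t))"
  unfolding linearized_flow_def
proof (rule the_equality)
  define e f where "e t = b t $ Inl 1 $ 0" and "f t = b t $ Inr 1 $ 0" for t
  note c = trivialization_components[OF b, folded e_def f_def]
  let ?w = "cis (freq 0 * t)"
  have sk: "complex_of_real (sqrt \<kappa>) * of_real (sqrt \<kappa>) = of_real \<kappa>"
    using kappa_pos by (simp only: of_real_mult[symmetric]) simp
  have E: "E t = e t / of_real (sqrt \<kappa>)" "F t = f t / of_real (sqrt \<kappa>)" for t
    by (simp_all add: E_def F_def e_def f_def)
  have Im: "Im (cnj (?w * (x / of_real (sqrt \<kappa>))) * (y / of_real (sqrt \<kappa>))) = Im (cnj (?w * x) * y) / \<kappa>"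
    "Im (cnj y / of_real (sqrt \<kappa>) * (?w * (x / of_real (sqrt \<kappa>)))) = Im (cnj y * (?w * x)) / \<kappa>" for x y
  proof -
    have "cnj (?w * (x / of_real (sqrt \<kappa>))) * (y / of_real (sqrt \<kappa>)) = cnj (?w * x) * y / of_real \<kappa>"
      "cnj y / of_real (sqrt \<kappa>) * (?w * (x / of_real (sqrt \<kappa>))) = cnj y * (?w * x) / of_real \<kappa>"
      unfolding sk[symmetric] by simp_all
    then show "Im (cnj (?w * (x / of_real (sqrt \<kappa>))) * (y / of_real (sqrt \<kappa>))) = Im (cnj (?w * x) * y) / \<kappa>"
      "Im (cnj y / of_real (sqrt \<kappa>) * (?w * (x / of_real (sqrt \<kappa>)))) = Im (cnj y * (?w * x)) / \<kappa>"
      by (simp_all only: Im_divide_of_real)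
  qed
  have tm: "tangent_map M (reeb_flow M \<alpha> t) (orb 0) (axis 0 x) = axis 0 (?w * x)" for x
  proof -
    have "axis 0 x \<in> contact_structure M \<alpha> (orb 0)"
      unfolding orb_def by (subst contact_structure_axis) (use j0 in auto)
    then have "axis 0 x \<in> tangent_space M (orb 0)" by (simp add: contact_structure_def)
    from tangent_map_flow[OF orb(1) this] show ?thesis by (simp add: rot_axis)
  qed
  have rhs: "(\<Sum>i\<in>UNIV. A $ i $ l *\<^sub>R b t $ i) = axis 0 (A $ Inl 1 $ l *\<^sub>R e t + A $ Inr 1 $ l *\<^sub>R f t)"
    for A :: "1 sq_matrix" and l
    unfolding sum_11 c(1,2) by (simp add: vec_eq_iff axis_def)
  have solve: "?w * x = r *\<^sub>R e t + s *\<^sub>R f t \<longleftrightarrow> r = Im (cnj (?w * x) * f t) / \<kappa> \<and> s = Im (cnj (e t) * (?w * x)) / \<kappa>"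
    for x r s
  proof
    assume *: "?w * x = r *\<^sub>R e t + s *\<^sub>R f t"
    have "Im (cnj (?w * x) * f t) = r * Im (cnj (e t) * f t)" "Im (cnj (e t) * (?w * x)) = s * Im (cnj (e t) * f t)"
      unfolding * by (simp_all add: algebra_simps)
    then show "r = Im (cnj (?w * x) * f t) / \<kappa> \<and> s = Im (cnj (e t) * (?w * x)) / \<kappa>"
      unfolding c(3) using kappa_pos by simp
  next
    assume *: "r = Im (cnj (?w * x) * f t) / \<kappa> \<and> s = Im (cnj (e t) * (?w * x)) / \<kappa>"
    have id: "Im (cnj W * f t) *\<^sub>R e t + Im (cnj (e t) * W) *\<^sub>R f t = Im (cnj (e t) * f t) *\<^sub>R W" for W
      by (simp add: complex_eq_iff algebra_simps)
    have "\<kappa> *\<^sub>R (r *\<^sub>R e t + s *\<^sub>R f t) = \<kappa> *\<^sub>R (?w * x)"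
      using * kappa_pos id[of "?w * x"] unfolding c(3) by (simp add: scaleR_add_right)
    then show "?w * x = r *\<^sub>R e t + s *\<^sub>R f t" using kappa_pos by simp
  qed
  have ax_inj: "(axis 0 u :: complex ^ 3) = axis 0 v \<longleftrightarrow> u = v" for u v by (metis axis_nth)
  have iff: "(\<forall>l. tangent_map M (reeb_flow M \<alpha> t) (orb 0) (b 0 $ l) = (\<Sum>i\<in>UNIV. A $ i $ l *\<^sub>R b t $ i))
     \<longleftrightarrow> A = conj_rot (E t) (F t) (E 0) (F 0) ?w" for A
  proof -
    have "(\<forall>l. tangent_map M (reeb_flow M \<alpha> t) (orb 0) (b 0 $ l) = (\<Sum>i\<in>UNIV. A $ i $ l *\<^sub>R b t $ i))
      \<longleftrightarrow> ?w * e 0 = A $ Inl 1 $ Inl 1 *\<^sub>R e t + A $ Inr 1 $ Inl 1 *\<^sub>R f t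
        \<and> ?w * f 0 = A $ Inl 1 $ Inr 1 *\<^sub>R e t + A $ Inr 1 $ Inr 1 *\<^sub>R f t"
      unfolding forall_11 rhs c(1,2) tm ax_inj ..
    also have "\<dots> \<longleftrightarrow> A = conj_rot (E t) (F t) (E 0) (F 0) ?w"
      unfolding solve conj_rot_def E complex_cnj_divide complex_cnj_complex_of_real Im
      by (subst (5) mat2_eq[of A]) (auto simp: mat2_eq_iff)
    finally show ?thesis .
  qed
  show "\<forall>l. tangent_map M (reeb_flow M \<alpha> t) (orb 0) (b 0 $ l)
     = (\<Sum>i\<in>UNIV. conj_rot (E t) (F t) (E 0) (F 0) ?w $ i $ l *\<^sub>R b t $ i)"
    using iff by blast
  show "A = conj_rot (E t) (F t) (E 0) (F 0) ?w"
    if "\<forall>l. tangent_map M (reeb_flow M \<alpha> t) (orb 0) (b 0 $ l) = (\<Sum>i\<in>UNIV. A $ i $ l *\<^sub>R b t $ i)" for A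
    using that iff by blast
qed

lemma T_rotation: "freq 0 * T = 2 * pi * (2 * real N / ((real n + 1) * a))"
  "2 * real N / ((real n + 1) * a) \<noteq> of_int m"
proof -
  show 1: "freq 0 * T = 2 * pi * (2 * real N / ((real n + 1) * a))"
    by (simp add: freq_def T_def)
  have "freq j * T = 2 * pi * of_int (int N)"
    using a_pos amp(1)[OF j0] by (simp add: T_def a_def)
  from freq_0_nonresonant[OF j0 T_pos this] 1
  show "2 * real N / ((real n + 1) * a) \<noteq> of_int m" using cis_eq_1_int by metis
qed

text \<open>\<open>frame_det\<close> of the sum frame is a constant times \<open>e - \<i> f\<close>.
  The homotopy to the constant frame gives it a logarithm of equal end values, which is the function
  required by \<open>cz_index_rotation\<close>.\<close>

lemma cz_canonical:
  assumes b: "canonical_trivialization n \<epsilon> T orb b"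
  shows "cz_index T (linearized_flow M \<alpha> orb b) = 2 * \<lfloor>2 * real N / ((real n + 1) * a)\<rfloor> + 1"
proof -
  have triv: "symplectic_trivialization M \<alpha> T orb b" using b by (simp add: canonical_trivialization_def)
  define e f where "e t = b t $ Inl 1 $ 0" and "f t = b t $ Inr 1 $ 0" for t
  note c = trivialization_components[OF triv, folded e_def f_def]
  obtain C where C: "C \<noteq> 0" "frame_det (sum_frame n \<epsilon> (orb t) (b t)) = C * (e t - \<i> * f t)" for t
    using frame_det_sum_frame c(1,2,3) by metis
  have hl: "homotopic_loops {F. symplectic_frame om F}
      (\<lambda>x. sum_frame n \<epsilon> (orb (T * x)) (b (T * x))) (\<lambda>x. constant_frame n)"
    using b by (simp add: canonical_trivialization_def omega_1_eq_wIm)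
  have nz: "frame_det F \<noteq> 0" if "F \<in> {F. symplectic_frame om F}" for F
    using that by (intro frame_det_nonzero[of "(real n + 1) / 2" 1 1]) auto
  obtain G where G: "continuous_on {0..1} G" "G 1 = G (0 :: real)"
    "\<And>x. x \<in> {0..1} \<Longrightarrow> frame_det (sum_frame n \<epsilon> (orb (T * x)) (b (T * x))) = exp (G x)"
    by (rule nullhomotopic_loop_log[OF hl continuous_on_frame_det nz]) blast+
  define s where "s = complex_of_real (sqrt \<kappa>)"
  have s: "s \<noteq> 0" "s * s = of_real \<kappa>" "cnj s = s"
    using kappa_pos by (auto simp: s_def of_real_mult[symmetric] simp del: of_real_mult)
  \<comment> \<open>Subtracting the logarithm of \<open>C * s\<close> removes the constant of the
    determinant and passes to the frame of determinant 1.\<close>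
  define g where "g t = G (t / T) - Ln (C * s)" for t
  have wind: "e t / s - \<i> * (f t / s) = exp (g t)" if "t \<in> {0..T}" for t
  proof -
    have "t / T \<in> {0..1}" "T * (t / T) = t" using that T_pos by auto
    then have "C * (e t - \<i> * f t) = exp (G (t / T))" using G(3)[of "t / T"] C(2)[of t] by simp
    then have "exp (g t) = C * (e t - \<i> * f t) / (C * s)"
      using C(1) s(1) by (simp add: g_def exp_diff)
    then have "exp (g t) = (e t - \<i> * f t) / s" using C(1) by simp
    then show ?thesis by (simp add: diff_divide_distrib)
  qed
  define m where "m = \<lfloor>2 * real N / ((real n + 1) * a)\<rfloor>"
  have m: "of_int m < 2 * real N / ((real n + 1) * a)" "2 * real N / ((real n + 1) * a) < of_int m + 1"
    using T_rotation(2)[of m] unfolding m_def by linarith+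
  show ?thesis
    unfolding m_def[symmetric]
  proof (rule cz_index_rotation[OF T_pos, where E = "\<lambda>t. e t / s" and F = "\<lambda>t. f t / s" and g = g and \<omega> = "freq 0"])
    show "continuous_on {0..T} (\<lambda>t. e t / s)" "continuous_on {0..T} (\<lambda>t. f t / s)"
      using s(1) c(4,5) by (auto intro!: continuous_on_divide continuous_on_const intro: continuous_on_subset)
    show "Im (cnj (e t / s) * (f t / s)) = 1" for t
    proof -
      have "cnj (e t / s) * (f t / s) = cnj (e t) * f t / of_real \<kappa>" unfolding s(2)[symmetric] by (simp add: s(3))
      then show ?thesis using c(3)[of t] kappa_pos by (simp only: Im_divide_of_real) simp
    qed
    show "e T / s = e 0 / s" "f T / s = f 0 / s" using c(6)[of 0] c(7)[of 0] by simp_all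
    show "continuous_on {0..T} g"
      unfolding g_def
      by (intro continuous_intros continuous_on_compose2[OF G(1), of "{0..T}" "\<lambda>t. t / T"]) (use T_pos in auto)
    show "g T = g 0" using G(2) T_pos by (simp add: g_def)
    show "linearized_flow M \<alpha> orb b t = conj_rot (e t / s) (f t / s) (e 0 / s) (f 0 / s) (cis (freq 0 * t))" for t
      using linearized_flow_orb[OF triv] by (simp add: e_def f_def s_def)
    show "2 * pi * of_int m < freq 0 * T" "freq 0 * T < 2 * pi * (of_int m + 1)"
      unfolding T_rotation(1) by (rule mult_strict_left_mono[OF m(1)] mult_strict_left_mono[OF m(2)]; simp)+
  qed (use wind in auto)
qed

text \<open>The pairs \<open>(\<mu>, \<nu>)\<close> on the three-sphere parametrize SU(2); the loop
  \<open>diag (x, 1 / x)\<close> contracts in it.\<close>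

definition path_frame :: "complex \<Rightarrow> complex \<Rightarrow> complex \<Rightarrow> real \<Rightarrow> (complex ^ 3) ^ (3 + 3)" where
  "path_frame \<mu> \<nu> \<zeta> s = (let E = axis 0 (of_real (sqrt (2 / (real n + 1)))); q = axis k \<mu> + axis j \<nu>;
      r = axis j (\<zeta> * cnj \<mu>) - axis k (\<zeta> * cnj \<nu>)
    in pairs_frame (E, \<i> *s E) (q, \<i> *s q) (r /\<^sub>R s, s *\<^sub>R (\<i> *s r)))"

text \<open>For \<open>s = 1\<close> the frame is unitary, as q and r are orthonormal for the
  Hermitian form of \<open>om\<close>, hence symplectic. Dividing one vector of the last pair by
  \<open>s\<close> and multiplying the other by \<open>s\<close> preserves this; the phase \<zeta>
  rotates r.\<close>

lemma path_frame_symplectic: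
  assumes "(cmod \<mu>)\<^sup>2 + (cmod \<nu>)\<^sup>2 = 1" "cmod \<zeta> = 1" "s > 0"
  shows "symplectic_frame om (path_frame \<mu> \<nu> \<zeta> s)"
proof -
  define E :: "complex ^ 3" where "E = axis 0 (of_real (sqrt (2 / (real n + 1))))"
  define q :: "complex ^ 3" where "q = axis k \<mu> + axis j \<nu>"
  define r :: "complex ^ 3" where "r = axis j (\<zeta> * cnj \<mu>) - axis k (\<zeta> * cnj \<nu>)"
  let ?re = "wRe ((real n + 1) / 2) 1 1"
  have "?re E E = 1"
    by (simp add: wRe_self E_def axis_def)
  moreover have "?re q q = 1" using jk assms(1) by (auto simp: wRe_self q_def axis_def)
  moreover have "?re r r = 1" using jk assms by (auto simp: wRe_self r_def axis_def norm_mult)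
  moreover have "?re E q = 0" "om E q = 0" "?re E r = 0" "om E r = 0"
    using jk by (auto simp: wRe_def wIm_def E_def q_def r_def axis_def)
  moreover have "cnj (q $ 0) * r $ 0 = 0" "cnj (q $ 1) * r $ 1 + cnj (q $ 2) * r $ 2 = 0"
    using jk by (auto simp: q_def r_def axis_def)
  then have "Re (cnj (q $ 0) * r $ 0) = 0" "Re (cnj (q $ 1) * r $ 1 + cnj (q $ 2) * r $ 2) = 0"
    "Im (cnj (q $ 0) * r $ 0) = 0" "Im (cnj (q $ 1) * r $ 1 + cnj (q $ 2) * r $ 2) = 0" by (metis zero_complex.sel)+
  then have "?re q r = 0" "om q r = 0" unfolding wRe_def wIm_def plus_complex.simps by simp_all
  ultimately show ?thesis
    unfolding path_frame_def Let_def E_def[symmetric] q_def[symmetric] r_def[symmetric]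
    using assms(3)
    by (intro symplectic_pairs_frame[OF wIm_antisym])
      (simp_all add: bounded_bilinear.scaleR_left[OF bounded_bilinear_wRe]
        bounded_bilinear.scaleR_right[OF bounded_bilinear_wRe]
        bounded_bilinear.scaleR_left[OF bounded_bilinear_wIm]
        bounded_bilinear.scaleR_right[OF bounded_bilinear_wIm])
qed

lemma continuous_on_path_frame:
  assumes "continuous_on S \<mu>" "continuous_on S \<nu>" "continuous_on S \<zeta>" "continuous_on S s" "\<And>x. x \<in> S \<Longrightarrow> s x > 0"
  shows "continuous_on S (\<lambda>x. path_frame (\<mu> x) (\<nu> x) (\<zeta> x) (s x))"
proof -
  have smul: "continuous_on S (\<lambda>x. \<i> *s f x)" if "continuous_on S f" for f :: "_ \<Rightarrow> complex ^ 3"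
    unfolding vector_scalar_mult_def using that by (intro continuous_on_vec_lambda continuous_intros)
  have q: "continuous_on S (\<lambda>x. axis k (\<mu> x) + axis j (\<nu> x) :: complex ^ 3)"
    by (intro continuous_on_add continuous_on_axis assms)
  have r: "continuous_on S (\<lambda>x. axis j (\<zeta> x * cnj (\<mu> x)) - axis k (\<zeta> x * cnj (\<nu> x)) :: complex ^ 3)"
    by (intro continuous_on_diff continuous_on_axis continuous_on_mult continuous_on_cnj assms)
  have "continuous_on S (\<lambda>x. inverse (s x))"
    by (rule continuous_on_inverse[OF assms(4)]) (use assms(5) in force)
  then show ?thesis
    unfolding path_frame_def Let_def
    by (intro continuous_on_pairs_frame smul q r continuous_on_scaleR assms continuous_on_const)
qed

lemma homotopic_path_frames:
  fixes \<mu> \<nu> \<zeta> :: "real \<times> real \<Rightarrow> complex" and s :: "real \<times> real \<Rightarrow> real"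
  assumes "continuous_on ({0..1} \<times> {0..1}) \<mu>" "continuous_on ({0..1} \<times> {0..1}) \<nu>"
    "continuous_on ({0..1} \<times> {0..1}) \<zeta>" "continuous_on ({0..1} \<times> {0..1}) s"
    and "\<And>u x. (cmod (\<mu> (u, x)))\<^sup>2 + (cmod (\<nu> (u, x)))\<^sup>2 = 1" "\<And>u x. cmod (\<zeta> (u, x)) = 1"
    "\<And>u x. u \<in> {0..1} \<Longrightarrow> s (u, x) > 0"
    and "\<And>u. \<mu> (u, 0) = \<mu> (u, 1)" "\<And>u. \<nu> (u, 0) = \<nu> (u, 1)" "\<And>u. \<zeta> (u, 0) = \<zeta> (u, 1)" "\<And>u. s (u, 0) = s (u, 1)"
  shows "homotopic_loops {F. symplectic_frame om F}
    (\<lambda>x. path_frame (\<mu> (0, x)) (\<nu> (0, x)) (\<zeta> (0, x)) (s (0, x)))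
    (\<lambda>x. path_frame (\<mu> (1, x)) (\<nu> (1, x)) (\<zeta> (1, x)) (s (1, x)))"
  unfolding homotopic_loops
proof (intro exI[of _ "\<lambda>z. path_frame (\<mu> z) (\<nu> z) (\<zeta> z) (s z)"] conjI)
  show "continuous_on ({0..1} \<times> {0..1}) (\<lambda>z. path_frame (\<mu> z) (\<nu> z) (\<zeta> z) (s z))"
    by (rule continuous_on_path_frame[OF assms(1-4)]) (use assms(7) in auto)
  show "(\<lambda>z. path_frame (\<mu> z) (\<nu> z) (\<zeta> z) (s z)) \<in> ({0..1} \<times> {0..1}) \<rightarrow> {F. symplectic_frame om F}"
    using path_frame_symplectic[OF assms(5,6)] assms(7) by auto
qed (use assms(8-11) in \<open>auto simp: pathfinish_def pathstart_def\<close>)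

section \<open>The constant trivialization is canonical\<close>

definition const_triv :: "real \<Rightarrow> (complex ^ 3) ^ (1 + 1)" where
  "const_triv t = (\<chi> i. case i of Inl _ \<Rightarrow> axis 0 (of_real (sqrt \<kappa>)) | Inr _ \<Rightarrow> axis 0 (\<i> * of_real (sqrt \<kappa>)))"

lemma const_triv_nth: "const_triv t $ Inl 1 = axis 0 (of_real (sqrt \<kappa>))"
  "const_triv t $ Inr 1 = axis 0 (\<i> * of_real (sqrt \<kappa>))"
  by (simp_all add: const_triv_def)

lemma const_triv_symplectic: "symplectic_trivialization M \<alpha> T orb const_triv"
proof -
  have sk: "sqrt \<kappa> * sqrt \<kappa> = \<kappa>" "sqrt \<kappa> \<noteq> 0" using kappa_pos by auto
  have "symplectic_frame (ext_deriv \<alpha> (orb t)) (const_triv t)" for t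
    unfolding symplectic_frame_def forall_11 const_triv_nth dalpha_orb
    using sk kappa_pos by (simp add: J0_def)
  moreover have "span (range (\<lambda>i. const_triv t $ i)) = contact_structure M \<alpha> (orb t)" for t
  proof -
    have lin: "linear (axis 0 :: complex \<Rightarrow> complex ^ 3)"
      by (auto intro!: linearI simp: vec_eq_iff axis_def)
    have "range (\<lambda>i. const_triv t $ i) = axis 0 ` {of_real (sqrt \<kappa>), \<i> * of_real (sqrt \<kappa>)}"
      unfolding UNIV_11 by (simp add: const_triv_nth)
    moreover have "span {of_real (sqrt \<kappa>), \<i> * of_real (sqrt \<kappa>)} = (UNIV :: complex set)"
    proof -
      have "z \<in> span {of_real (sqrt \<kappa>), \<i> * of_real (sqrt \<kappa>)}" for z
      proof -
        have "z = (Re z / sqrt \<kappa>) *\<^sub>R of_real (sqrt \<kappa>) + (Im z / sqrt \<kappa>) *\<^sub>R (\<i> * of_real (sqrt \<kappa>))"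
          using sk(2) by (simp add: complex_eq_iff)
        moreover have "\<dots> \<in> span {of_real (sqrt \<kappa>), \<i> * of_real (sqrt \<kappa>)}"
          by (intro span_add span_scale span_base) auto
        ultimately show ?thesis by (simp only:)
      qed
      then show ?thesis by blast
    qed
    ultimately have "span (range (\<lambda>i. const_triv t $ i)) = range (axis 0)"
      by (simp only: linear_span_image[OF lin])
    also have "\<dots> = contact_structure M \<alpha> (orb t)"
      unfolding orb_def by (rule contact_structure_axis[symmetric]) (use j0 in auto)
    finally show ?thesis .
  qed
  moreover have "const_triv = (\<lambda>t. const_triv 0)" by (simp add: const_triv_def fun_eq_iff)
  then have "continuous_on UNIV const_triv" by (metis continuous_on_const)
  ultimately show ?thesis by (simp add: symplectic_trivialization_def const_triv_def)
qed

lemma const_triv_canonical: "canonical_trivialization n \<epsilon> T orb const_triv"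
proof -
  define x where "x t = cis (2 * a * (T * t))" for t
  let ?q = "sqrt (2 * a)" and ?Q = "{0..1::real} \<times> {0..1::real}"
  have x1: "x 0 = 1" "x 1 = 1"
  proof -
    have "2 * a * T = 2 * pi * of_int (int N)" using a_pos by (simp add: T_def)
    then show "x 1 = 1" unfolding x_def using cis_eq_1_int by (metis mult.right_neutral)
  qed (simp add: x_def)
  have s0: "?q > 0" using a_pos by simp
  have ka: "sqrt \<kappa> / sqrt a = sqrt (2 / (real n + 1))"
    using a_pos by (simp add: \<kappa>_def real_sqrt_divide[symmetric])
  have smul: "\<i> *s axis l y = axis l (\<i> * y)" for l :: 3 and y :: complex
    by (simp add: vec_eq_iff axis_def)
  have scale: "r *\<^sub>R axis l y = axis l (of_real r * y)" for l :: 3 and y :: complex and r :: real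
    by (simp add: vec_eq_iff axis_def scaleR_conv_of_real[of r "_ :: complex"])
  have ax0: "axis l 0 = (0 :: complex ^ 3)" for l by (simp add: vec_eq_iff axis_def)
  have start: "sum_frame n \<epsilon> (orb (T * t)) (const_triv (T * t)) = path_frame (cnj (x t)) 0 1 ?q" for t
  proof -
    have "Im (cnj (complex_of_real (sqrt \<kappa>)) * (\<i> * of_real (sqrt \<kappa>))) = \<kappa>"
      using kappa_pos by simp
    note eq = sum_frame_orb[OF const_triv_nth this x_def[of t]]
    have c: "complex_of_real (sqrt \<kappa>) / of_real (sqrt a) = of_real (sqrt (2 / (real n + 1)))"
      unfolding of_real_divide[symmetric] ka ..
    have c': "\<i> * complex_of_real (sqrt \<kappa>) / of_real (sqrt a) = \<i> * of_real (sqrt (2 / (real n + 1)))"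
      unfolding times_divide_eq_right[symmetric] c ..
    show ?thesis
      unfolding eq c c' path_frame_def Let_def
      by (simp add: smul scale ax0 divide_inverse mult_ac)
  qed
  \<comment> \<open>The vector in direction \<open>k\<close>, with its rotating phase, is turned
    into direction \<open>j\<close>: the cosine extinguishes the phase. Meanwhile \<zeta> moves from
    1 to -1, so that the last pair ends at 1 and \<i> in direction \<open>k\<close>, and the
    stretching factor returns to 1.\<close>
  define A where "A z = complex_of_real (cos (pi / 2 * fst z)) * cnj (x (snd z))" for z :: "real \<times> real"
  define B where "B z = complex_of_real (sin (pi / 2 * fst z))" for z :: "real \<times> real"
  define Z where "Z z = cis (pi * fst z)" for z :: "real \<times> real"
  define S where "S z = (1 - fst z) * ?q + fst z" for z :: "real \<times> real"
  have "homotopic_loops {F. symplectic_frame om F}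
    (\<lambda>t. path_frame (A (0, t)) (B (0, t)) (Z (0, t)) (S (0, t)))
    (\<lambda>t. path_frame (A (1, t)) (B (1, t)) (Z (1, t)) (S (1, t)))"
  proof (rule homotopic_path_frames)
    show "continuous_on ?Q A" "continuous_on ?Q B" "continuous_on ?Q Z" "continuous_on ?Q S"
      unfolding A_def B_def Z_def S_def x_def by (intro continuous_intros)+
    show "(cmod (A (u, t)))\<^sup>2 + (cmod (B (u, t)))\<^sup>2 = 1" for u t
      by (simp add: A_def B_def x_def norm_mult)
    show "S (u, t) > 0" if "u \<in> {0..1}" for u t
    proof (cases "u = 1")
      case False
      then have "(1 - u) * ?q > 0" using that s0 by (intro mult_pos_pos) auto
      then show ?thesis using that by (simp add: S_def)
    qed (simp add: S_def)
  qed (simp_all add: A_def B_def Z_def S_def x1)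
  then have 1: "homotopic_loops {F. symplectic_frame om F}
    (\<lambda>t. sum_frame n \<epsilon> (orb (T * t)) (const_triv (T * t))) (\<lambda>t. path_frame 0 1 (- 1) 1)"
    by (simp add: A_def B_def Z_def S_def start)
  have cf: "constant_frame n = (if j = 1 then path_frame 0 1 (- 1) 1 else path_frame 1 0 1 1)"
  proof -
    have "(real n + 1) / 2 * Im (cnj 1 * \<i>) = (real n + 1) / 2" "Im (cnj 1 * \<i>) = 1" by simp_all
    then have n0: "symp_normalize om (axis 0 1) (axis 0 \<i>) =
        (axis 0 (of_real (sqrt (2 / (real n + 1)))), axis 0 (\<i> * of_real (sqrt (2 / (real n + 1)))))"
      unfolding symp_normalize_def om_axis(1) scale
      by (simp add: real_sqrt_divide field_simps)
    have nl: "symp_normalize om (axis l 1) (axis l \<i>) = (axis l 1, axis l \<i>)" if "l \<noteq> 0" for l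
      unfolding symp_normalize_def om_axis(2)[OF that] by simp
    let ?E = "(axis 0 (of_real (sqrt (2 / (real n + 1)))), axis 0 (\<i> * of_real (sqrt (2 / (real n + 1)))))"
    have neg: "0 - axis l (- y) = axis l y" for l :: 3 and y :: complex
      by (simp add: vec_eq_iff axis_def)
    have "path_frame 0 1 (- 1) 1 = pairs_frame ?E (axis j 1, axis j \<i>) (axis k 1, axis k \<i>)"
      by (simp add: path_frame_def Let_def ax0 neg[simplified] smul)
    moreover have "path_frame 1 0 1 1 = pairs_frame ?E (axis k 1, axis k \<i>) (axis j 1, axis j \<i>)"
      by (simp add: path_frame_def Let_def ax0 smul)
    moreover have "constant_frame n = pairs_frame ?E (axis 1 1, axis 1 \<i>) (axis 2 1, axis 2 \<i>)"
      unfolding constant_frame_def Let_def omega_1_eq_wIm n0 by (simp add: nl)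
    ultimately show ?thesis using jk by auto
  qed
  \<comment> \<open>For \<open>j = 2\<close> the first homotopy ends with the pairs of the
    coordinates 1 and 2 interchanged; a quarter turn restores the order of the constant
    frame.\<close>
  have 2: "homotopic_loops {F. symplectic_frame om F} (\<lambda>t. path_frame 0 1 (- 1) 1) (\<lambda>t. path_frame 1 0 1 1)"
  proof -
    define A' where "A' z = complex_of_real (sin (pi / 2 * fst z))" for z :: "real \<times> real"
    define B' where "B' z = complex_of_real (cos (pi / 2 * fst z))" for z :: "real \<times> real"
    define Z' where "Z' z = - cis (pi * fst z)" for z :: "real \<times> real"
    have "homotopic_loops {F. symplectic_frame om F}
      (\<lambda>t. path_frame (A' (0, t)) (B' (0, t)) (Z' (0, t)) ((\<lambda>_. 1) (0 :: real, t)))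
      (\<lambda>t. path_frame (A' (1, t)) (B' (1, t)) (Z' (1, t)) ((\<lambda>_. 1) (1 :: real, t)))"
    proof (rule homotopic_path_frames)
      show "continuous_on ?Q A'" "continuous_on ?Q B'" "continuous_on ?Q Z'" "continuous_on ?Q (\<lambda>_. 1 :: real)"
        unfolding A'_def B'_def Z'_def by (intro continuous_intros)+
    qed (simp_all add: A'_def B'_def Z'_def)
    then show ?thesis by (simp add: A'_def B'_def Z'_def)
  qed
  have "homotopic_loops {F. symplectic_frame om F}
    (\<lambda>t. sum_frame n \<epsilon> (orb (T * t)) (const_triv (T * t))) (\<lambda>t. constant_frame n)"
  proof (cases "j = 1")
    case True
    then have "constant_frame n = path_frame 0 1 (- 1) 1" unfolding cf by (rule if_P)
    then show ?thesis using 1 by (simp only:)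
  next
    case False
    then have "constant_frame n = path_frame 1 0 1 1" unfolding cf by (rule if_not_P)
    then show ?thesis using homotopic_loops_trans[OF 1 2] by (simp only:)
  qed
  then show ?thesis
    using const_triv_symplectic by (simp add: canonical_trivialization_def omega_1_eq_wIm)
qed

lemma canonical_cz_index: "has_canonical_cz_index n \<epsilon> T orb (2 * \<lfloor>2 * real N / ((real n + 1) * a)\<rfloor> + 1)"
  unfolding has_canonical_cz_index_def using const_triv_canonical cz_canonical by blast

end

text \<open>The remaining floor terms of the formula cancel, as \<open>N (2 - a) / a = 2 N / a - N\<close>.\<close>

lemma floor_formula:
  assumes "a > 0"
  shows "2 * (m + \<lfloor>real N * (2 - a) / a\<rfloor> - \<lfloor>2 * real N / a\<rfloor>) + 2 * int N + 1 = 2 * m + 1"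
proof -
  have "real N * (2 - a) / a = 2 * real N / a - of_int (int N)" using assms by (simp add: field_simps)
  then have "\<lfloor>real N * (2 - a) / a\<rfloor> = \<lfloor>2 * real N / a\<rfloor> - int N" by (simp only: floor_diff_of_int)
  then show ?thesis by simp
qed

theorem theorem1p1:
  fixes n :: nat and \<epsilon> :: real
  assumes "1 \<le> n" and "0 < \<epsilon>" and "\<epsilon> < 1" and "\<epsilon> \<notin> \<rat>"
  shows
    "nondegenerate_contact_form (link_A n) (alpha_eps n \<epsilon>) \<and>
     contactomorphic (link_A n) alpha_0 (link_A n) (alpha_eps n \<epsilon>) \<and>
     (\<forall>T \<gamma>. simple_reeb_orbit (link_A n) (alpha_eps n \<epsilon>) T \<gamma> \<longleftrightarrow>
        (T = pi / (1 + \<epsilon>) \<and> (\<exists>s. \<forall>t. \<gamma> t = gamma_plus \<epsilon> (t + s))) \<or>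
        (T = pi / (1 - \<epsilon>) \<and> (\<exists>s. \<forall>t. \<gamma> t = gamma_minus \<epsilon> (t + s)))) \<and>
     (\<forall>N::nat. 1 \<le> N \<longrightarrow>
        has_canonical_cz_index n \<epsilon> (real N * pi / (1 + \<epsilon>)) (gamma_plus \<epsilon>)
          (2 * (\<lfloor>2 * real N / ((real n + 1) * (1 + \<epsilon>))\<rfloor>
                + \<lfloor>real N * (1 - \<epsilon>) / (1 + \<epsilon>)\<rfloor>
                - \<lfloor>2 * real N / (1 + \<epsilon>)\<rfloor>) + 2 * int N + 1) \<and>
        has_canonical_cz_index n \<epsilon> (real N * pi / (1 - \<epsilon>)) (gamma_minus \<epsilon>)
          (2 * (\<lfloor>2 * real N / ((real n + 1) * (1 - \<epsilon>))\<rfloor>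
                + \<lfloor>real N * (1 + \<epsilon>) / (1 - \<epsilon>)\<rfloor>
                - \<lfloor>2 * real N / (1 - \<epsilon>)\<rfloor>) + 2 * int N + 1))"
proof -
  interpret irrational_link n \<epsilon> using assms by unfold_locales
  have simple: "simple_reeb_orbit (link_A n) (alpha_eps n \<epsilon>) T \<gamma> \<longleftrightarrow>
        (T = pi / (1 + \<epsilon>) \<and> (\<exists>s. \<forall>t. \<gamma> t = gamma_plus \<epsilon> (t + s))) \<or>
        (T = pi / (1 - \<epsilon>) \<and> (\<exists>s. \<forall>t. \<gamma> t = gamma_minus \<epsilon> (t + s)))" for T \<gamma>
  proof -
    have "(\<exists>j :: 3. j \<noteq> 0 \<and> P j) \<longleftrightarrow> P 1 \<or> P 2" for P
      using forall_UNIV_3[of "\<lambda>j. \<not> (j \<noteq> 0 \<and> P j)"] by auto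
    then show ?thesis
      unfolding simple_orbit_iff by (simp add: amp_def gamma_plus_def gamma_minus_def)
  qed
  have "has_canonical_cz_index n \<epsilon> (real N * pi / (1 + \<epsilon>)) (gamma_plus \<epsilon>)
          (2 * (\<lfloor>2 * real N / ((real n + 1) * (1 + \<epsilon>))\<rfloor> + \<lfloor>real N * (1 - \<epsilon>) / (1 + \<epsilon>)\<rfloor>
                - \<lfloor>2 * real N / (1 + \<epsilon>)\<rfloor>) + 2 * int N + 1)" if N: "1 \<le> N" for N
  proof -
    interpret axis_orbit n \<epsilon> 1 2 N using N by unfold_locales auto
    have "a = 1 + \<epsilon>" "orb = gamma_plus \<epsilon>" by (simp_all add: a_def amp_def orb_def gamma_plus_def fun_eq_iff)
    moreover have "2 - (1 + \<epsilon>) = 1 - \<epsilon>" by simp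
    moreover note canonical_cz_index[folded floor_formula[OF a_pos, of "\<lfloor>2 * real N / ((real n + 1) * a)\<rfloor>" N], unfolded T_def]
    ultimately show ?thesis by (simp only:)
  qed
  moreover have "has_canonical_cz_index n \<epsilon> (real N * pi / (1 - \<epsilon>)) (gamma_minus \<epsilon>)
          (2 * (\<lfloor>2 * real N / ((real n + 1) * (1 - \<epsilon>))\<rfloor> + \<lfloor>real N * (1 + \<epsilon>) / (1 - \<epsilon>)\<rfloor>
                - \<lfloor>2 * real N / (1 - \<epsilon>)\<rfloor>) + 2 * int N + 1)" if N: "1 \<le> N" for N
  proof -
    interpret axis_orbit n \<epsilon> 2 1 N using N by unfold_locales auto
    have "a = 1 - \<epsilon>" "orb = gamma_minus \<epsilon>" by (simp_all add: a_def amp_def orb_def gamma_minus_def fun_eq_iff)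
    moreover have "2 - (1 - \<epsilon>) = 1 + \<epsilon>" by simp
    moreover note canonical_cz_index[folded floor_formula[OF a_pos, of "\<lfloor>2 * real N / ((real n + 1) * a)\<rfloor>" N], unfolded T_def]
    ultimately show ?thesis by (simp only:)
  qed
  ultimately show ?thesis
    using nondegenerate contactomorphic_link[OF assms(1-3)] simple by blast
qed

end
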